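(* Let $\delta, K_1, K_2, C_0, C_1$ be admissible parameters. Let $\overrightarrow{\mathcal{A}}^\delta_{K_1,K_2,C_0,C_1}$ be the class of all structures $(V,\le,R^1,\dots,R^\delta)$ such that $(V,R^1,\dots,R^\delta)\in\mathcal{A}^\delta_{K_1,K_2,C_0,C_1}$ and $\le$ is an arbitrary linear order of $V$. Then $\overrightarrow{\mathcal{A}}^\delta_{K_1,K_2,C_0,C_1}$ has the Ramsey property, and it has the expansion property with respect to $\mathcal{A}^\delta_{K_1,K_2,C_0,C_1}$.
   Context: A $\delta$-valued metric space $(V,d)$ (a metric space with distances in $\{0,1,\dots,\delta\}$) is identified with the relational structure $(V,R^1,\dots,R^\delta)$ where $(x,y)\in R^i$ iff $d(x,y)=i$. Parameters $\delta,K_1,K_2,C_0,C_1$ are positive integers; they are acceptable if $3\le\delta<\infty$, $1\le K_1\le K_2\le\delta$, $2\delta+2\le C_0,C_1\le 3\delta+2$, $C_0$ even and $C_1$ odd. Write $C=\min(C_0,C_1)$, $C'=\max(C_0,C_1)$. They are admissible if acceptable and one of the following holds: (II) $C\le 2\delta+K_1$, $C=2K_1+2K_2+1$, $K_1+K_2\ge\delta$, $K_1+2K_2\le 2\delta-1$, and either (IIA) $C'=C+1$, or (IIB) $C'>C+1$, $K_1=K_2$ and $3K_2=2\delta-1$; or (III) $C\ge 2\delta+K_1+1$, $K_1+2K_2\ge 2\delta-1$, $3K_2\ge 2\delta$, if $K_1+2K_2=2\delta-1$ then $C\ge 2\delta+K_1+2$, and if $C'>C+1$ then $C\ge 2\delta+K_2$.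 The class $\mathcal{A}^\delta_{K_1,K_2,C_0,C_1}$ consists of all finite $\delta$-valued metric spaces such that for every three distinct points $u,v,w$, with $p=d(u,v)+d(v,w)+d(u,w)$ and $m=\min\{d(u,v),d(v,w),d(u,w)\}$: if $p$ is odd then $2K_1<p$, $p<2K_2+2m$ and $p<C_1$; if $p$ is even then $p<C_0$. An embedding is an injective map preserving all relations and non-relations. A class $\mathcal{K}$ of finite structures has the Ramsey property if for all $\mathbf{A},\mathbf{B}\in\mathcal{K}$ and $k\ge1$ there is $\mathbf{C}\in\mathcal{K}$ such that for every colouring of the set of embeddings $\mathbf{A}\to\mathbf{C}$ with $k$ colours there is an embedding $\beta:\mathbf{B}\to\mathbf{C}$ such that $\beta\circ\alpha_1$ and $\beta\circ\alpha_2$ have the same colour for all embeddings $\alpha_1,\alpha_2:\mathbf{A}\to\mathbf{B}$. An ordered class $\mathcal{K}^+$ whose structures are expansions (same vertex set and relations, plus the extra order) of structures in $\mathcal{K}$ has the expansion property with respect to $\mathcal{K}$ if for every $\mathbf{B}\in\mathcal{K}$ there is $\mathbf{C}\in\mathcal{K}$ such that for every $\mathbf{B}^+\in\mathcal{K}^+$ expanding $\mathbf{B}$ and every $\mathbf{C}^+\in\mathcal{K}^+$ expanding $\mathbf{C}$ there is an embedding $\mathbf{B}^+\to\mathbf{C}^+$. *)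

theory Defs
  imports "HOL-Analysis.Abstract_Metric_Spaces" "HOL-Library.Infinite_Typeclass"
begin

text \<open>Relational structures with binary relations indexed by symbols of type \<open>'s\<close> and with
  vertices in the type \<open>'a\<close>.  A class of structures is a set of structures over one fixed
  vertex type; for infinite \<open>'a\<close> every finite structure has an isomorphic copy over \<open>'a\<close>.\<close>

record ('s, 'a) struct =
  verts :: "'a set"
  rels :: "'s \<Rightarrow> ('a \<times> 'a) set"

text \<open>Embeddings are extensional functions, so that maps agreeing on the vertices of \<open>A\<close>
  are equal and receive the same colour.\<close>

definition embeddings :: "('s, 'a) struct \<Rightarrow> ('s, 'b) struct \<Rightarrow> ('a \<Rightarrow> 'b) set" where
  "embeddings A B = {f \<in> verts A \<rightarrow>\<^sub>E verts B. inj_on f (verts A) \<and>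
     (\<forall>s. \<forall>x\<in>verts A. \<forall>y\<in>verts A. (x, y) \<in> rels A s \<longleftrightarrow> (f x, f y) \<in> rels B s)}"

definition ramsey_property :: "('s, 'a) struct set \<Rightarrow> bool" where
  "ramsey_property \<K> \<longleftrightarrow>
     (\<forall>A\<in>\<K>. \<forall>B\<in>\<K>. \<forall>k\<ge>(1::nat). \<exists>C\<in>\<K>.
        \<forall>c \<in> embeddings A C \<rightarrow> {..<k}.
          \<exists>\<beta>\<in>embeddings B C. \<forall>\<alpha>\<^sub>1\<in>embeddings A B. \<forall>\<alpha>\<^sub>2\<in>embeddings A B.
            c (compose (verts A) \<beta> \<alpha>\<^sub>1) = c (compose (verts A) \<beta> \<alpha>\<^sub>2))"

datatype 's with_order = Leq | Sym 's

definition reduct :: "('s with_order, 'a) struct \<Rightarrow> ('s, 'a) struct" where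
  "reduct S = \<lparr>verts = verts S, rels = (\<lambda>s. rels S (Sym s))\<rparr>"

definition expansion_property ::
  "('s with_order, 'a) struct set \<Rightarrow> ('s, 'a) struct set \<Rightarrow> bool" where
  "expansion_property \<K>' \<K> \<longleftrightarrow>
     (\<forall>B\<in>\<K>. \<exists>C\<in>\<K>. \<forall>B'\<in>\<K>'. \<forall>C'\<in>\<K>'.
        reduct B' = B \<longrightarrow> reduct C' = C \<longrightarrow> embeddings B' C' \<noteq> {})"

definition order_expansions :: "('s, 'a) struct set \<Rightarrow> ('s with_order, 'a) struct set" where
  "order_expansions \<K> = {S. reduct S \<in> \<K> \<and> linear_order_on (verts S) (rels S Leq)}"

text \<open>The locale \<^locale>\<open>Metric_space\<close> requires symmetry of \<open>d\<close> also outside \<open>V\<close>.  This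
  is no restriction below, since \<open>metric_struct\<close> depends only on the values of \<open>d\<close> on \<open>V\<close>.\<close>

definition valued_metric :: "nat \<Rightarrow> 'a set \<Rightarrow> ('a \<Rightarrow> 'a \<Rightarrow> nat) \<Rightarrow> bool" where
  "valued_metric \<delta> V d \<longleftrightarrow>
     Metric_space V (\<lambda>x y. real (d x y)) \<and> (\<forall>x\<in>V. \<forall>y\<in>V. d x y \<le> \<delta>)"

text \<open>The symbols are all natural numbers; those outside \<open>{1..\<delta>}\<close> are always interpreted by
  the empty relation, which makes them irrelevant for embeddings and reducts.\<close>

definition metric_struct :: "nat \<Rightarrow> 'a set \<Rightarrow> ('a \<Rightarrow> 'a \<Rightarrow> nat) \<Rightarrow> (nat, 'a) struct" where
  "metric_struct \<delta> V d =
     \<lparr>verts = V,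
      rels = (\<lambda>i. if i \<in> {1..\<delta>} then {(x, y). x \<in> V \<and> y \<in> V \<and> d x y = i} else {})\<rparr>"

definition acceptable :: "nat \<Rightarrow> nat \<Rightarrow> nat \<Rightarrow> nat \<Rightarrow> nat \<Rightarrow> bool" where
  "acceptable \<delta> K1 K2 C0 C1 \<longleftrightarrow>
     3 \<le> \<delta> \<and> 1 \<le> K1 \<and> K1 \<le> K2 \<and> K2 \<le> \<delta> \<and>
     2 * \<delta> + 2 \<le> C0 \<and> C0 \<le> 3 * \<delta> + 2 \<and> 2 * \<delta> + 2 \<le> C1 \<and> C1 \<le> 3 * \<delta> + 2 \<and>
     even C0 \<and> odd C1"

definition admissible_II :: "nat \<Rightarrow> nat \<Rightarrow> nat \<Rightarrow> nat \<Rightarrow> nat \<Rightarrow> bool" where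
  "admissible_II \<delta> K1 K2 C0 C1 \<longleftrightarrow>
     (let C = min C0 C1; C' = max C0 C1 in
        C \<le> 2 * \<delta> + K1 \<and> C = 2 * K1 + 2 * K2 + 1 \<and> K1 + K2 \<ge> \<delta> \<and> K1 + 2 * K2 \<le> 2 * \<delta> - 1 \<and>
        (C' = C + 1 \<or> C' > C + 1 \<and> K1 = K2 \<and> 3 * K2 = 2 * \<delta> - 1))"

definition admissible_III :: "nat \<Rightarrow> nat \<Rightarrow> nat \<Rightarrow> nat \<Rightarrow> nat \<Rightarrow> bool" where
  "admissible_III \<delta> K1 K2 C0 C1 \<longleftrightarrow>
     (let C = min C0 C1; C' = max C0 C1 in
        C \<ge> 2 * \<delta> + K1 + 1 \<and> K1 + 2 * K2 \<ge> 2 * \<delta> - 1 \<and> 3 * K2 \<ge> 2 * \<delta> \<and>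
        (K1 + 2 * K2 = 2 * \<delta> - 1 \<longrightarrow> C \<ge> 2 * \<delta> + K1 + 2) \<and>
        (C' > C + 1 \<longrightarrow> C \<ge> 2 * \<delta> + K2))"

definition admissible :: "nat \<Rightarrow> nat \<Rightarrow> nat \<Rightarrow> nat \<Rightarrow> nat \<Rightarrow> bool" where
  "admissible \<delta> K1 K2 C0 C1 \<longleftrightarrow>
     acceptable \<delta> K1 K2 C0 C1 \<and> (admissible_II \<delta> K1 K2 C0 C1 \<or> admissible_III \<delta> K1 K2 C0 C1)"

definition allowed_triangle :: "nat \<Rightarrow> nat \<Rightarrow> nat \<Rightarrow> nat \<Rightarrow> nat \<Rightarrow> nat \<Rightarrow> nat \<Rightarrow> bool" where
  "allowed_triangle K1 K2 C0 C1 a b c \<longleftrightarrow>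
     (let p = a + b + c; m = min a (min b c) in
        (odd p \<longrightarrow> 2 * K1 < p \<and> p < 2 * K2 + 2 * m \<and> p < C1) \<and>
        (even p \<longrightarrow> p < C0))"

definition metric_class :: "nat \<Rightarrow> nat \<Rightarrow> nat \<Rightarrow> nat \<Rightarrow> nat \<Rightarrow> (nat, 'a) struct set" where
  "metric_class \<delta> K1 K2 C0 C1 =
     {metric_struct \<delta> V d | V d. finite V \<and> valued_metric \<delta> V d \<and>
        (\<forall>u\<in>V. \<forall>v\<in>V. \<forall>w\<in>V. u \<noteq> v \<and> v \<noteq> w \<and> u \<noteq> w \<longrightarrow>
           allowed_triangle K1 K2 C0 C1 (d u v) (d v w) (d u w))}"

definition ordered_metric_class ::
  "nat \<Rightarrow> nat \<Rightarrow> nat \<Rightarrow> nat \<Rightarrow> nat \<Rightarrow> (nat with_order, 'a) struct set" where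
  "ordered_metric_class \<delta> K1 K2 C0 C1 = order_expansions (metric_class \<delta> K1 K2 C0 C1)"

end

theory Submission
  imports Defs "HOL-Library.Ramsey"
begin

text \<open>A missing distance of a partial space is controlled by the words labelling paths between its
  ends.  Call a closed word good if it can be triangulated by allowed triangles; as two allowed
  triangles with a common edge amalgamate, goodness does not depend on the triangulation, and good
  closed walks can be glued along a vertex or an edge.  Fix a magic distance \<open>M\<close>: all triangles
  \<open>M, M, a\<close> are allowed.  Two edges \<open>a\<close>, \<open>b\<close> at a common vertex force a third distance only if one of
  \<open>\<bar>a - b\<bar> > M\<close>, \<open>a + b < M\<close>, \<open>C - 1 - a - b < M\<close> holds.  Iterating these forks reaches only paths of
  bounded length, and giving every pair the strongest forced value, or \<open>M\<close> if there is none,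
  completes every graph whose closed walks of bounded length are good to a space of the class.

  For the Ramsey property, let all closed walks of length at most \<open>l\<close> be good in an edge-labelled
  graph \<open>Q\<close> with \<open>Q \<longrightarrow> (B)\<^sup>A\<close>.  The partite construction over \<open>Q\<close>, with fibre powers and the
  Hales-Jewett theorem as partite lemma, yields such a graph for length \<open>l + 1\<close>: a closed walk of the new
  graph either projects to an earlier picture, or a chord of a copy of \<open>A\<close> cuts its projection to \<open>Q\<close>
  into two shorter closed walks.  The induction starts with Ramsey's theorem.

  The expansion property follows from the Ramsey property for a pair of points at distance \<open>M\<close>: an
  order of \<open>C\<close> agrees with, or reverses, the given order on all such pairs of a copy of a space in
  which any two points of \<open>B\<close> are separated by a point at distance \<open>M\<close> from both.\<close>

section \<open>Magic distances and forks\<close>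

text \<open>The obstacle is parity. Completing by shortest paths would control distances up to
  inequalities, but the bounds by \<open>K1\<close>, \<open>K2\<close>, \<open>C0\<close>,
  \<open>C1\<close> depend on whether a perimeter is odd. A forced value therefore also fixes parity
  where these bounds are tight, and a triangle of forced values is judged by comparing it with a
  triangle of actual distances that realise them. Precedence among forced values runs inwards from
  \<delta> and from 1 towards \<open>M\<close>, alternating between the two sides; this is the order
  in which every fork yields a later value. The retriangulation \<open>flip\<close> is associativity
  of composing distances. Through it, all that the partite construction has to know about metrics is
  the short list of closure rules in \<open>gluing\<close>, and no list of forbidden cycles is
  computed. Distances are completed without regard to the order: the order travels through the
  projections as a rank and is made linear only at the end.\<close>

definition allowed :: "nat \<Rightarrow> nat \<Rightarrow> nat \<Rightarrow> nat \<Rightarrow> nat \<Rightarrow> nat \<Rightarrow> nat \<Rightarrow> bool" where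
 "allowed K1 K2 C0 C1 a b c \<longleftrightarrow> a \<le> b + c \<and> b \<le> a + c \<and> c \<le> a + b \<and>
   (odd (a+b+c) \<longrightarrow> 2*K1 < a+b+c \<and> a+b < 2*K2+c \<and> a+c < 2*K2+b \<and> b+c < 2*K2+a \<and> a+b+c < C1) \<and>
   (even (a+b+c) \<longrightarrow> a+b+c < C0)"

text \<open>\<open>M\<close> is a magic distance and \<open>C\<close> the minimum of \<open>C0\<close> and \<open>C1\<close>.  The flag marks the case (IIB), the
  only one in which the fork \<open>\<delta>, \<delta>\<close> can be completed on both sides of \<open>M\<close>, but not by \<open>M\<close>.\<close>

locale magic =
  fixes \<delta> K1 K2 C0 C1 M C :: nat and IIB :: bool
  assumes acc: "3 \<le> \<delta>" "1 \<le> K1" "K1 \<le> K2" "K2 \<le> \<delta>" "2 * \<delta> + 2 \<le> C" "C \<le> C0" "C \<le> C1" "C = C0 \<or> C = C1" and par: "even C0" "odd C1"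
    and M: "K1 \<le> M" "M \<le> K2" "\<delta> \<le> 2 * M" "2 * M + \<delta> < C"
    and IIB: "IIB \<Longrightarrow> K1 = M \<and> K2 = M \<and> 3 * M + 1 = 2 * \<delta> \<and> C = 4*M+1 \<and> C1 = C \<and> odd M \<and> M \<ge> 3"
    and adm: "IIB \<or>
      (((C0 \<le> C+1 \<and> C1 \<le> C + 1 \<and> odd C \<and> C = 2*K1+2*K2+1 \<and> C \<le> 2*\<delta>+K1 \<and> \<delta> \<le> K1 + K2 \<and> K1 + 2*K2 < 2*\<delta>) \<or>
       (C \<ge> 2*\<delta>+K1+1 \<and> 2*\<delta> \<le> K1 + 2*K2 + 1 \<and> 2*\<delta> \<le> 3*K2
        \<and> (K1 + 2*K2 + 1 = 2*\<delta> \<longrightarrow> C \<ge> 2*\<delta>+K1+2 \<and> K1 < M)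
        \<and> ((C0 \<le> C+1 \<and> C1 \<le> C + 1) \<or> (C \<ge> 2*\<delta>+K2 \<and> (C=2*\<delta>+K2 \<longrightarrow> M < K2))))))"
begin

abbreviation tri :: "nat \<Rightarrow> nat \<Rightarrow> nat \<Rightarrow> bool" where
  "tri \<equiv> allowed K1 K2 C0 C1"

text \<open>What a forced value \<open>m\<close> says about the distance \<open>x\<close> of the two points in any space of the class:
  \<open>x\<close> lies on the same side of \<open>M\<close> and at least as far from it, with the parity of \<open>m\<close> if \<open>m\<close> is extreme.
  In case (IIB) the value \<open>M - 1\<close> may come from the fork \<open>\<delta>, \<delta>\<close>, and then only the parity is known.\<close>

definition realises :: "nat \<Rightarrow> nat \<Rightarrow> bool" where
 "realises m x \<longleftrightarrow> (m < M \<longrightarrow> (if IIB \<and> m + 1 = M then even (m + x) else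
     x \<le> m \<and> (m < K1 \<or> m = K1 \<and> K1 + 2*K2 + 1 = 2*\<delta> \<longrightarrow> even (m + x)))) \<and>
   (m > M \<longrightarrow> x \<ge> m \<and> (m \<ge> K2 \<longrightarrow> even (m+x)))"

section \<open>The rules by which two edges force a third distance\<close>

lemma realises_lowD: "realises m x \<Longrightarrow> m < M \<Longrightarrow> \<not> (IIB \<and> m + 1 = M) \<Longrightarrow> x \<le> m"
  by (auto simp: realises_def)

lemma realises_evenD:
  assumes "realises m x" "m < M \<and> (m < K1 \<or> m = K1 \<and> K1 + 2*K2 + 1 = 2*\<delta>) \<or> M < m \<and> K2 \<le> m"
  shows "even x \<longleftrightarrow> even m"
  using assms unfolding realises_def by (auto split: if_splits)

lemma realises_highD: "realises m x \<Longrightarrow> M < m \<Longrightarrow> m \<le> x"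
  by (simp add: realises_def)

lemma allowed_metric: "tri x y z \<Longrightarrow> x \<le> y + z \<and> y \<le> x + z \<and> z \<le> x + y"
  by (simp add: allowed_def)
lemma allowed_odd: "tri x y z \<Longrightarrow> odd (x + y + z) \<Longrightarrow>
    2*K1 < x+y+z \<and> x+y < 2*K2+z \<and> x+z < 2*K2+y \<and> y+z < 2*K2+x \<and> x+y+z < C1"
  by (simp add: allowed_def)
lemma allowed_even: "tri x y z \<Longrightarrow> even (x + y + z) \<Longrightarrow> x+y+z < C0"
  by (simp add: allowed_def)

lemma realisesI_high: "M < m \<Longrightarrow> m \<le> x \<Longrightarrow> (m \<ge> K2 \<Longrightarrow> even x \<longleftrightarrow> even m) \<Longrightarrow> realises m x"
  by (auto simp: realises_def)

text \<open>For \<open>p \<ge> K2\<close>, a wrong parity of \<open>z\<close> would mean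
  \<open>z > p\<close> and an odd perimeter, against \<open>x + z < 2 * K2 + y\<close>. The parity
  of \<open>b\<close> is available because \<open>b \<le> \<delta> - K2\<close> is small.\<close>

lemma realises_minus:
  assumes r: "realises a x" "realises b y" "tri x y z" and p: "a = b + p" "p > M" and
    bd: "1 \<le> b" "a \<le> \<delta>" "x \<le> \<delta>" "y \<le> \<delta>" "z \<le> \<delta>"
  shows "realises p z"
proof (rule realisesI_high)
  have b: "b < M" using M p bd by linarith
  have "\<not> (IIB \<and> b + 1 = M)" using IIB p bd by linarith
  then have y: "y \<le> b" using r b realises_lowD by blast
  have x: "a \<le> x" using r p realises_highD by simp
  show z: "p \<le> z" using allowed_metric[OF r(3)] x y p by linarith
  assume K: "K2 \<le> p"
  have xa: "even x \<longleftrightarrow> even a" using realises_evenD[OF r(1)] K p by auto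
  have "y = b \<or> b < K1 \<or> b = K1 \<and> K1 + 2*K2 + 1 = 2*\<delta>" using adm IIB K p bd acc M by linarith
  then have yb: "even y \<longleftrightarrow> even b" using realises_evenD[OF r(2)] b by auto
  show "even z \<longleftrightarrow> even p"
  proof (rule ccontr)
    assume *: "even z \<noteq> even p"
    then have "p < z" using z by (metis le_neq_implies_less)
    moreover have "odd (x+y+z)" using * xa yb p by auto
    ultimately show False using allowed_odd[OF r(3)] x y p K by linarith
  qed
qed (use p in auto)

text \<open>Parity is claimed only for \<open>p \<le> K1\<close>; there an odd perimeter, being at
  most \<open>2 * p\<close>, would violate the lower bound \<open>2 * K1\<close>.\<close>

lemma realises_plus:
  assumes r: "realises a x" "realises b y" "tri x y z" and p: "p = a + b" "p < M" and
    bd: "1 \<le> a" "1 \<le> b" "x \<le> \<delta>" "y \<le> \<delta>" "z \<le> \<delta>"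
  shows "realises p z"
proof -
  have x: "x \<le> a" using realises_lowD[OF r(1)] p bd by linarith
  have y: "y \<le> b" using realises_lowD[OF r(2)] p bd by linarith
  have z: "z \<le> p" using allowed_metric[OF r(3)] x y p by linarith
  have "even z \<longleftrightarrow> even p" if "p < K1 \<or> p = K1 \<and> K1 + 2*K2 + 1 = 2*\<delta>"
  proof (rule ccontr)
    assume *: "even z \<noteq> even p"
    have "even x \<longleftrightarrow> even a" "even y \<longleftrightarrow> even b" using realises_evenD[OF r(1)] realises_evenD[OF r(2)] p bd that by force+
    then have "odd (x+y+z)" using * p by auto
    then show False using allowed_odd[OF r(3)] x y z p that by linarith
  qed
  then show ?thesis using IIB p z unfolding realises_def by auto
qed

text \<open>The rule with \<open>p < M\<close> occurs only under the flag, where it means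
  \<open>a = b = \<delta>\<close> and no odd \<open>z\<close> closes the fork, or when
  \<open>C0\<close> and \<open>C1\<close> differ by one; then every perimeter is below
  \<open>C\<close>.\<close>

lemma realises_C:
  assumes r: "realises a x" "realises b y" "tri x y z" and p: "p + a + b + 1 = C" "p < M" and
    bd: "a \<le> \<delta>" "b \<le> \<delta>" "x \<le> \<delta>" "y \<le> \<delta>" "z \<le> \<delta>"
  shows "realises p z"
proof -
  have a: "a > M" "b > M" using p M bd by linarith+
  have x: "a \<le> x" "b \<le> y" using realises_highD r a by auto
  show ?thesis
  proof (cases IIB)
    case True
    then have "K1 = M" "K2 = M" "3 * M + 1 = 2 * \<delta>" "C = 4*M+1" "C1 = C" "odd M" using IIB by auto
    moreover from this have "p + 1 = M" "x = \<delta>" "y = \<delta>" using x p bd by linarith+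
    moreover have "even z"
      using allowed_odd[OF r(3)] calculation by (cases "even z") auto
    ultimately show ?thesis using True p unfolding realises_def by auto
  next
    case False
    then have C: "C0 \<le> C+1" "C1 \<le> C+1" using adm p M bd by linarith+
    have lt: "x + y + z < C"
      using allowed_even[OF r(3)] allowed_odd[OF r(3)] acc par C by (cases "even (x+y+z)"; cases "x+y+z = C"; force)
    then have z: "z \<le> p" using x p by linarith
    moreover have "even z \<longleftrightarrow> even p" if K: "p < K1 \<or> p = K1 \<and> K1 + 2*K2 + 1 = 2*\<delta>"
    proof (rule ccontr)
      assume *: "even z \<noteq> even p"
      have C: "odd C \<and> C = 2*K1+2*K2+1 \<and> \<delta> \<le> K1 + K2" using adm False K p bd acc by linarith
      then have "K2 \<le> a" "K2 \<le> b" using p bd K by linarith+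
      then have "even x \<longleftrightarrow> even a" "even y \<longleftrightarrow> even b" using realises_evenD[OF r(1)] realises_evenD[OF r(2)] a by auto
      moreover have "even (p + a + b)" using p(1) C by auto
      ultimately have "odd (x+y+z)" using * by auto
      then show False using allowed_odd[OF r(3)] x z p K C by linarith
    qed
    ultimately show ?thesis using False p unfolding realises_def by auto
  qed
qed

text \<open>A distance nearest to \<open>M\<close> among those that close the fork. For
  \<open>a\<close>, \<open>b\<close> at most \<delta> the four conditions exclude each
  other.\<close>

definition fork :: "nat \<Rightarrow> nat \<Rightarrow> nat" where
  "fork a b = (if b + M < a then a - b else if a + M < b then b - a else if a + b < M then a + b
     else if C \<le> a + b + M then C - 1 - (a + b) else M)"

lemma fork_cases:
  assumes "a \<le> \<delta>" "b \<le> \<delta>"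
  obtains (minus) "a = b + fork a b" "M < fork a b" | (minus') "b = a + fork a b" "M < fork a b"
    | (plus) "fork a b = a + b" "a + b < M" | (C) "fork a b + a + b + 1 = C" "fork a b < M" "M < a" "M < b"
    | (top) "fork a b = M" "a \<le> b + M" "b \<le> a + M" "M \<le> a + b" "a + b + M < C"
proof -
  consider "b + M < a" | "a + M < b" | "a + b < M" | "C \<le> a + b + M" "a \<le> b + M" "b \<le> a + M" "M \<le> a + b" | "a \<le> b + M" "b \<le> a + M" "M \<le> a + b" "a + b + M < C"
    by linarith
  then show ?thesis
  proof cases
    case 1
    then have "fork a b = a - b" by (simp add: fork_def)
    with 1 show ?thesis by (intro that(1)) auto
  next
    case 2
    then have "fork a b = b - a" by (simp add: fork_def)
    with 2 show ?thesis by (intro that(2)) auto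
  next
    case 3
    then have "fork a b = a + b" by (simp add: fork_def)
    with 3 show ?thesis by (intro that(3)) auto
  next
    case 4
    then have "fork a b = C - 1 - (a + b)" by (simp add: fork_def)
    then have "fork a b + a + b + 1 = C" "M < a" "M < b" using 4 assms acc M by linarith+
    with 4 show ?thesis by (intro that(4)) auto
  next
    case 5
    then have "fork a b = M" by (simp add: fork_def)
    with 5 show ?thesis by (intro that(5)) auto
  qed
qed

lemma allowed_commute: "tri x y z \<Longrightarrow> tri y x z"
  unfolding allowed_def by (auto simp: add_ac)

lemma realises_fork:
  assumes r: "realises a x" "realises b y" "tri x y z" and
    bd: "1 \<le> a" "1 \<le> b" "a \<le> \<delta>" "b \<le> \<delta>" "x \<le> \<delta>" "y \<le> \<delta>" "z \<le> \<delta>"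
  shows "realises (fork a b) z"
  using bd(3,4)
proof (cases rule: fork_cases)
  case minus
  then show ?thesis using realises_minus[OF r] bd by blast
next
  case minus'
  then show ?thesis using realises_minus[OF r(2,1) allowed_commute[OF r(3)]] bd by blast
next
  case plus
  then show ?thesis using realises_plus[OF r] bd by metis
next
  case C
  then show ?thesis using realises_C[OF r] bd by blast
next
  case top
  then show ?thesis by (simp add: realises_def)
qed

text \<open>The order in which forced values take precedence.  Forks increase it, which bounds their nesting.\<close>

definition time :: "nat \<Rightarrow> nat" where
  "time x = (if x = M then 2 * \<delta> else if x < M then 2 * x - 1 else 2 * (\<delta> - x))"

text \<open>The times order the distances as \<delta>, 1, \<delta> - 1, 2 and so on, even above
  \<open>M\<close>, odd below it, \<open>M\<close> last. The \<open>- 1\<close> in the odd times is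
  tight: the fork \<delta>, \<open>b\<close> with \<open>\<delta> - b > M\<close> gives time
  \<open>2 * b\<close>, just after the time \<open>2 * b - 1\<close> of \<open>b\<close>.\<close>

lemma time_fork:
  assumes "1 \<le> a" "1 \<le> b" "a \<le> \<delta>" "b \<le> \<delta>" "fork a b \<noteq> M"
  shows "time a < time (fork a b) \<and> time b < time (fork a b)"
  using assms(3,4)
proof (cases rule: fork_cases)
  case minus then show ?thesis using assms M unfolding time_def by auto
next
  case minus' then show ?thesis using assms M unfolding time_def by auto
next
  case plus then show ?thesis using assms M unfolding time_def by auto
next
  case C then show ?thesis using assms M acc unfolding time_def by auto
qed (use assms in auto)

lemma fork_bounds:
  assumes "1 \<le> a" "1 \<le> b" "a \<le> \<delta>" "b \<le> \<delta>"
  shows "1 \<le> fork a b \<and> fork a b \<le> \<delta>"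
  using assms(3,4) by (cases rule: fork_cases) (use assms M acc in linarith)+

text \<open>Two values other than \<open>M\<close> that are realised by the same \<open>x\<close>
  lie on the same side of \<open>M\<close>, and on one side an earlier time means farther out. The
  exception is \<open>M - 1\<close> in case (IIB), which is realised on both sides.\<close>

lemma time_le:
  assumes "realises m x" "realises n x" "time m \<le> time n" "1 \<le> m" "m \<le> \<delta>" "1 \<le> n" "n \<le> \<delta>"
  shows "n < M \<longrightarrow> m \<le> n \<or> IIB \<and> n + 1 = M \<and> M < m" "M < n \<longrightarrow> n \<le> m"
proof -
  have *: "time M = 2 * \<delta>" "\<And>x. x < M \<Longrightarrow> time x = 2 * x - 1" "\<And>x. x > M \<Longrightarrow> time x = 2 * (\<delta> - x)"
    by (auto simp: time_def)
  show "n < M \<longrightarrow> m \<le> n \<or> IIB \<and> n + 1 = M \<and> M < m"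
  proof
    assume n: "n < M"
    show "m \<le> n \<or> IIB \<and> n + 1 = M \<and> M < m"
      using realises_highD[OF assms(1)] realises_lowD[OF assms(2) n] n assms * M acc
      by (cases m M rule: linorder_cases) fastforce+
  qed
  show "M < n \<longrightarrow> n \<le> m"
  proof
    assume n: "M < n"
    consider "m < M" "\<not> (IIB \<and> m + 1 = M)" | "m < M" "IIB" "m + 1 = M" | "m = M" | "M < m" by linarith
    then show "n \<le> m"
    proof cases
      case 1 then show ?thesis using realises_lowD[OF assms(1)] realises_highD[OF assms(2) n] n by linarith
    next
      case 2 then show ?thesis using IIB assms * n by fastforce
    next
      case 3 then show ?thesis using assms * n by fastforce
    next
      case 4 then show ?thesis using assms * n by fastforce
    qed
  qed
qed

text \<open>The arithmetic content of \<open>time a \<le> time (fork b c)\<close>.\<close>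

definition side :: "nat \<Rightarrow> nat \<Rightarrow> nat \<Rightarrow> bool" where
  "side a b c \<longleftrightarrow> (c + M < b \<longrightarrow> b \<le> a + c) \<and> (b + M < c \<longrightarrow> c \<le> a + b) \<and> (b + c < M \<longrightarrow> a \<le> b + c) \<and>
    (C \<le> b + c + M \<longrightarrow> a + b + c < C \<or> IIB \<and> b = \<delta> \<and> c = \<delta> \<and> even a)"

lemma side_commute: "side a b c \<Longrightarrow> side a c b"
  unfolding side_def by (auto simp: add_ac)

lemma sideI:
  assumes r: "realises a x" "realises b y" "realises c z" "tri y z x" and t: "time a \<le> time (fork b c)"
   and bd: "1 \<le> a" "a \<le> \<delta>" "1 \<le> b" "b \<le> \<delta>" "1 \<le> c" "c \<le> \<delta>" "x \<le> \<delta>" "y \<le> \<delta>" "z \<le> \<delta>"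
  shows "side a b c"
proof -
  have o: "realises (fork b c) x" "1 \<le> fork b c" "fork b c \<le> \<delta>" using realises_fork r bd fork_bounds by auto
  note le = time_le[OF r(1) o(1) t bd(1,2) o(2,3)]
  from bd(4,6) show ?thesis
  proof (cases rule: fork_cases)
    case minus then show ?thesis using le bd M acc unfolding side_def by auto
  next
    case minus' then show ?thesis using le bd M acc unfolding side_def by auto
  next
    case plus
    have "y \<le> b" "z \<le> c" using realises_lowD[OF r(2)] realises_lowD[OF r(3)] plus bd by auto
    then have "x \<le> b + c" using allowed_metric[OF r(4)] by linarith
    then have "a \<le> M" using realises_highD[OF r(1)] plus by (cases "M < a") linarith+
    then show ?thesis using plus le bd M acc unfolding side_def by auto
  next
    case C
    show ?thesis
    proof (cases "a \<le> fork b c")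
      case True
      then show ?thesis using C bd M unfolding side_def by auto
    next
      case False
      then have *: "IIB" "fork b c + 1 = M" "M < a" using le C by auto
      note 2 = IIB[OF *(1)]
      \<comment> \<open>\<open>C = 4 * M + 1\<close> and \<open>fork b c = M - 1\<close> give
        \<open>b + c = 3 * M + 1 = 2 * \<delta>\<close>.\<close>
      have bc: "b = \<delta>" "c = \<delta>" using 2 * C bd by linarith+
      then have yz: "y = \<delta>" "z = \<delta>" using realises_highD[OF r(2)] realises_highD[OF r(3)] C bd by auto
      have "even x" using allowed_odd[OF r(4)] 2 yz by (cases "even x") auto
      moreover have "even x \<longleftrightarrow> even a" using realises_evenD[OF r(1)] 2 * by auto
      ultimately show ?thesis using * bc C bd M unfolding side_def by auto
    qed
  next
    case top then show ?thesis using bd M acc unfolding side_def by auto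
  qed
qed

section \<open>Triangles of forced values\<close>

definition triple :: "nat \<Rightarrow> nat \<Rightarrow> nat \<Rightarrow> nat \<Rightarrow> nat \<Rightarrow> nat \<Rightarrow> bool" where
  "triple a b c x y z \<longleftrightarrow> realises a x \<and> realises b y \<and> realises c z \<and> tri x y z \<and>
    side a b c \<and> side b a c \<and> side c a b \<and> 1 \<le> a \<and> 1 \<le> b \<and> 1 \<le> c \<and> a \<le> \<delta> \<and> b \<le> \<delta> \<and> c \<le> \<delta> \<and> x \<le> \<delta> \<and> y \<le> \<delta> \<and> z \<le> \<delta>"

lemma allowed_rotate: "tri x y z \<Longrightarrow> tri y z x"
  unfolding allowed_def by (auto simp: add_ac)

lemma triple_perms:
  assumes "triple a b c x y z"
  shows "triple b c a y z x" "triple b a c y x z"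
  using assms side_commute allowed_rotate allowed_commute unfolding triple_def by blast+

text \<open>A violation puts \<open>a\<close> above \<open>M\<close> and \<open>b\<close>,
  \<open>c\<close> below it. With \<open>y \<le> b\<close> and \<open>z \<le> c\<close> the triangle
  \<open>x\<close>, \<open>y\<close>, \<open>z\<close> contradicts it at once, so some short side is
  \<open>M - 1\<close> in case (IIB). This value is even and \<open>a\<close> exceeds the other
  short side by exactly \<open>M\<close>; hence the realising triangle is odd, and its odd bounds
  fail.\<close>

lemma triple_metric:
  assumes "triple a b c x y z"
  shows "a \<le> b + c"
proof (rule ccontr)
  assume n: "\<not> a \<le> b + c"
  have s: "b + c < M \<longrightarrow> a \<le> b + c" "c + M < a \<longrightarrow> a \<le> b + c" "b + M < a \<longrightarrow> a \<le> c + b"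
    and r: "realises a x" "realises b y" "realises c z" "tri x y z" and bd: "a \<le> \<delta>" "1 \<le> b" "1 \<le> c"
    using assms unfolding triple_def side_def by auto
  have a: "M < a" and bM: "b < M" and cM: "c < M" using s n by linarith+
  have x: "a \<le> x" using realises_highD r a by auto
  have "IIB \<and> (b + 1 = M \<or> c + 1 = M)"
    using realises_lowD[OF r(2) bM] realises_lowD[OF r(3) cM] allowed_metric[OF r(4)] x n by linarith
  note 2 = IIB[OF this[THEN conjunct1]] this
  have e: "even x \<longleftrightarrow> even a" "even y \<longleftrightarrow> even b" "even z \<longleftrightarrow> even c"
    using realises_evenD[OF r(1)] realises_evenD[OF r(2)] realises_evenD[OF r(3)] 2 a bM cM by auto
  have sp: False if c: "b' + 1 = M" "b' + c' < a" "a \<le> c' + M" "a \<le> b' + M" "1 \<le> c'" "c' < M"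
    "realises c' z'" "even y' \<longleftrightarrow> even b'" "even z' \<longleftrightarrow> even c'" and allowed': "tri x y' z'" and z': "x \<le> \<delta>" for b' c' y' z'
  proof -
    have ac: "a = M + c'" using c by linarith
    moreover have "even (b' + M) \<longleftrightarrow> False" using c(1) by (metis even_plus_one_iff odd_add even_add)
    ultimately have "odd (x + y' + z')" using c(8,9) e(1) by auto
    note od = allowed_odd[OF allowed' this]
    show False
    proof (cases "c' + 1 = M")
      case True
      \<comment> \<open>Two short sides \<open>M - 1\<close> give
        \<open>2 * M - 1 \<le> \<delta>\<close>, which with \<open>3 * M + 1 = 2 * \<delta>\<close>
        and \<open>M \<ge> 3\<close> leaves a single numerical case.\<close>
      then have M3: "M = 3" "\<delta> = 5" "c' = 2" "b' = 2" "a = 5" using c(1) ac bd 2 by linarith+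
      then have "x = 5" "y' = z'" "z' = 3" using od 2 x z' allowed_metric[OF allowed'] by linarith+
      then show False using c M3 by auto
    next
      case False
      then have "z' \<le> c'" using realises_lowD[OF c(7)] c by blast
      then show False using od 2 x ac c(1) allowed_metric[OF allowed'] by linarith
    qed
  qed
  show False
  proof (cases "b + 1 = M")
    case True
    then show False using sp[of b c z y] n s r(3,4) e bd a bM cM assms unfolding triple_def by auto
  next
    case False
    then show False using 2 sp[of c b y z] n s r allowed_rotate[OF allowed_commute[OF r(4)]] e bd a bM cM assms unfolding triple_def
     by (auto simp: add.commute)
  qed
qed

text \<open>In the last case \<open>2 * \<delta> + M < C\<close>, so no fork is decided by the
  perimeter. This is the purpose of demanding \<open>M < K2\<close> when
  \<open>C = 2 * \<delta> + K2\<close>.\<close>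

lemma adm_cases:
  obtains (exc) "IIB" "K1 = M" "K2 = M" "3 * M + 1 = 2 * \<delta>" "C = 4 * M + 1" "C1 = C" "C \<le> C0" "odd M" "3 \<le> M"
  | (II) "\<not> IIB" "C0 \<le> C + 1" "C1 \<le> C + 1" "odd C" "C = 2 * K1 + 2 * K2 + 1" "\<delta> \<le> K1 + K2" "K1 + 2 * K2 < 2 * \<delta>"
  | (III) "\<not> IIB" "C0 \<le> C + 1" "C1 \<le> C + 1" "2 * \<delta> + K1 < C" "2 * \<delta> \<le> 3 * K2"
      "2 * \<delta> \<le> K1 + 2 * K2 \<or> K1 + 2 * K2 + 1 = 2 * \<delta> \<and> 2 * \<delta> + K1 + 1 < C \<and> K1 < M"
  | (IIIC) "\<not> IIB" "2 * \<delta> + K2 \<le> C" "2 * \<delta> + M < C" "2 * \<delta> + K1 < C" "2 * \<delta> \<le> 3 * K2"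
      "2 * \<delta> \<le> K1 + 2 * K2 \<or> K1 + 2 * K2 + 1 = 2 * \<delta> \<and> 2 * \<delta> + K1 + 1 < C \<and> K1 < M"
proof (cases IIB)
  case True
  with IIB[OF True] acc that(1) show ?thesis by auto
next
  case False
  consider "C0 \<le> C + 1" "C1 \<le> C + 1" "odd C" "C = 2 * K1 + 2 * K2 + 1" "\<delta> \<le> K1 + K2" "K1 + 2 * K2 < 2 * \<delta>"
    | "2 * \<delta> + K1 + 1 \<le> C" "2 * \<delta> \<le> K1 + 2 * K2 + 1" "2 * \<delta> \<le> 3 * K2" "K1 + 2 * K2 + 1 = 2 * \<delta> \<longrightarrow> 2 * \<delta> + K1 + 2 \<le> C \<and> K1 < M"
      "(C0 \<le> C + 1 \<and> C1 \<le> C + 1 \<or> 2 * \<delta> + K2 \<le> C \<and> (C = 2 * \<delta> + K2 \<longrightarrow> M < K2))"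
    using adm False by blast
  then show ?thesis
  proof cases
    case 1 with False that(2) show ?thesis by blast
  next
    case 2
    then have *: "2 * \<delta> \<le> K1 + 2 * K2 \<or> K1 + 2 * K2 + 1 = 2 * \<delta> \<and> 2 * \<delta> + K1 + 1 < C \<and> K1 < M"
      "2 * \<delta> + K1 < C" by linarith+
    from 2(5) show ?thesis
    proof
      assume "C0 \<le> C + 1 \<and> C1 \<le> C + 1"
      with * 2 False that(3) show ?thesis by blast
    next
      assume 3: "2 * \<delta> + K2 \<le> C \<and> (C = 2 * \<delta> + K2 \<longrightarrow> M < K2)"
      then have "2 * \<delta> + M < C" using M by linarith
      with * 2 3 False that(4) show ?thesis by blast
    qed
  qed
qed

text \<open>A perimeter equal to \<open>C\<close> would have the parity of that one of
  \<open>C0\<close>, \<open>C1\<close> which equals \<open>C\<close>.\<close>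

lemma allowed_perimeter:
  assumes "C0 \<le> C+1" "C1 \<le> C+1" "tri x y z"
  shows "x + y + z < C"
proof (rule ccontr)
  assume n: "\<not> x + y + z < C"
  show False
  proof (cases "even (x + y + z)")
    case True
    then have "x + y + z = C" "C < C0" using allowed_even[OF assms(3)] assms n by linarith+
    then show False using True acc par by auto
  next
    case False
    then have "x + y + z = C" "C < C1" using allowed_odd[OF assms(3)] assms n by linarith+
    then show False using False acc par by auto
  qed
qed

text \<open>The bounds are inherited from \<open>x\<close>, \<open>y\<close>, \<open>z\<close>:
  apart from \<open>M - 1\<close> in case (IIB), realising a value above \<open>M\<close> enlarges
  it and realising one below \<open>M\<close> shrinks it, and near the critical bounds the parities
  agree.\<close>

lemma triple_allowed:
  assumes t: "triple a b c x y z" and le: "b \<le> a" "c \<le> b"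
  shows "tri a b c"
proof -
  note m = triple_metric[OF assms(1)]
  have r: "realises a x" "realises b y" "realises c z" "tri x y z" and s: "side a b c" "side b a c" "side c a b"
    and bd: "1 \<le> a" "1 \<le> b" "1 \<le> c" "a \<le> \<delta>" "b \<le> \<delta>" "c \<le> \<delta>" "x \<le> \<delta>" "y \<le> \<delta>" "z \<le> \<delta>"
    using t unfolding triple_def by auto
  \<comment> \<open>All sides exceed \<open>M\<close>. Either all are at least \<open>K2\<close>, so
    that the parities agree and the larger triangle \<open>x\<close>, \<open>y\<close>,
    \<open>z\<close> breaks the same one of the bounds \<open>C0\<close>, \<open>C1\<close>; or
    these differ by one, and then every perimeter is below \<open>C\<close>.\<close>
  have high: False if "M < c" "C \<le> a + b + c" "odd (a+b+c) \<longrightarrow> C1 \<le> a+b+c" "even (a+b+c) \<longrightarrow> C0 \<le> a + b + c"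
  proof -
    have h: "a \<le> x" "b \<le> y" "c \<le> z" using realises_highD r le that by auto
    show False
    proof (cases "IIB \<or> 2 * \<delta> + K2 \<le> C")
      case True
      then have "K2 \<le> c" "K2 \<le> b" "K2 \<le> a" using that bd IIB le by linarith+
      then have "even x \<longleftrightarrow> even a" "even y \<longleftrightarrow> even b" "even z \<longleftrightarrow> even c"
        using realises_evenD[OF r(1)] realises_evenD[OF r(2)] realises_evenD[OF r(3)] that le by auto
      then have "even (x+y+z) \<longleftrightarrow> even (a+b+c)" by auto
      then show False using h that allowed_odd[OF r(4)] allowed_even[OF r(4)] by (cases "even (a+b+c)") auto
    next
      case False
      then have "C0 \<le> C+1" "C1 \<le> C+1" using adm by linarith+
      then have "x + y + z < C"
        using allowed_perimeter r(4) by blast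
      then show False using h that by linarith
    qed
  qed
  \<comment> \<open>\<open>side\<close> excludes this except for two sides \<delta> in case (IIB).
    Then \<open>c\<close> is even, so the bound in question is \<open>C0\<close>, and it exceeds
    \<open>C = 2 * \<delta> + M\<close>.\<close>
  have low: False if "c \<le> M" "C \<le> a + b + c" "odd (a+b+c) \<longrightarrow> C1 \<le> a+b+c" "even (a+b+c) \<longrightarrow> C0 \<le> a + b + c"
  proof -
    have *: "IIB" "a = \<delta>" "b = \<delta>" "even c" using s(3) that unfolding side_def by auto
    then have "C0 \<le> a + b + c" using that by auto
    moreover have "C0 \<noteq> C" using IIB * par by auto
    ultimately show False using IIB * acc that by linarith
  qed
  have peri: "(odd (a+b+c) \<longrightarrow> a+b+c < C1) \<and> (even (a+b+c) \<longrightarrow> a+b+c < C0)"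
  proof (rule ccontr)
    assume n: "\<not> ?thesis"
    then have "C \<le> a + b + c" "odd (a+b+c) \<longrightarrow> C1 \<le> a+b+c" "even (a+b+c) \<longrightarrow> C0 \<le> a + b + c"
      using acc by auto
    then show False using low high by linarith
  qed
  have k1: "2 * K1 < a + b + c" if od: "odd (a+b+c)"
  proof (rule ccontr)
    assume n: "\<not> 2 * K1 < a + b + c"
    have "a + b + c \<noteq> 2 * K1" using od by (metis dvd_triv_left)
    then have K: "a < K1" "b < K1" "c < K1" "a + b + c < 2 * K1" using n m le by linarith+
    then have lM: "a < M" "b < M" "c < M" using M by linarith+
    have e: "even x \<longleftrightarrow> even a" "even y \<longleftrightarrow> even b" "even z \<longleftrightarrow> even c"
      using realises_evenD[OF r(1)] realises_evenD[OF r(2)] realises_evenD[OF r(3)] K lM by auto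
    then have "odd (x+y+z)" using od by auto
    note od' = allowed_odd[OF r(4) this]
    note allowed = allowed_metric[OF r(4)]
    show False
    proof (cases "IIB \<and> a + 1 = M")
      case False
      then have "\<not> (IIB \<and> b + 1 = M)" "\<not> (IIB \<and> c + 1 = M)" using le lM by auto
      then have "x \<le> a" "y \<le> b" "z \<le> c" using realises_lowD[OF r(1)] realises_lowD[OF r(2)] realises_lowD[OF r(3)] False lM by auto
      then show False using od' K by linarith
    next
      case True
      note 2 = IIB[OF True[THEN conjunct1]]
      have "c + 1 < M" using True 2 K le by linarith
      then have z: "z \<le> c" using realises_lowD[OF r(3)] lM by auto
      show False
      proof (cases "b + 1 = M")
        case False
        then have "y \<le> b" using realises_lowD[OF r(2)] lM by auto
        then show False using od' allowed z K True 2 by linarith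
      next
        case b: True
        \<comment> \<open>Two sides \<open>M - 1\<close> leave only \<open>c = 1\<close>. Then
          \<open>z = 1\<close>, so \<open>x\<close> and \<open>y\<close>, being even, must coincide,
          and they are less than \<open>M\<close>.\<close>
        then have "c = 1" using K 2 True bd by linarith
        then have "z = 1" using z e(3) by (cases "z = 0") auto
        moreover have "even x" "even y" using e(1,2) b True 2 by (metis even_plus_one_iff)+
        moreover have "x \<noteq> M" using 2 \<open>even x\<close> by auto
        moreover have "x = y" using calculation allowed by (metis Suc_eq_plus1 even_Suc le_SucE le_antisym)
        ultimately show False using od' 2 by linarith
      qed
    qed
  qed
  have k2: "a + b < 2 * K2 + c" if od: "odd (a+b+c)"
  proof (rule ccontr)
    assume n: "\<not> a + b < 2 * K2 + c"
    have "a + b \<noteq> 2 * K2 + c" using od by (metis even_add dvd_triv_left)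
    moreover have "a \<noteq> b + c" using od by auto
    ultimately have n: "2 * K2 + c < a + b" "a < b + c" using n m by linarith+
    then have hi: "K2 < b" "K2 < a" using le by linarith+
    then have xy: "a \<le> x" "b \<le> y" "even x \<longleftrightarrow> even a" "even y \<longleftrightarrow> even b"
      using M realises_highD r realises_evenD[OF r(1)] realises_evenD[OF r(2)] by auto
    have pe: "a + b + c < C1" using peri od by auto
    note allowed = allowed_odd[OF r(4)]
    have nl: False if "c < M" "c < K1 \<or> c = K1 \<and> K1 + 2*K2 + 1 = 2*\<delta>" "\<not> (IIB \<and> c + 1 = M)"
      using realises_lowD[OF r(3)] realises_evenD[OF r(3)] xy n od allowed that by fastforce
    show False
    proof (cases "c < M \<and> (c < K1 \<or> c = K1 \<and> K1 + 2*K2 + 1 = 2*\<delta>)")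
      case True
      then have "IIB \<and> c + 1 = M" using nl by auto
      note 2 = IIB[OF this[THEN conjunct1]] this
      have "even c" using 2 by (metis even_plus_one_iff)
      have "even z" using realises_evenD[OF r(3)] True \<open>even c\<close> by auto
      have "x + y = 2 * \<delta> \<or> x + y + 1 = 2 * \<delta>" using xy n 2 bd by linarith
      moreover have "odd (x + y)" using xy od \<open>even c\<close> by auto
      ultimately have "x + y + 1 = 2 * \<delta>" by (metis dvd_triv_left)
      moreover have "odd (x + y + z)" using \<open>odd (x+y)\<close> \<open>even z\<close> by auto
      moreover have "z \<noteq> M" using 2 \<open>even z\<close> by auto
      ultimately show False using allowed 2 by linarith
    next
      case False
      then have c: "K1 \<le> c" using M by linarith
      show False
      proof (cases IIB)
        case True
        note 2 = IIB[OF this]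
        have "c = M" "a = \<delta>" "b = \<delta>" using c n bd 2 by linarith+
        then show False using pe 2 by linarith
      next
        case nIIB: False
        \<comment> \<open>\<open>2 * K2 + c < a + b\<close> with \<open>c \<ge> K1\<close> leaves
          only \<open>c = K1\<close> in the borderline
          \<open>K1 + 2 * K2 + 1 = 2 * \<delta>\<close>. There \<open>K1 < M\<close> puts
          \<open>c\<close> below \<open>M\<close>, where its parity is known.\<close>
        have spec: False if "2 * \<delta> \<le> K1 + 2 * K2 \<or> K1 + 2 * K2 + 1 = 2 * \<delta> \<and> 2 * \<delta> + K1 + 1 < C \<and> K1 < M"
        proof -
          have "c = K1" "K1 + 2 * K2 + 1 = 2 * \<delta>" using n c bd that by linarith+
          then show ?thesis using that False by auto
        qed
        from adm_cases show False
        proof cases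
          case II
          have "C1 = C" using II(4) acc(8) par by auto
          then show ?thesis using II pe n c by linarith
        qed (use spec nIIB in blast)+
      qed
    qed
  qed
  have k3: "a + c < 2 * K2 + b \<and> b + c < 2 * K2 + a" if od: "odd (a+b+c)"
    using k2[OF od] le by linarith
  have "b \<le> a + c" "c \<le> a + b" using le by linarith+
  then show ?thesis unfolding allowed_def using peri k1 k2 k3 m by blast
qed

lemma allowed_sym: "tri x y z = tri y x z" "tri x y z = tri x z y"
  using allowed_commute allowed_rotate by blast+

text \<open>The form applied to the completed distance, where no value is later than the fork of the
  other two; sorting the sides reduces it to \<open>triple_allowed\<close>.\<close>

lemma time_fork_allowed:
  assumes t: "time a \<le> time (fork b c)" "time b \<le> time (fork a c)" "time c \<le> time (fork a b)"
    and r: "realises a x" "realises b y" "realises c z" "tri x y z"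
    and bd: "1 \<le> a" "a \<le> \<delta>" "1 \<le> b" "b \<le> \<delta>" "1 \<le> c" "c \<le> \<delta>" "x \<le> \<delta>" "y \<le> \<delta>" "z \<le> \<delta>"
  shows "tri a b c"
proof -
  have "triple a b c x y z"
    unfolding triple_def using sideI[OF r(1-3) _ t(1)] sideI[OF r(2,1,3) _ t(2)] sideI[OF r(3,1,2) _ t(3)] r bd allowed_rotate allowed_commute
    by metis
  note p = triple_allowed[OF this] triple_allowed[OF triple_perms(1)[OF this]] triple_allowed[OF triple_perms(2)[OF this]]
    triple_allowed[OF triple_perms(1)[OF triple_perms(1)[OF this]]] triple_allowed[OF triple_perms(2)[OF triple_perms(1)[OF this]]]
    triple_allowed[OF triple_perms(1)[OF triple_perms(2)[OF this]]]
  have "tri a b c \<or> tri b c a \<or> tri b a c \<or> tri c a b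
     \<or> tri c b a \<or> tri a c b"
    using p by linarith
  then show ?thesis by (simp add: allowed_sym)
qed

lemma realises_refl: "realises m m" by (auto simp: realises_def)

text \<open>Realising a value pushes the distance away from \<open>M\<close>. For
  \<open>M - 1\<close> in case (IIB), where only the parity is known, \<open>x\<close> is even and
  hence different from the odd \<open>M\<close>.\<close>

lemma time_realises:
  assumes "realises m x" "1 \<le> m" "m \<le> \<delta>" "1 \<le> x" "x \<le> \<delta>"
  shows "time x \<le> time m"
proof -
  consider "m = M" | "M < m" | "m < M" "\<not> (IIB \<and> m + 1 = M)" | "m < M" "IIB" "m + 1 = M" by linarith
  then show ?thesis
  proof cases
    case 1 then show ?thesis using assms M by (auto simp: time_def)
  next
    case 2 then show ?thesis using assms realises_highD[OF assms(1)] by (auto simp: time_def)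
  next
    case 3 then show ?thesis using assms realises_lowD[OF assms(1)] by (auto simp: time_def)
  next
    case 4
    note 2 = IIB[OF 4(2)]
    have "even m" using 2 4 by (metis even_plus_one_iff)
    then have "even x" using realises_evenD[OF assms(1)] 2 4 by auto
    then have "x \<noteq> M" using 2 by auto
    then show ?thesis using 2 4 assms \<open>even x\<close> by (auto simp: time_def)
  qed
qed

text \<open>The parity of the time tells the side: it is odd exactly below \<open>M\<close>.\<close>

lemma time_inj:
  assumes "time x = time y" "x \<le> \<delta>" "y \<le> \<delta>" "1 \<le> x" "1 \<le> y"
  shows "x = y"
proof -
  have *: "z = M \<and> time z = 2 * \<delta> \<or> z < M \<and> time z + 1 = 2 * z \<or> M < z \<and> time z + 2 * z = 2 * \<delta>" if "1 \<le> z" "z \<le> \<delta>" for z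
    using that by (auto simp: time_def)
  have e: "odd (time z) \<longleftrightarrow> z < M" if "1 \<le> z" "z \<le> \<delta>" for z
    using that by (auto simp: time_def)
  have d: "M \<le> \<delta>" using M acc by linarith
  show ?thesis
  proof (cases "x < M")
    case True
    then have "y < M" using e assms by metis
    then show ?thesis using True assms by (auto simp: time_def)
  next
    case False
    then have "\<not> y < M" using e assms by metis
    then show ?thesis using *[OF assms(4,2)] *[OF assms(5,3)] False assms(1) d by linarith
  qed
qed

section \<open>Amalgamation of two triangles\<close>

lemma allowed_M_M:
  assumes "1 \<le> a" "a \<le> \<delta>"
  shows "tri M M a"
proof -
  have "a \<noteq> 2 * K2" if "odd a" using that by auto
  then show ?thesis unfolding allowed_def using M acc assms by fastforce
qed

lemma fork_allowed:
  assumes "1 \<le> y" "y \<le> \<delta>" "1 \<le> z" "z \<le> \<delta>"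
  shows "tri y z (fork y z)"
  using assms(2,4)
proof (cases rule: fork_cases)
  case minus
  then have "even (y + z + fork y z)" "y + z + fork y z < C0" using assms acc by (metis dvd_triv_left mult_2 add.assoc, linarith)
  then show ?thesis using minus unfolding allowed_def by linarith
next
  case minus'
  then have "even (y + z + fork y z)" "y + z + fork y z < C0" using assms acc by (metis dvd_triv_left mult_2 add.commute add.left_commute, linarith)
  then show ?thesis using minus' unfolding allowed_def by linarith
next
  case plus
  then have "even (y + z + fork y z)" "y + z + fork y z < C0" using M acc by (auto)
  then show ?thesis using plus unfolding allowed_def by linarith
next
  case C
  have *: "fork y z \<le> y + z" "y \<le> fork y z + z" "z \<le> fork y z + y" "y + z + fork y z < C0" "y + z + fork y z < C1"
    using C assms M acc by linarith+
  moreover have "2 * K1 < y + z + fork y z \<and> y + z < 2 * K2 + fork y z" if od: "odd (y + z + fork y z)"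
  proof -
    have "even C" using od C(1) by (metis add.commute add.left_commute even_plus_one_iff)
    have oC: "fork y z + y + z + 1 = C" by fact
    from adm_cases show ?thesis
    proof cases
      case III
      \<comment> \<open>These are the parameters for which \<open>y + z < 2 * K2 + fork y z\<close>
        would fail at \<open>y = z = \<delta>\<close>; they make \<open>C\<close> odd.\<close>
      have "2 * \<delta> \<noteq> K1 + 2 * K2 \<or> C \<noteq> 2 * \<delta> + K1 + 1"
        "2 * \<delta> \<noteq> K1 + 2 * K2 + 1 \<or> C \<noteq> 2 * \<delta> + K1 + 2" using \<open>even C\<close> by presburger+
      then show ?thesis using oC III C M acc(1-5) assms by linarith
    next
      case IIIC then show ?thesis using IIIC oC C M acc(1-5) assms by linarith
    qed (use \<open>even C\<close> in auto)
  qed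
  ultimately show ?thesis unfolding allowed_def using assms C M by auto
next
  case top
  have "2 * K1 < y + z + M \<and> y + z < 2 * K2 + M \<and> y + M < 2 * K2 + z \<and> z + M < 2 * K2 + y" if od: "odd (y + z + M)"
  proof -
    have "y + z + M \<noteq> 2 * K1" "y + z \<noteq> 2 * K2 + M" "y + M \<noteq> 2 * K2 + z" "z + M \<noteq> 2 * K2 + y"
      using od by (metis dvd_triv_left even_add)+
    then have "2 * K1 < y + z + M" "y + M < 2 * K2 + z" "z + M < 2 * K2 + y" using top M by linarith+
    moreover have "y + z < 2 * K2 + M"
      using adm_cases by cases (use \<open>y + z \<noteq> 2 * K2 + M\<close> top(5) M assms in linarith)+
    ultimately show ?thesis by blast
  qed
  then show ?thesis unfolding allowed_def top using top acc by auto
qed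

section \<open>Retriangulating a quadrangle\<close>

lemma time_fork_high:
  assumes t: "time f \<le> time (fork x w)" "M < f"
   and bd: "1 \<le> x" "x \<le> \<delta>" "1 \<le> w" "w \<le> \<delta>" "f \<le> \<delta>"
  shows "w + M < x \<longrightarrow> x \<le> f + w" "x + M < w \<longrightarrow> w \<le> f + x"
proof -
  have f: "time f = 2 * (\<delta> - f)" using t by (simp add: time_def)
  show "w + M < x \<longrightarrow> x \<le> f + w"
  proof
    assume 1: "w + M < x"
    then have "fork x w = x - w" "M < x - w" by (simp_all add: fork_def)
    then have "time (fork x w) = 2 * (\<delta> - (x - w))" by (simp add: time_def)
    then show "x \<le> f + w" using f t bd 1 by linarith
  qed
  show "x + M < w \<longrightarrow> w \<le> f + x"
  proof
    assume 1: "x + M < w"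
    then have "fork x w = w - x" "M < w - x" by (simp_all add: fork_def)
    then have "time (fork x w) = 2 * (\<delta> - (w - x))" by (simp add: time_def)
    then show "w \<le> f + x" using f t bd 1 by linarith
  qed
qed

text \<open>Precedence of \<open>f\<close> over \<open>fork x w\<close> in linear form. The last two
  claims compare values on opposite sides of \<open>M\<close>; they settle case (IIB) in
  \<open>flip_C\<close>.\<close>

lemma time_fork_low:
  assumes t: "time f \<le> time (fork x w)" "f < M" "1 \<le> f"
   and bd: "1 \<le> x" "x \<le> \<delta>" "1 \<le> w" "w \<le> \<delta>"
  shows "x + w < M \<longrightarrow> f \<le> x + w" "C \<le> x + w + M \<longrightarrow> f + x + w < C"
    "w + M < x \<longrightarrow> f + x \<le> \<delta> + w" "x + M < w \<longrightarrow> f + w \<le> \<delta> + x"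
proof -
  have f: "time f = 2 * f - 1" using t by (simp add: time_def)
  show "x + w < M \<longrightarrow> f \<le> x + w"
  proof
    assume "x + w < M"
    moreover from this have "fork x w = x + w" by (simp add: fork_def)
    ultimately show "f \<le> x + w" using f t bd by (simp add: time_def)
  qed
  show "C \<le> x + w + M \<longrightarrow> f + x + w < C"
  proof
    assume 1: "C \<le> x + w + M"
    then have 2: "\<not> w + M < x" "\<not> x + M < w" "\<not> x + w < M" using M acc bd by linarith+
    then have 3: "fork x w = C - 1 - (x + w)" using 1 by (simp add: fork_def)
    moreover have "fork x w < M" "1 \<le> fork x w" using 1 2 3 M acc bd by linarith+
    ultimately show "f + x + w < C" using f t by (simp add: time_def)
  qed
  show "w + M < x \<longrightarrow> f + x \<le> \<delta> + w"
  proof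
    assume 1: "w + M < x"
    then have "fork x w = x - w" "M < x - w" by (simp_all add: fork_def)
    then have "time (fork x w) = 2 * (\<delta> - (x - w))" by (simp add: time_def)
    then show "f + x \<le> \<delta> + w" using f t bd 1 by linarith
  qed
  show "x + M < w \<longrightarrow> f + w \<le> \<delta> + x"
  proof
    assume 1: "x + M < w"
    then have "fork x w = w - x" "M < w - x" by (simp_all add: fork_def)
    then have "time (fork x w) = 2 * (\<delta> - (w - x))" by (simp add: time_def)
    then show "f + w \<le> \<delta> + x" using f t bd 1 by linarith
  qed
qed

text \<open>In a quadrangle \<open>x\<close>, \<open>y\<close>, \<open>z\<close>, \<open>w\<close> with diagonal \<open>e\<close>, the other diagonal can be given the stronger of
  the values forced by \<open>y\<close>, \<open>z\<close> and by \<open>x\<close>, \<open>w\<close>.\<close>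

lemma flip_minus:
  assumes 1: "tri x y e" and 2: "tri e z w" and yz: "y = z + f" "M < f"
   and t: "time f \<le> time (fork x w)"
   and bd: "1 \<le> x" "x \<le> \<delta>" "1 \<le> y" "y \<le> \<delta>" "1 \<le> z" "z \<le> \<delta>" "1 \<le> w" "w \<le> \<delta>" "e \<le> \<delta>"
  shows "tri x w f"
proof -
  have m1: "x \<le> y + e" "y \<le> x + e" "e \<le> x + y" and m2: "e \<le> z + w" "z \<le> e + w" "w \<le> e + z"
    using allowed_metric[OF 1] allowed_metric[OF 2] by auto
  have f: "f \<le> \<delta>" using yz bd by linarith
  note th = time_fork_high[OF t yz(2) bd(1,2,7,8) this]
  have tri: "f \<le> x + w" "x \<le> w + f" "w \<le> x + f" using m1 m2 yz th M by linarith+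
  have pe: "x + w + f \<le> x + y + e" using m2 yz by linarith
  \<comment> \<open>An odd perimeter \<open>x + w + f\<close> makes exactly one of the two given
    triangles odd, and that one supplies the odd bounds.\<close>
  have p: "even (x + w + f) \<longleftrightarrow> even (x+y+e) = even (e+z+w)" using yz by auto
  have k: "2*K1 < x+w+f \<and> x+w < 2*K2+f \<and> x+f < 2*K2+w \<and> w+f < 2*K2+x" if od: "odd (x+w+f)"
  proof -
    have ne: "x + w \<noteq> 2 * K2 + f" "x + f \<noteq> 2 * K2 + w" "w + f \<noteq> 2 * K2 + x" using od by (metis dvd_triv_left even_add)+
    have k1: "2*K1 < x+w+f" using tri yz M by linarith
    have b: "x + w < 2 * K2 + f"
    proof (rule ccontr)
      assume "\<not> x + w < 2 * K2 + f"
      then have n: "2 * K2 + f < x + w" using ne(1) by linarith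
      from adm_cases show False
      proof cases
        case II
        then show ?thesis using allowed_perimeter[OF II(2,3) 1] n pe yz M by linarith
      qed (use n bd yz M in linarith)+
    qed
    have ac: "w + f < 2 * K2 + x \<and> x + f < 2 * K2 + w"
    proof (cases "even (x+y+e)")
      case True
      then have o: "odd (e+z+w)" using p od by auto
      then have "e \<noteq> z + w" by auto
      then have ez: "e < z + w" using m2 by linarith
      have 3: "2*K1 < e+z+w" "e + w < 2*K2 + z" using allowed_odd[OF 2 o] by auto
      have "w + f < 2 * K2 + x" using 3 m1 tri yz by linarith
      moreover have "x + f < 2 * K2 + w"
      proof (rule ccontr)
        assume "\<not> x + f < 2 * K2 + w"
        then have n: "2 * K2 + w < x + f" using ne(2) by linarith
        from adm_cases show False
        proof cases
          case II
          then show ?thesis using allowed_perimeter[OF II(2,3) 1] n yz 3 by linarith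
        qed (use n bd yz 3 ez in linarith)+
      qed
      ultimately show ?thesis by blast
    next
      case False
      have "x + y < 2*K2 + e" "y + e < 2 * K2 + x" using allowed_odd[OF 1 False] by auto
      then show ?thesis using m1 m2 yz by linarith
    qed
    show ?thesis using k1 b ac by blast
  qed
  have per: "(odd (x+w+f) \<longrightarrow> x + w + f < C1) \<and> (even (x+w+f) \<longrightarrow> x + w + f < C0)"
  proof (cases "even (x+w+f) = even (x+y+e)")
    case True
    then show ?thesis using pe allowed_odd[OF 1] allowed_even[OF 1] by (metis le_less_trans)
  next
    case False
    then have o: "odd (e+z+w)" using p by auto
    then have "e \<noteq> z + w" by auto
    then have ez: "e < z + w" using m2 by linarith
    have 3: "2*K1 < e+z+w" "e + w < 2*K2 + z" using allowed_odd[OF 2 o] by auto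
    have "x + w + f < C"
    proof (rule ccontr)
      assume n: "\<not> x + w + f < C"
      from adm_cases show False
      proof cases
        case II
        then show ?thesis using allowed_perimeter[OF II(2,3) 1] n pe by linarith
      next
        case III
        then show ?thesis using allowed_perimeter[OF III(2,3) 1] n pe by linarith
      next
        case IIIC
        then show ?thesis using n bd yz 3 m2 by linarith
      next
        case exc
        then show ?thesis using n bd yz 3 m2 by linarith
      qed
    qed
    then show ?thesis using acc by linarith
  qed
  then show ?thesis using k per tri unfolding allowed_def by auto
qed
lemma flip_plus:
  assumes 1: "tri x y e" and 2: "tri e z w" and yz: "f = y + z" "f < M"
   and t: "time f \<le> time (fork x w)"
   and bd: "1 \<le> x" "x \<le> \<delta>" "1 \<le> y" "y \<le> \<delta>" "1 \<le> z" "z \<le> \<delta>" "1 \<le> w" "w \<le> \<delta>" "e \<le> \<delta>"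
  shows "tri x w f"
proof -
  note m = allowed_metric[OF 1] allowed_metric[OF 2]
  have "1 \<le> f" using yz bd by linarith
  note tl = time_fork_low[OF t yz(2) this bd(1,2,7,8)]
  have tri: "f \<le> x + w" "x \<le> w + f" "w \<le> x + f" "x + w + f < C" using m yz tl M by linarith+
  have p: "even (x + w + f) \<longleftrightarrow> even (x+y+e) = even (e+z+w)" using yz by auto
  have k: "2*K1 < x+w+f \<and> x+w < 2*K2+f \<and> x+f < 2*K2+w \<and> w+f < 2*K2+x" if od: "odd (x+w+f)"
  proof (cases "even (x+y+e)")
    case True
    then have o: "odd (e+z+w)" using p od by auto
    show ?thesis using allowed_odd[OF 2 o] m(1,2) tri(1-3) yz M by linarith
  next
    case False
    then show ?thesis using allowed_odd[OF 1 False] m(1,2) tri(1-3) yz M by linarith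
  qed
  then show ?thesis using acc tri unfolding allowed_def by auto
qed

text \<open>If \<open>C0\<close> and \<open>C1\<close> differ by one, both given perimeters are
  below \<open>C\<close>, which yields the triangle inequalities for
  \<open>f = C - 1 - y - z\<close>. If \<open>2 * \<delta> + M < C\<close> there is no such fork,
  and in case (IIB) it is \<open>y = z = \<delta>\<close>.\<close>

lemma flip_C:
  assumes 1: "tri x y e" and 2: "tri e z w" and yz: "f + y + z + 1 = C" "f < M"
   and t: "time f \<le> time (fork x w)"
   and bd: "1 \<le> x" "x \<le> \<delta>" "1 \<le> y" "y \<le> \<delta>" "1 \<le> z" "z \<le> \<delta>" "1 \<le> w" "w \<le> \<delta>" "e \<le> \<delta>"
  shows "tri x w f"
proof -
  have m1: "x \<le> y + e" "y \<le> x + e" "e \<le> x + y" and m2: "e \<le> z + w" "z \<le> e + w" "w \<le> e + z"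
    using allowed_metric[OF 1] allowed_metric[OF 2] by auto
  have "1 \<le> f" using yz bd acc by linarith
  note tl = time_fork_low[OF t yz(2) this bd(1,2,7,8)]
  have tri: "f \<le> x + w" "x + w + f < C" using yz tl M by linarith+
  have e1: "x+y < 2*K2+e \<and> x+e < 2*K2+y \<and> y+e < 2*K2+x \<and> x+y+e < C1" if "odd (x+y+e)" using allowed_odd[OF 1 that] by simp
  have e2: "e+z < 2*K2+w \<and> e+w < 2*K2+z \<and> z+w < 2*K2+e \<and> e+z+w < C1" if "odd (e+z+w)" using allowed_odd[OF 2 that] by simp
  have od2: "odd (x+y+e) \<or> odd (e+z+w)" if "odd C" "odd (x+w+f)"
  proof -
    have "even (f + y + z)" using yz(1) that by (metis even_plus_one_iff)
    then show ?thesis using that by auto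
  qed
  have eqs: "y = \<delta> \<and> z = \<delta> \<and> f + 1 = M" if "3 * M + 1 = 2 * \<delta>" "C = 4 * M + 1"
    using that yz bd by linarith
  have tri2: "x \<le> w + f \<and> w \<le> x + f"
    using adm_cases
  proof cases
    case exc
    note q = eqs[OF exc(4,5)]
    have x: "x \<le> w + f"
    proof (rule ccontr)
      assume n: "\<not> x \<le> w + f"
      have "\<not> w + M < x" using tl(3) q exc by linarith
      then have xw: "x = w + M" using n q by linarith
      show False
      proof (cases "odd (x + y + e)")
        case True
        then show False using e1 xw q exc m2 by linarith
      next
        case False
        then have o: "odd (e + z + w)" using xw exc q by auto
        then have "e + w \<noteq> z" by auto
        then show False using e2[OF o] xw q exc m2 bd by linarith
      qed
    qed
    have "w \<le> x + f"
    proof (rule ccontr)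
      assume n: "\<not> w \<le> x + f"
      have "\<not> x + M < w" using tl(4) q exc by linarith
      then have xw: "w = x + M" using n q by linarith
      show False
      proof (cases "odd (e + z + w)")
        case True
        then show False using e2 xw q exc m1 by linarith
      next
        case False
        then have o: "odd (x + y + e)" using xw exc q by auto
        then have "e + x \<noteq> y" by auto
        then show False using e1[OF o] xw q exc m1 bd by linarith
      qed
    qed
    with x show ?thesis by blast
  next
    case II
    then show ?thesis using allowed_perimeter[OF II(2,3) 1] allowed_perimeter[OF II(2,3) 2] yz m1 m2 by linarith
  next
    case III
    then show ?thesis using allowed_perimeter[OF III(2,3) 1] allowed_perimeter[OF III(2,3) 2] yz m1 m2 by linarith
  next
    case IIIC
    then show ?thesis using yz bd by linarith
  qed
  have k: "2*K1 < x+w+f \<and> x+w < 2*K2+f" if od: "odd (x+w+f)"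
  proof -
    have ne: "x + w + f \<noteq> 2 * K1" "x + w \<noteq> 2 * K2 + f" using od by (metis dvd_triv_left even_add)+
    have c: "2*K1 < x+w+f" if C: "C = 2 * K1 + 2 * K2 + 1" "odd C"
      using od2[OF C(2) od] e1 e2 C(1) yz m1 m2 by linarith
    from adm_cases show ?thesis
    proof cases
      case exc
      note q = eqs[OF exc(4,5)]
      have "x + w < 2 * K2 + f"
      proof (rule ccontr)
        assume "\<not> x + w < 2 * K2 + f"
        then have "2 * \<delta> \<le> x + w + 1" using ne(2) exc q by linarith
        moreover have "odd C" using exc by simp
        ultimately show False using od2[OF _ od] e1 e2 exc(3-6) q bd by linarith
      qed
      then show ?thesis using c exc by auto
    next
      case II
      have "x + w < 2 * K2 + f"
      proof (rule ccontr)
        assume "\<not> x + w < 2 * K2 + f"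
        then have n: "2 * K2 + f < x + w" using ne(2) by linarith
        show False using od2[OF II(4) od] e1 e2 allowed_perimeter[OF II(2,3) 1] allowed_perimeter[OF II(2,3) 2] n yz by linarith
      qed
      then show ?thesis using c II by auto
    next
      case III
      then show ?thesis using ne yz bd tri by linarith
    next
      case IIIC
      then show ?thesis using yz bd by linarith
    qed
  qed
  have "x+f < 2*K2+w \<and> w+f < 2*K2+x"
    using tri2 yz M by linarith
  moreover have "x + w + f < C0 \<and> x + w + f < C1" using tri acc by linarith
  ultimately show ?thesis using tri tri2 k unfolding allowed_def by auto
qed

text \<open>Degenerate triangles have the even perimeter \<open>2 * x\<close>, which is below
  \<open>C0\<close>. They make 0 neutral for composing distances.\<close>

lemma allowed_zero:
  assumes "x \<le> \<delta>"
  shows "tri 0 x y \<longleftrightarrow> y = x"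
proof
  assume "tri 0 x y"
  then show "y = x" using allowed_metric by fastforce
next
  assume "y = x"
  then show "tri 0 x y" using assms acc unfolding allowed_def by auto
qed

lemma flip_fork:
  assumes 1: "tri x y e" and 2: "tri e z w"
   and t: "time (fork y z) \<le> time (fork x w)"
   and bd: "1 \<le> x" "x \<le> \<delta>" "1 \<le> y" "y \<le> \<delta>" "1 \<le> z" "z \<le> \<delta>" "1 \<le> w" "w \<le> \<delta>" "e \<le> \<delta>"
  shows "tri x w (fork y z)"
proof -
  have s: "tri w z e" "tri e y x" using 1 2 by (simp_all add: allowed_sym)
  have c: "fork x w = fork w x" by (auto simp: fork_def)
  from bd(4,6) show ?thesis
  proof (cases rule: fork_cases)
    case minus
    then show ?thesis using flip_minus[OF 1 2 minus t] bd by blast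
  next
    case minus'
    then have "tri w x (fork y z)" using flip_minus[OF s minus'] t c bd by metis
    then show ?thesis by (simp add: allowed_sym)
  next
    case plus
    then show ?thesis using flip_plus[OF 1 2 plus(1) _ t] bd by simp
  next
    case C
    then show ?thesis using flip_C[OF 1 2 C(1,2) t] bd by blast
  next
    case top
    \<comment> \<open>\<open>M\<close> is last in precedence, so the other fork has value
      \<open>M\<close> as well.\<close>
    have "fork x w = M"
    proof (rule ccontr)
      assume n: "fork x w \<noteq> M"
      have "time (fork x w) < 2 * \<delta>" using n fork_bounds[OF bd(1,7,2,8)] M acc by (auto simp: time_def)
      then show False using t top by (simp add: time_def)
    qed
    then show ?thesis using fork_allowed[of x w] bd top by simp
  qed
qed

text \<open>Of the two forks facing the new diagonal, the one with the earlier value supplies it: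
  this value closes its own fork by \<open>fork_allowed\<close> and fits the other by
  \<open>flip_fork\<close>.\<close>

lemma flip:
  assumes 1: "tri x y e" and 2: "tri e z w"
   and bd: "x \<le> \<delta>" "y \<le> \<delta>" "z \<le> \<delta>" "w \<le> \<delta>" "e \<le> \<delta>"
  shows "\<exists>f\<le>\<delta>. tri y z f \<and> tri x f w"
proof -
  have z: "tri u 0 v \<longleftrightarrow> v = u" "tri u v 0 \<longleftrightarrow> v = u" if "u \<le> \<delta>" for u v
    using allowed_zero[OF that, of v] allowed_sym[of u 0 v] allowed_sym[of u v 0] by simp_all
  consider "x = 0" | "y = 0" | "z = 0" | "w = 0" | "1 \<le> x" "1 \<le> y" "1 \<le> z" "1 \<le> w" by linarith
  then show ?thesis
  proof cases
    case x: 1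
    have "e = y" using 1 x allowed_zero bd by simp
    then show ?thesis using 2 x bd allowed_zero by (intro exI[of _ w]) simp
  next
    case y: 2
    then have "e = x" using 1 z bd by simp
    then show ?thesis using 2 y bd allowed_zero by (intro exI[of _ z]) simp
  next
    case z0: 3
    then have "w = e" using 2 z bd by simp
    then show ?thesis using 1 z0 bd z by (intro exI[of _ y]) simp
  next
    case w: 4
    then have "z = e" using 2 z bd by simp
    moreover have "tri y e x" using 1 by (simp add: allowed_sym)
    ultimately show ?thesis using w bd allowed_zero z by (intro exI[of _ x]) simp
  next
    case 5
    show ?thesis
    proof (cases "time (fork y z) \<le> time (fork x w)")
      case True
      have "tri x w (fork y z)" using flip_fork[OF 1 2 True] 5 bd by blast
      then show ?thesis using fork_allowed[of y z] fork_bounds[of y z] 5 bd allowed_sym(2)[of x w] by auto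
    next
      case False
      have s: "tri y x e" "tri e w z" using 1 2 by (simp_all add: allowed_sym)
      have "tri y z (fork x w)" using flip_fork[OF s] False 5 bd by simp
      then show ?thesis using fork_allowed[of x w] fork_bounds[of x w] 5 bd allowed_sym(2)[of x w] by auto
    qed
  qed
qed

end

section \<open>From admissible parameters to a magic distance\<close>

text \<open>The bound by the smallest side is the conjunction of the three bounds by each side,
  which keeps all conditions linear.\<close>

lemma allowed_iff:
  "allowed K1 K2 C0 C1 a b c \<longleftrightarrow> a \<le> b + c \<and> b \<le> a + c \<and> c \<le> a + b \<and> allowed_triangle K1 K2 C0 C1 a b c"
  unfolding allowed_def allowed_triangle_def Let_def by (auto simp: min_def)

text \<open>The lower bounds on \<open>M\<close> are \<open>K1\<close>, half of \<delta>, and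
  \<open>K1 + 1\<close> in the borderline \<open>K1 + 2 * K2 + 1 = 2 * \<delta>\<close>; the least
  integer above them meets the upper bounds. In case (IIB) the range collapses to
  \<open>K1 = K2\<close>.\<close>

lemma admissible_magic:
  assumes "admissible \<delta> K1 K2 C0 C1"
  obtains M C IIB where "magic \<delta> K1 K2 C0 C1 M C IIB"
proof -
  have a: "3 \<le> \<delta>" "1 \<le> K1" "K1 \<le> K2" "K2 \<le> \<delta>" "2 * \<delta> + 2 \<le> C0" "2 * \<delta> + 2 \<le> C1" "C0 \<le> 3 * \<delta> + 2" "C1 \<le> 3 * \<delta> + 2"
     "even C0" "odd C1" and
    adm: "admissible_II \<delta> K1 K2 C0 C1 \<or> admissible_III \<delta> K1 K2 C0 C1"
    using assms unfolding admissible_def acceptable_def by auto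
  define C where "C = min C0 C1"
  have C: "2 * \<delta> + 2 \<le> C" "C \<le> C0" "C \<le> C1" "C = C0 \<or> C = C1" "C \<le> 3 * \<delta> + 2" using a unfolding C_def by auto
  show ?thesis
  proof (cases "admissible_II \<delta> K1 K2 C0 C1")
    case True
    then have II: "C \<le> 2 * \<delta> + K1" "C = 2 * K1 + 2 * K2 + 1" "\<delta> \<le> K1 + K2" "K1 + 2 * K2 + 1 \<le> 2 * \<delta>"
      "max C0 C1 = C + 1 \<or> C + 1 < max C0 C1 \<and> K1 = K2 \<and> 3 * K2 + 1 = 2 * \<delta>"
      unfolding admissible_II_def Let_def C_def[symmetric] using a by auto
    have o: "odd C" "C1 = C" using II(2) C a by auto
    show ?thesis
    proof (cases "max C0 C1 = C + 1")
      case True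
      have b: "C0 \<le> C + 1" "C1 \<le> C + 1" using True by auto
      define h where "h = (\<delta> + 1) div 2"
      have h: "\<delta> \<le> 2 * h" "2 * h \<le> \<delta> + 1" unfolding h_def by auto
      have "magic \<delta> K1 K2 C0 C1 (max K1 h) C False"
      proof unfold_locales
        show "K1 \<le> max K1 h" "\<delta> \<le> 2 * max K1 h" "max K1 h \<le> K2" "2 * max K1 h + \<delta> < C"
          using h II(1-4) a C(1) unfolding max_def by (auto split: if_splits)
      qed (use a C II(1-4) b o in auto)
      then show ?thesis by (rule that)
    next
      case False
      then have K: "K1 = K2" "3 * K2 + 1 = 2 * \<delta>" using II(5) by auto
      from K(2) have "odd K2" by presburger
      moreover have "3 \<le> K2"
      proof -
        have "2 \<le> K2" using K(2) a(1) by linarith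
        moreover have "K2 \<noteq> 2" using \<open>odd K2\<close> by auto
        ultimately show ?thesis by linarith
      qed
      ultimately have "magic \<delta> K1 K2 C0 C1 K2 C True"
        by unfold_locales (use a C II(1-4) o K \<open>odd K2\<close> in auto)
      then show ?thesis by (rule that)
    qed
  next
    case False
    then have III: "2 * \<delta> + K1 + 1 \<le> C" "2 * \<delta> \<le> K1 + 2 * K2 + 1" "2 * \<delta> \<le> 3 * K2"
       "K1 + 2 * K2 + 1 = 2 * \<delta> \<longrightarrow> C \<ge> 2 * \<delta> + K1 + 2"
       "max C0 C1 > C + 1 \<longrightarrow> C \<ge> 2 * \<delta> + K2"
      using adm a unfolding admissible_III_def Let_def C_def[symmetric] by auto
    define h where "h = (\<delta> + 1) div 2"
    have h: "\<delta> \<le> 2 * h" "2 * h \<le> \<delta> + 1" unfolding h_def by auto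
    define M where "M = max (if K1 + 2 * K2 + 1 = 2 * \<delta> then K1 + 1 else K1) h"
    have big': "C0 \<le> C + 1 \<and> C1 \<le> C + 1 \<or> C \<ge> 2 * \<delta> + K2" using III(5) by (auto simp: not_less)
    have "magic \<delta> K1 K2 C0 C1 M C False"
    proof unfold_locales
      show "K1 \<le> M" "\<delta> \<le> 2 * M" using h unfolding M_def by auto
      have "h \<le> K2" using III(3) h a(1) by linarith
      moreover have K1: "K1 + 1 \<le> K2" if "K1 + 2 * K2 + 1 = 2 * \<delta>" using that III a by linarith
      ultimately show "M \<le> K2" using a unfolding M_def by auto
      show "2 * M + \<delta> < C"
      proof -
        have "2 * h + \<delta> < C" using h C(1) by linarith
        moreover have "2 * K1 + \<delta> < C" using III(1) a by linarith
        moreover have "2 * (K1 + 1) + \<delta> < C" if "K1 + 2 * K2 + 1 = 2 * \<delta>"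
          using K1[OF that] III(4)[rule_format, OF that] a(4) by simp
        ultimately show ?thesis unfolding M_def max_def by simp
      qed
      have "M < K2" if "C = 2 * \<delta> + K2"
      proof -
        have "K1 < K2" using that III by linarith
        moreover have "K1 + 1 < K2" if sp: "K1 + 2 * K2 + 1 = 2 * \<delta>" using III(4)[rule_format, OF sp] \<open>C = 2 * \<delta> + K2\<close> by linarith
        \<comment> \<open>\<open>2 * \<delta> \<le> 3 * K2\<close> suffices unless
          \<open>\<delta> = 3\<close> and \<open>K2 = 2\<close>. Then \<open>K1 = 1\<close> makes
          the parameters borderline, and \<open>C = 8\<close> is too small.\<close>
        moreover have "h < K2"
        proof (cases "\<delta> = 3 \<and> K2 = 2")
          case True
          then have "K1 + 2 * K2 + 1 = 2 * \<delta>" using \<open>K1 < K2\<close> a by linarith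
          then show ?thesis using III(4) \<open>C = 2 * \<delta> + K2\<close> True by auto
        next
          case False
          then have "\<delta> \<noteq> 3 \<or> K2 \<noteq> 2" by blast
          then show ?thesis using III(3) h a(1) by linarith
        qed
        ultimately show ?thesis unfolding M_def by auto
      qed
      moreover have "K1 < M" if "K1 + 2 * K2 + 1 = 2 * \<delta>" using that unfolding M_def by auto
      ultimately show "False \<or> C0 \<le> C + 1 \<and> C1 \<le> C + 1 \<and> odd C \<and> C = 2 * K1 + 2 * K2 + 1 \<and> C \<le> 2 * \<delta> + K1 \<and> \<delta> \<le> K1 + K2 \<and> K1 + 2 * K2 < 2 * \<delta> \<or>
         2 * \<delta> + K1 + 1 \<le> C \<and> 2 * \<delta> \<le> K1 + 2 * K2 + 1 \<and> 2 * \<delta> \<le> 3 * K2 \<and>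
         (K1 + 2 * K2 + 1 = 2 * \<delta> \<longrightarrow> 2 * \<delta> + K1 + 2 \<le> C \<and> K1 < M) \<and>
         (C0 \<le> C + 1 \<and> C1 \<le> C + 1 \<or> 2 * \<delta> + K2 \<le> C \<and> (C = 2 * \<delta> + K2 \<longrightarrow> M < K2))" using III(1-4) big' by auto
    qed (use a C in auto)
    then show ?thesis by (rule that)
  qed
qed

section \<open>The Hales-Jewett theorem\<close>

text \<open>Combinatorial lines are encoded as words over \<open>'a option\<close>, with
  \<open>None\<close> at the moving coordinates.\<close>

definition inst :: "'a option list \<Rightarrow> 'a \<Rightarrow> 'a list" where
  "inst T y = map (\<lambda>z. case z of None \<Rightarrow> y | Some x \<Rightarrow> x) T"

definition words :: "'a set \<Rightarrow> nat \<Rightarrow> 'a list set" where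
  "words A n = {w. length w = n \<and> set w \<subseteq> A}"

definition line :: "'a set \<Rightarrow> nat \<Rightarrow> 'a option list \<Rightarrow> bool" where
  "line A n T \<longleftrightarrow> length T = n \<and> None \<in> set T \<and> set T \<subseteq> insert None (Some ` A)"

definition mono_line :: "('a list \<Rightarrow> 'c) \<Rightarrow> 'a set \<Rightarrow> 'a option list \<Rightarrow> bool" where
  "mono_line c A T \<longleftrightarrow> (\<forall>x\<in>A. \<forall>y\<in>A. c (inst T x) = c (inst T y))"

lemma inst_append: "inst (T @ T') y = inst T y @ inst T' y"
  by (simp add: inst_def)

lemma inst_Some: "inst (map Some w) y = w"
  by (simp add: inst_def comp_def)

lemma inst_words: "line A n T \<Longrightarrow> y \<in> A \<Longrightarrow> inst T y \<in> words A n"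
  by (auto simp: line_def words_def inst_def)

lemma line_append: "line A m T \<Longrightarrow> line A n T' \<Longrightarrow> line A (m + n) (T @ T')"
  by (auto simp: line_def)

lemma line_append_Some: "line A m T \<Longrightarrow> w \<in> words A n \<Longrightarrow> line A (m + n) (T @ map Some w)"
  "w \<in> words A m \<Longrightarrow> line A n T \<Longrightarrow> line A (m + n) (map Some w @ T)"
  by (auto simp: line_def words_def)

lemma line_mono: "line A n T \<Longrightarrow> A \<subseteq> B \<Longrightarrow> line B n T"
  unfolding line_def by blast

lemma words_append: "u \<in> words A m \<Longrightarrow> v \<in> words A n \<Longrightarrow> u @ v \<in> words A (m + n)"
  by (auto simp: words_def)

lemma finite_words: "finite A \<Longrightarrow> finite (words A n)"
  using finite_lists_length_eq[of A n] by (simp add: words_def conj_commute)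

definition focused :: "('a list \<Rightarrow> nat) \<Rightarrow> 'a set \<Rightarrow> 'a \<Rightarrow> 'a \<Rightarrow> nat \<Rightarrow> nat \<Rightarrow> bool" where
  "focused c Y y x n r \<longleftrightarrow> (\<exists>z\<in>words (insert x Y) n. \<exists>Ts. (\<forall>i<r. line (insert x Y) n (Ts i) \<and> inst (Ts i) x = z \<and> mono_line c Y (Ts i))
     \<and> inj_on (\<lambda>i. c (inst (Ts i) y)) {..<r})"

text \<open>Colour focusing: each further block of coordinates either completes a monochromatic line
  or adds one more line through a common focus whose colour on \<open>Y\<close> is new.\<close>

lemma focusing:
  assumes Y: "finite Y" "y \<in> Y"
    and hj: "\<And>k. \<exists>n. \<forall>c :: 'a list \<Rightarrow> nat. (\<forall>w\<in>words Y n. c w < k) \<longrightarrow> (\<exists>T. line Y n T \<and> mono_line c Y T)"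
  shows "\<exists>n. \<forall>c. (\<forall>w\<in>words (insert x Y) n. c w < k) \<longrightarrow>
    (\<exists>T. line (insert x Y) n T \<and> mono_line c (insert x Y) T) \<or> focused c Y y x n r"
proof (induction r)
  case 0
  have "focused c Y y x 0 0" for c
    unfolding focused_def by (intro bexI[of _ "[]"]) (auto simp: words_def)
  then show ?case by blast
next
  case (Suc r)
  let ?X = "insert x Y"
  obtain m where m: "\<And>c. (\<forall>w\<in>words ?X m. c w < k) \<Longrightarrow>
    (\<exists>T. line ?X m T \<and> mono_line c ?X T) \<or> focused c Y y x m r" using Suc by blast
  \<comment> \<open>A word of the new block is coloured by the whole function it induces on words of
    the old block; \<open>enc\<close> numbers these finitely many functions.\<close>
  define F where "F = (words ?X m \<rightarrow>\<^sub>E {..<k})"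
  have "finite F" unfolding F_def using Y by (intro finite_PiE finite_words) auto
  then obtain enc :: "('a list \<Rightarrow> nat) \<Rightarrow> nat" and K where enc: "bij_betw enc F {..<K}"
    using ex_bij_betw_finite_nat atLeast0LessThan by metis
  obtain n where n: "\<And>c :: 'a list \<Rightarrow> nat. (\<forall>w\<in>words Y n. c w < K) \<Longrightarrow> \<exists>T. line Y n T \<and> mono_line c Y T"
    using hj by meson
  show ?case
  proof (intro exI[of _ "m + n"] allI impI)
    fix c :: "'a list \<Rightarrow> nat"
    assume c: "\<forall>w\<in>words ?X (m + n). c w < k"
    define g where "g v = restrict (\<lambda>u. c (u @ v)) (words ?X m)" for v
    have YX: "words Y n \<subseteq> words ?X n" by (auto simp: words_def)
    have g: "g v \<in> F" if "v \<in> words ?X n" for v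
      unfolding g_def F_def using c words_append that by fastforce
    have "\<forall>w\<in>words Y n. enc (g w) < K" using g enc YX by (auto simp: bij_betw_def)
    from n[OF this] obtain T' where T': "line Y n T'" "mono_line (\<lambda>v. enc (g v)) Y T'" by auto
    have T'X: "line ?X n T'" using T'(1) line_mono by blast
    define v where "v = inst T' y"
    have v: "v \<in> words ?X n" unfolding v_def using inst_words[OF T'X] Y by simp
    have gv: "g (inst T' y') = g v" if "y' \<in> Y" for y'
    proof -
      have "enc (g (inst T' y')) = enc (g v)" using T'(2) that Y unfolding mono_line_def v_def by blast
      then show ?thesis using enc g v inst_words[OF T'X] that by (auto simp: bij_betw_def inj_on_def)
    qed
    define c' where "c' u = c (u @ v)" for u
    have c'v: "c (u @ inst T' y') = c' u" if "u \<in> words ?X m" "y' \<in> Y" for u y'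
      using fun_cong[OF gv[OF that(2)], of u] that(1) unfolding g_def c'_def by simp
    have lift: "\<exists>T. line ?X (m + n) T \<and> mono_line c ?X T" if "line ?X m T" "mono_line c' ?X T" for T
    proof (intro exI conjI)
      show "line ?X (m + n) (T @ map Some v)" by (rule line_append_Some(1)[OF that(1) v])
      show "mono_line c ?X (T @ map Some v)"
        using that(2) unfolding mono_line_def inst_append inst_Some c'_def .
    qed
    have "\<forall>w\<in>words ?X m. c' w < k" unfolding c'_def using c words_append v by blast
    from m[OF this] show "(\<exists>T. line ?X (m + n) T \<and> mono_line c ?X T) \<or> focused c Y y x (m + n) (Suc r)"
    proof
      assume "focused c' Y y x m r"
      then obtain z Ts where z: "z \<in> words ?X m"
        and Ts: "\<And>i. i < r \<Longrightarrow> line ?X m (Ts i) \<and> inst (Ts i) x = z \<and> mono_line c' Y (Ts i)"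
        and inj: "inj_on (\<lambda>i. c' (inst (Ts i) y)) {..<r}"
        unfolding focused_def by blast
      show ?thesis
      proof (cases "\<exists>i<r. c' z = c' (inst (Ts i) y)")
        case True
        then obtain i where i: "i < r" "c' z = c' (inst (Ts i) y)" by blast
        \<comment> \<open>The focus repeats the colour of line \<open>i\<close>, so this line stays
          monochromatic when \<open>x\<close> is added.\<close>
        then have "mono_line c' ?X (Ts i)" using Ts[OF i(1)] Y unfolding mono_line_def by (metis insertE)
        then show ?thesis using lift Ts[OF i(1)] by blast
      next
        case False
        \<comment> \<open>The old lines move in both blocks and keep their colours. The line with
          index \<open>r\<close> moves only in the new block, over the old focus \<open>z\<close>,
          whose colour is new.\<close>
        define Ts' where "Ts' i = (if i < r then Ts i else map Some z) @ T'" for i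
        have l: "line ?X (m + n) (Ts' i)" for i
          using Ts line_append[OF _ T'X] line_append_Some(2)[OF z T'X] by (auto simp: Ts'_def)
        have f: "inst (Ts' i) x = z @ inst T' x" for i
          using Ts by (auto simp: Ts'_def inst_append inst_Some)
        have col: "c (inst (Ts' i) y') = c' (if i < r then inst (Ts i) y' else z)" if "y' \<in> Y" for i y'
        proof -
          have "(if i < r then inst (Ts i) y' else z) \<in> words ?X m" using z Ts inst_words that by (metis insertCI)
          from c'v[OF this that] show ?thesis by (auto simp: Ts'_def inst_append inst_Some)
        qed
        have mo: "mono_line c Y (Ts' i)" for i
          unfolding mono_line_def
        proof (intro ballI)
          fix y1 y2 assume y: "y1 \<in> Y" "y2 \<in> Y"
          have "c' (inst (Ts i) y1) = c' (inst (Ts i) y2)" if "i < r"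
            using Ts[OF that] y unfolding mono_line_def by blast
          then show "c (inst (Ts' i) y1) = c (inst (Ts' i) y2)" by (simp add: col y)
        qed
        have "inj_on (\<lambda>i. c (inst (Ts' i) y)) {..<Suc r}"
          using inj False unfolding inj_on_def by (auto simp: col[OF Y(2)] less_Suc_eq)
        moreover have "z @ inst T' x \<in> words ?X (m + n)" using words_append[OF z] inst_words[OF T'X] by simp
        ultimately show ?thesis unfolding focused_def using l f mo by blast
      qed
    qed (use lift in blast)
  qed
qed

text \<open>Induction on the alphabet: \<open>Suc k\<close> focused lines would show more than
  \<open>k\<close> colours. One-letter alphabets are split off because focusing needs a letter of
  \<open>Y\<close>.\<close>

theorem hales_jewett:
  fixes A :: "'a set"
  assumes "finite A"
  shows "\<exists>n. \<forall>c :: 'a list \<Rightarrow> nat. (\<forall>w\<in>words A n. c w < k) \<longrightarrow> (\<exists>T. line A n T \<and> mono_line c A T)"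
  using assms
proof (induction A arbitrary: k rule: finite_induct)
  case empty
  show ?case by (intro exI[of _ 1] allI impI exI[of _ "[None]"]) (auto simp: line_def mono_line_def)
next
  case (insert x Y)
  show ?case
  proof (cases "Y = {}")
    case True
    then show ?thesis by (intro exI[of _ 1] allI impI exI[of _ "[None]"]) (auto simp: line_def mono_line_def)
  next
    case False
    then obtain y where y: "y \<in> Y" by blast
    obtain n where n: "\<And>c. (\<forall>w\<in>words (insert x Y) n. c w < k) \<Longrightarrow>
       (\<exists>T. line (insert x Y) n T \<and> mono_line c (insert x Y) T) \<or> focused c Y y x n (Suc k)"
      using focusing[OF insert(1) y insert(3), of x k "Suc k"] by blast
    have "\<not> focused c Y y x n (Suc k)" if c: "\<forall>w\<in>words (insert x Y) n. c w < k" for c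
    proof
      assume "focused c Y y x n (Suc k)"
      then obtain Ts where Ts: "\<And>i. i < Suc k \<Longrightarrow> line (insert x Y) n (Ts i)" "inj_on (\<lambda>i. c (inst (Ts i) y)) {..<Suc k}"
        unfolding focused_def by blast
      have "(\<lambda>i. c (inst (Ts i) y)) ` {..<Suc k} \<subseteq> {..<k}" using c inst_words[OF Ts(1)] y by auto
      from card_inj_on_le[OF Ts(2) this] show False by simp
    qed
    then show ?thesis using n by blast
  qed
qed

section \<open>Completion of graphs with good closed walks\<close>

fun walk :: "('v \<Rightarrow> nat \<Rightarrow> 'v \<Rightarrow> bool) \<Rightarrow> 'v \<Rightarrow> (nat \<times> 'v) list \<Rightarrow> 'v \<Rightarrow> bool" where
  "walk E u [] v \<longleftrightarrow> u = v"
| "walk E u ((s, x) # w) v \<longleftrightarrow> E u s x \<and> walk E x w v"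

lemma walk_append: "walk E u (w @ w') v \<longleftrightarrow> (\<exists>x. walk E u w x \<and> walk E x w' v)"
  by (induction E u w v rule: walk.induct) auto

context magic begin

text \<open>The possible distances of the ends of a path, given the labels along it; by \<open>flip\<close> it does not
  matter that only fans of triangles are used.\<close>

fun span :: "nat list \<Rightarrow> nat set" where
  "span [] = {0}"
| "span (a # w) = {z. z \<le> \<delta> \<and> a \<le> \<delta> \<and> (\<exists>y\<in>span w. tri a y z)}"

lemma span_le: "z \<in> span w \<Longrightarrow> z \<le> \<delta>"
  by (cases w) auto

lemma allowed_0_0: "x \<le> \<delta> \<Longrightarrow> tri x y 0 \<longleftrightarrow> y = x" "x \<le> \<delta> \<Longrightarrow> tri x 0 y \<longleftrightarrow> y = x"
  using allowed_zero[of x y] allowed_sym[of x y 0] allowed_sym[of x 0 y] by simp_all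

lemma span_single: "a \<le> \<delta> \<Longrightarrow> span [a] = {a}"
  by (auto simp: allowed_0_0)

lemma span_single_D: "z \<in> span [a] \<Longrightarrow> z = a \<and> a \<le> \<delta>"
  by (auto simp: allowed_0_0)

text \<open>A fan of triangles can be cut anywhere: both directions move a diagonal across one
  quadrangle by \<open>flip\<close>.\<close>

lemma span_append: "z \<in> span (v @ w) \<longleftrightarrow> z \<le> \<delta> \<and> (\<exists>x\<in>span v. \<exists>y\<in>span w. tri x y z)"
proof (induction v arbitrary: z)
  case Nil
  then show ?case using allowed_zero span_le by auto
next
  case (Cons a v)
  show ?case (is "?l \<longleftrightarrow> ?r")
  proof
    assume ?l
    then obtain u x y where *: "z \<le> \<delta>" "a \<le> \<delta>" "tri a u z" "x \<in> span v" "y \<in> span w" "tri x y u" "u \<le> \<delta>"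
      using Cons by auto
    then have "tri y x u" "tri u a z" by (simp_all add: allowed_sym)
    from flip[OF this] * span_le obtain f where "f \<le> \<delta>" "tri x a f" "tri y f z" by blast
    then have "f \<in> span (a # v)" "tri f y z" using * by (auto simp: allowed_sym)
    then show ?r using * by blast
  next
    assume ?r
    then obtain f x y where *: "z \<le> \<delta>" "a \<le> \<delta>" "tri a x f" "x \<in> span v" "y \<in> span w" "tri f y z" "f \<le> \<delta>"
      by auto
    from flip[OF *(3,6)] * span_le obtain u where "u \<le> \<delta>" "tri x y u" "tri a u z" by blast
    then show ?l using * Cons by auto
  qed
qed

text \<open>Closing two words into one cycle means choosing a common distance for their ends. All
  gluing rules for closed walks come from this.\<close>

lemma span_append_0: "0 \<in> span (v @ w) \<longleftrightarrow> (\<exists>x\<in>span v. x \<in> span w)"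
proof -
  have "tri x y 0 \<longleftrightarrow> y = x" if "x \<in> span v" for x y
    using allowed_0_0(1) span_le[OF that] by simp
  then show ?thesis by (auto simp: span_append)
qed

section \<open>Values forced along walks\<close>

lemma fork_M: "b \<le> \<delta> \<Longrightarrow> fork M b = M" "b \<le> \<delta> \<Longrightarrow> fork b M = M"
  using M by (auto simp: fork_def)

lemma fork_comm: "fork a b = fork b a"
  by (auto simp: fork_def)

lemma time_le_M: "time x \<le> time M"
  using M acc by (auto simp: time_def)

text \<open>The forced value is recorded together with its walk, so that goodness of closed walks
  can be applied to it. Excluding \<open>M\<close> as the value of a join makes \<open>time\<close>
  increase at each join.\<close>

inductive tree :: "('v \<Rightarrow> nat \<Rightarrow> 'v \<Rightarrow> bool) \<Rightarrow> 'v \<Rightarrow> nat \<Rightarrow> (nat \<times> 'v) list \<Rightarrow> 'v \<Rightarrow> bool" for E where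
  edge: "E u s v \<Longrightarrow> tree E u s [(s, v)] v"
| join: "tree E u a w x \<Longrightarrow> tree E x b w' v \<Longrightarrow> fork a b \<noteq> M \<Longrightarrow> tree E u (fork a b) (w @ w') v"

lemma tree_walk: "tree E u m w v \<Longrightarrow> walk E u w v"
  by (induction rule: tree.induct) (auto simp: walk_append)

end

text \<open>A tree contributes a walk of length at most \<open>2 ^ (2 * \<delta>)\<close>, and a triangle of forced values
  consists of three trees.\<close>

locale good_graph = magic +
  fixes E :: "'v \<Rightarrow> nat \<Rightarrow> 'v \<Rightarrow> bool"
  assumes sym: "E u s v \<Longrightarrow> E v s u"
    and label: "E u s v \<Longrightarrow> 1 \<le> s \<and> s \<le> \<delta>"
    and good: "walk E u w u \<Longrightarrow> length w \<le> 3 * 2 ^ (2 * \<delta>) \<Longrightarrow> 0 \<in> span (map fst w)"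
begin

lemma tree_bounds: "tree E u m w v \<Longrightarrow> 1 \<le> m \<and> m \<le> \<delta>"
  by (induction rule: tree.induct) (use label fork_bounds in auto)

lemma tree_sym: "tree E u m w v \<Longrightarrow> \<exists>w'. tree E v m w' u"
proof (induction rule: tree.induct)
  case edge then show ?case using sym tree.edge by metis
next
  case join then show ?case using tree.join fork_comm by metis
qed

lemma tree_length_time: "tree E u m w v \<Longrightarrow> length w \<le> 2 ^ time m"
proof (induction rule: tree.induct)
  case (join u a w x b w' v)
  have "time a < time (fork a b)" "time b < time (fork a b)" using time_fork tree_bounds join by blast+
  then have "2 ^ time a \<le> (2::nat) ^ (time (fork a b) - 1)" "2 ^ time b \<le> (2::nat) ^ (time (fork a b) - 1)" "time (fork a b) > 0"
    by (auto intro!: power_increasing)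
  moreover from this have "(2::nat) ^ time (fork a b) = 2 * 2 ^ (time (fork a b) - 1)"
    by (metis Suc_diff_1 power_Suc)
  moreover have "length (w @ w') \<le> 2 ^ time a + 2 ^ time b" using join by simp
  ultimately show ?case by linarith
qed auto

lemma tree_length:
  assumes "tree E u m w v"
  shows "length w \<le> 2 ^ (2 * \<delta>)"
proof -
  have "time m \<le> 2 * \<delta>" using time_le_M[of m] by (simp add: time_def[of M])
  then have "(2::nat) ^ time m \<le> 2 ^ (2 * \<delta>)" by (rule power_increasing) simp
  then show ?thesis using tree_length_time[OF assms] by linarith
qed

lemma tree_realises: "tree E u m w v \<Longrightarrow> z \<in> span (map fst w) \<Longrightarrow> realises m z"
proof (induction arbitrary: z rule: tree.induct)
  case (edge u s v)
  then have "z \<in> span [s]" by simp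
  then show ?case using span_single_D realises_refl by blast
next
  case (join u a w x b w' v)
  then obtain y y' where y: "y \<in> span (map fst w)" "y' \<in> span (map fst w')" "tri y y' z" "z \<le> \<delta>"
    by (auto simp: span_append)
  show ?case
    using realises_fork[OF join.IH(1)[OF y(1)] join.IH(2)[OF y(2)] y(3)] tree_bounds[OF join.hyps(1)] tree_bounds[OF join.hyps(2)]
      span_le y by blast
qed

section \<open>The completed distance\<close>

definition vals :: "'v \<Rightarrow> 'v \<Rightarrow> nat set" where
  "vals u v = insert M {m. \<exists>w. tree E u m w v}"

lemma vals_sym: "vals u v = vals v u"
  unfolding vals_def using tree_sym by blast

lemma vals_bounds: "m \<in> vals u v \<Longrightarrow> 1 \<le> m \<and> m \<le> \<delta>"
  unfolding vals_def using tree_bounds M acc by auto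

text \<open>\<open>M\<close> belongs to each \<open>vals u v\<close> and has the latest time, so it
  is chosen only when no other value is forced.\<close>

definition dst :: "'v \<Rightarrow> 'v \<Rightarrow> nat" where
  "dst u v = arg_min time (\<lambda>m. m \<in> vals u v)"

lemma dst_vals: "dst u v \<in> vals u v" and dst_le: "m \<in> vals u v \<Longrightarrow> time (dst u v) \<le> time m"
proof -
  have "M \<in> vals u v" by (simp add: vals_def)
  from arg_min_nat_lemma[of "\<lambda>m. m \<in> vals u v", OF this, of time]
  show "dst u v \<in> vals u v" "m \<in> vals u v \<Longrightarrow> time (dst u v) \<le> time m" unfolding dst_def by blast+
qed

lemma dst_sym: "dst u v = dst v u"
  unfolding dst_def by (simp add: vals_sym)

lemma dst_bounds: "1 \<le> dst u v" "dst u v \<le> \<delta>"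
  using dst_vals vals_bounds by blast+

lemma dst_tree: "dst u v \<noteq> M \<Longrightarrow> \<exists>w. tree E u (dst u v) w v"
  using dst_vals[of u v] by (auto simp: vals_def)

text \<open>Trees for the chosen values join to a tree for their fork, so the fork competes in the
  minimum.\<close>

lemma dst_time: "time (dst u v) \<le> time (fork (dst u x) (dst x v))"
proof (cases "fork (dst u x) (dst x v) = M")
  case True
  then show ?thesis using time_le_M by simp
next
  case False
  then have "dst u x \<noteq> M" "dst x v \<noteq> M" using fork_M dst_bounds by metis+
  then obtain w w' where "tree E u (dst u x) w x" "tree E x (dst x v) w' v" using dst_tree by meson
  then have "tree E u (fork (dst u x) (dst x v)) (w @ w') v" using False by (rule tree.join)
  then show ?thesis by (intro dst_le) (auto simp: vals_def)
qed

text \<open>Closing the walk of a competing tree by the edge gives a good closed walk. Hence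
  \<open>s\<close> is a possible distance along that walk, realises the competing value and is no
  later.\<close>

lemma dst_edge:
  assumes "E u s v"
  shows "dst u v = s"
proof -
  have s: "s \<in> vals u v" using tree.edge[of E, OF assms] by (auto simp: vals_def)
  have "time s \<le> time m" if m: "m \<in> vals u v" for m
  proof (cases "m = M")
    case False
    then obtain w where t: "tree E u m w v" using m by (auto simp: vals_def)
    have "walk E u (w @ [(s,u)]) u" using tree_walk[OF t] sym[OF assms] by (auto simp: walk_append)
    moreover have "length w + 1 \<le> 3 * 2 ^ (2*\<delta>)" using tree_length[OF t] by (simp add: le_trans[of _ "2 ^ (2*\<delta>) + 1"])
    ultimately have "0 \<in> span (map fst w @ [s])" using good[of u "w @ [(s,u)]"] by simp
    then have "s \<in> span (map fst w)" using span_append_0 span_single_D by blast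
    then show ?thesis using tree_realises[OF t] time_realises tree_bounds[OF t] label[OF assms] by blast
  qed (use time_le_M in simp)
  then have "time (dst u v) = time s" using dst_vals dst_le s by (meson le_antisym)
  then show ?thesis using time_inj dst_bounds label[OF assms] by blast
qed

text \<open>For \<open>time_fork_allowed\<close> a triangle of actual distances realising the three
  values is required. Three trees close up to a good walk and provide it; if one value is
  \<open>M\<close>, which every distance realises, the fork of the other two serves in its
  place.\<close>

lemma dst_allowed: "tri (dst u v) (dst v x) (dst u x)"
proof -
  have ex: "\<exists>a b c. realises (dst u v) a \<and> realises (dst v x) b \<and> realises (dst u x) c \<and> tri a b c \<and> a \<le> \<delta> \<and> b \<le> \<delta> \<and> c \<le> \<delta>"
  proof (cases "dst u v = M \<or> dst v x = M \<or> dst u x = M")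
    case True
    note o = fork_allowed fork_bounds dst_bounds realises_refl
    have M: "realises M y" for y by (simp add: realises_def)
    from True show ?thesis
    proof (elim disjE)
      assume "dst u v = M"
      moreover have "tri (fork (dst v x) (dst u x)) (dst v x) (dst u x)"
        using fork_allowed[of "dst v x" "dst u x"] dst_bounds by (simp add: allowed_sym)
      ultimately show ?thesis using o M by metis
    next
      assume "dst v x = M"
      moreover have "tri (dst u v) (fork (dst u v) (dst u x)) (dst u x)"
        using fork_allowed[of "dst u v" "dst u x"] dst_bounds by (simp add: allowed_sym)
      ultimately show ?thesis using o M by metis
    next
      assume "dst u x = M"
      then show ?thesis using o M by metis
    qed
  next
    case False
    then obtain w1 w2 w3 where t: "tree E u (dst u v) w1 v" "tree E v (dst v x) w2 x" "tree E x (dst u x) w3 u"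
      using dst_tree dst_sym by metis
    have "length w1 + (length w2 + length w3) \<le> 3 * 2 ^ (2*\<delta>)" using t[THEN tree_length] by linarith
    moreover have "walk E u (w1 @ (w2 @ w3)) u" using t[THEN tree_walk] walk_append by metis
    ultimately have "0 \<in> span (map fst w1 @ (map fst w2 @ map fst w3))" using good[of u "w1 @ (w2 @ w3)"] by simp
    then obtain a where a: "a \<in> span (map fst w1)" "a \<in> span (map fst w2 @ map fst w3)" using span_append_0 by blast
    then obtain b c where "b \<in> span (map fst w2)" "c \<in> span (map fst w3)" "tri b c a" by (auto simp: span_append)
    moreover from this have "tri a b c" by (simp add: allowed_sym)
    ultimately show ?thesis using a t[THEN tree_realises] span_le by metis
  qed
  then obtain a b c where "realises (dst u v) a" "realises (dst v x) b" "realises (dst u x) c" "tri a b c" "a \<le> \<delta>" "b \<le> \<delta>" "c \<le> \<delta>"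
    by blast
  from time_fork_allowed[OF _ _ _ this(1-4)] this(5-) show ?thesis
    using dst_time dst_bounds dst_sym by metis
qed

end

section \<open>The partite construction\<close>

text \<open>A single type that is closed under all constructions: the base of Ramsey's theorem, the disjoint
  copies of \<open>B\<close>, the fibre powers, and the copies of the vertices outside of a fibre power.\<close>

datatype vertex = Base nat | Copy "nat \<Rightarrow> vertex" nat | In "vertex list" | Out "(nat \<Rightarrow> vertex) option list" vertex

definition pattern :: "nat set \<Rightarrow> nat \<Rightarrow> (nat \<Rightarrow> nat \<Rightarrow> nat) \<Rightarrow> bool" where
  "pattern L a lab \<longleftrightarrow> (\<forall>i<a. \<forall>j<a. i \<noteq> j \<longrightarrow> lab i j \<in> L \<and> lab i j = lab j i)"

text \<open>Vertices carry a rank in place of an order: copies increase strictly in rank, and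
  vertices of equal rank stay incomparable until the completion.\<close>

definition copies :: "nat \<Rightarrow> (nat \<Rightarrow> nat \<Rightarrow> nat) \<Rightarrow> 'v set \<Rightarrow> ('v \<Rightarrow> nat \<Rightarrow> 'v \<Rightarrow> bool) \<Rightarrow> ('v \<Rightarrow> nat) \<Rightarrow> (nat \<Rightarrow> 'v) set" where
  "copies a lab V E r = {\<alpha> \<in> {..<a} \<rightarrow>\<^sub>E V. \<forall>i<a. \<forall>j<a. i < j \<longrightarrow> r (\<alpha> i) < r (\<alpha> j) \<and> E (\<alpha> i) (lab i j) (\<alpha> j)}"

definition pattern_edge :: "nat \<Rightarrow> (nat \<Rightarrow> nat \<Rightarrow> nat) \<Rightarrow> nat \<Rightarrow> nat \<Rightarrow> nat \<Rightarrow> bool" where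
  "pattern_edge b lab i s j \<longleftrightarrow> i < b \<and> j < b \<and> i \<noteq> j \<and> s = lab i j"

abbreviation maps :: "nat \<Rightarrow> (nat \<Rightarrow> nat \<Rightarrow> nat) \<Rightarrow> nat \<Rightarrow> (nat \<Rightarrow> nat \<Rightarrow> nat) \<Rightarrow> (nat \<Rightarrow> nat) set" where
  "maps a labA b labB \<equiv> copies a labA {..<b} (pattern_edge b labB) id"

lemma walk_map:
  assumes "walk E u w v" "\<And>x s y. x \<in> insert u (snd ` set w) \<Longrightarrow> y \<in> insert u (snd ` set w) \<Longrightarrow> E x s y \<Longrightarrow> E' (\<phi> x) s (\<phi> y)"
  shows "walk E' (\<phi> u) (map (apsnd \<phi>) w) (\<phi> v)"
  using assms
proof (induction E u w v rule: walk.induct)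
  case (2 E u s x w v)
  have "walk E' (\<phi> x) (map (apsnd \<phi>) w) (\<phi> v)"
  proof (rule 2(1))
    show "walk E x w v" using 2(2) by simp
    show "E' (\<phi> y) t (\<phi> z)" if "y \<in> insert x (snd ` set w)" "z \<in> insert x (snd ` set w)" "E y t z" for y t z
      using that by (intro 2(3)) auto
  qed
  moreover have "E' (\<phi> u) s (\<phi> x)" using 2(2) by (intro 2(3)) auto
  ultimately show ?case by simp
qed auto

lemma walk_split:
  assumes "walk E u w v" "x \<in> snd ` set w"
  obtains w1 w2 where "w = w1 @ w2" "walk E u w1 x" "walk E x w2 v" "w1 \<noteq> []"
  using assms
proof (induction E u w v arbitrary: thesis rule: walk.induct)
  case (2 E u s y w v)
  show ?case
  proof (cases "x = y")
    case True
    then show ?thesis using 2(2)[of "[(s,y)]" w] 2(3) by auto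
  next
    case False
    then have "x \<in> snd ` set w" "walk E y w v" using 2 by auto
    then obtain w1 w2 where "w = w1 @ w2" "walk E y w1 x" "walk E x w2 v" using 2(1) by metis
    then show ?thesis using 2(2)[of "(s,y) # w1" w2] 2(3) by auto
  qed
qed auto

lemma walk_end: "walk E u w v \<Longrightarrow> w \<noteq> [] \<Longrightarrow> v \<in> snd ` set w"
  by (induction E u w v rule: walk.induct) (auto, metis image_eqI list.set_intros(1) neq_Nil_conv snd_conv walk.simps(1))

definition graph :: "nat set \<Rightarrow> 'v set \<Rightarrow> ('v \<Rightarrow> nat \<Rightarrow> 'v \<Rightarrow> bool) \<Rightarrow> bool" where
  "graph L V E \<longleftrightarrow> finite V \<and> (\<forall>u s v. E u s v \<longrightarrow> u \<in> V \<and> v \<in> V \<and> s \<in> L \<and> E v s u)"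

text \<open>\<open>G\<close> is the set of good words.  By \<open>glue_edge\<close> a closed walk may be cut along a chord.\<close>

locale gluing =
  fixes L :: "nat set" and G :: "nat list set"
  assumes nil: "[] \<in> G"
    and rotate: "v @ w \<in> G \<Longrightarrow> w @ v \<in> G"
    and glue: "v \<in> G \<Longrightarrow> w \<in> G \<Longrightarrow> v @ w \<in> G"
    and glue_edge: "t \<in> L \<Longrightarrow> v @ [t] \<in> G \<Longrightarrow> w @ [t] \<in> G \<Longrightarrow> v @ w \<in> G"
    and single: "s \<in> L \<Longrightarrow> [s] \<notin> G"
    and double: "s \<in> L \<Longrightarrow> t \<in> L \<Longrightarrow> [s, t] \<in> G \<longleftrightarrow> s = t"
begin

definition walks_good :: "nat \<Rightarrow> ('v \<Rightarrow> nat \<Rightarrow> 'v \<Rightarrow> bool) \<Rightarrow> bool" where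
  "walks_good l E \<longleftrightarrow> (\<forall>u w. walk E u w u \<longrightarrow> length w \<le> l \<longrightarrow> map fst w \<in> G)"

lemma good_loop:
  assumes "walks_good l E" "1 \<le> l" "graph L V E" "E u s v"
  shows "u \<noteq> v"
proof
  assume "u = v"
  then have "walk E u [(s, u)] u" using assms by simp
  then have "map fst [(s, u)] \<in> G" using assms(1,2) unfolding walks_good_def by (metis length_Cons list.size(3) One_nat_def)
  then show False using single assms(3,4) unfolding graph_def by auto
qed

lemma good_label:
  assumes "walks_good l E" "2 \<le> l" "graph L V E" "E u s v" "E u t v"
  shows "s = t"
proof -
  have "walk E u [(s, v), (t, u)] u" using assms(3-) unfolding graph_def by auto
  then have "map fst [(s, v), (t, u)] \<in> G" using assms(1,2) unfolding walks_good_def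
    by (metis length_Cons list.size(3) One_nat_def Suc_1)
  then show ?thesis using double assms(3-) unfolding graph_def by auto
qed

end

definition sections :: "nat \<Rightarrow> (nat \<Rightarrow> nat \<Rightarrow> nat) \<Rightarrow> 'v set \<Rightarrow> ('v \<Rightarrow> nat \<Rightarrow> 'v \<Rightarrow> bool) \<Rightarrow> ('v \<Rightarrow> 'q) \<Rightarrow> (nat \<Rightarrow> 'q) \<Rightarrow> (nat \<Rightarrow> 'v) set" where
  "sections a lab V E \<pi> f = {\<alpha> \<in> {..<a} \<rightarrow>\<^sub>E V. (\<forall>i<a. \<pi> (\<alpha> i) = f i) \<and> (\<forall>i<a. \<forall>j<a. i < j \<longrightarrow> E (\<alpha> i) (lab i j) (\<alpha> j))}"

text \<open>The picture is one step better than its target, with good walks up to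
  \<open>Suc l\<close> against \<open>l\<close>. The construction over the single copy
  \<open>f\<close> must preserve this.\<close>

locale partite = gluing L G for L G +
  fixes a :: nat and lab :: "nat \<Rightarrow> nat \<Rightarrow> nat"
    and VQ :: "vertex set" and EQ :: "vertex \<Rightarrow> nat \<Rightarrow> vertex \<Rightarrow> bool" and rQ :: "vertex \<Rightarrow> nat"
    and V :: "vertex set" and E :: "vertex \<Rightarrow> nat \<Rightarrow> vertex \<Rightarrow> bool" and \<pi> :: "vertex \<Rightarrow> vertex"
    and l :: nat and f :: "nat \<Rightarrow> vertex"
  assumes A: "pattern L a lab"
    and Q: "graph L VQ EQ" "walks_good l EQ" "1 \<le> l"
    and P: "graph L V E" "walks_good (Suc l) E"
    and proj: "\<And>v. v \<in> V \<Longrightarrow> \<pi> v \<in> VQ" "\<And>u s v. E u s v \<Longrightarrow> EQ (\<pi> u) s (\<pi> v)"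
    and f: "f \<in> copies a lab VQ EQ rQ"
begin

lemma f_edge: "i < a \<Longrightarrow> j < a \<Longrightarrow> i \<noteq> j \<Longrightarrow> EQ (f i) (lab i j) (f j)"
  using f A Q(1) unfolding copies_def pattern_def graph_def by (cases i j rule: linorder_cases) auto

lemma f_inj: "i < a \<Longrightarrow> j < a \<Longrightarrow> f i = f j \<Longrightarrow> i = j"
  using f_edge[of i j] good_loop[OF Q(2,3,1)] by metis

section \<open>The fibre power over one copy of the pattern\<close>

definition idx :: "vertex \<Rightarrow> nat" where "idx v = (THE i. i < a \<and> f i = \<pi> v)"

lemma idx: "i < a \<Longrightarrow> \<pi> v = f i \<Longrightarrow> idx v = i"
  unfolding idx_def using f_inj by (intro the_equality) auto

definition D :: "vertex set" where "D = {v \<in> V. \<pi> v \<in> f ` {..<a}}"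

lemma idxD: "v \<in> D \<Longrightarrow> idx v < a \<and> f (idx v) = \<pi> v"
  unfolding D_def using idx by auto

definition Sec :: "(nat \<Rightarrow> vertex) set" where
  "Sec = {\<alpha> \<in> {..<a} \<rightarrow>\<^sub>E V. (\<forall>i<a. \<pi> (\<alpha> i) = f i) \<and> (\<forall>i<a. \<forall>j<a. i \<noteq> j \<longrightarrow> E (\<alpha> i) (lab i j) (\<alpha> j))}"

lemma finite_Sec: "finite Sec"
proof -
  have "finite ({..<a} \<rightarrow>\<^sub>E V)" using P(1) by (intro finite_PiE) (auto simp: graph_def)
  then show ?thesis unfolding Sec_def by simp
qed

definition app :: "(nat \<Rightarrow> vertex) option list \<Rightarrow> vertex \<Rightarrow> vertex list" where
  "app T v = map (\<lambda>z. case z of None \<Rightarrow> v | Some \<alpha> \<Rightarrow> \<alpha> (idx v)) T"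

text \<open>The copy of the picture belonging to the line \<open>T\<close>. The tag \<open>T\<close>
  outside \<open>D\<close> makes copies for different lines meet only in the fibre power; inside, a
  fixed coordinate is filled by the vertex of its section in the fibre of \<open>v\<close>.\<close>

definition lift :: "(nat \<Rightarrow> vertex) option list \<Rightarrow> vertex \<Rightarrow> vertex" where
  "lift T v = (if v \<in> D then In (app T v) else Out T v)"

definition fibre :: "nat \<Rightarrow> vertex list \<Rightarrow> nat \<Rightarrow> bool" where
  "fibre n g i \<longleftrightarrow> i < a \<and> length g = n \<and> (\<forall>x\<in>set g. x \<in> V \<and> \<pi> x = f i)"

definition V' :: "nat \<Rightarrow> vertex set" where
  "V' n = {In g | g i. fibre n g i} \<union> {Out T v | T v. line Sec n T \<and> v \<in> V - D}"

definition power_edge :: "nat \<Rightarrow> vertex \<Rightarrow> nat \<Rightarrow> vertex \<Rightarrow> bool" where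
  "power_edge n x s y \<longleftrightarrow> (\<exists>g h i j. x = In g \<and> y = In h \<and> fibre n g i \<and> fibre n h j \<and> i \<noteq> j \<and> s = lab i j \<and>
     (\<forall>m<n. E (g ! m) s (h ! m)))"

text \<open>Edges inside the fibre power may come from edges of the picture whose label differs from \<open>lab\<close>:
  for \<open>l = 1\<close> a pair of vertices of \<open>VQ\<close> can carry several labels.\<close>

definition lift_edge :: "nat \<Rightarrow> vertex \<Rightarrow> nat \<Rightarrow> vertex \<Rightarrow> bool" where
  "lift_edge n x s y \<longleftrightarrow> (\<exists>T u v. line Sec n T \<and> E u s v \<and> x = lift T u \<and> y = lift T v)"

definition E' :: "nat \<Rightarrow> vertex \<Rightarrow> nat \<Rightarrow> vertex \<Rightarrow> bool" where
  "E' n x s y \<longleftrightarrow> power_edge n x s y \<or> lift_edge n x s y"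

fun \<pi>' :: "vertex \<Rightarrow> vertex" where
  "\<pi>' (In g) = \<pi> (hd g)"
| "\<pi>' (Out T v) = \<pi> v"
| "\<pi>' v = v"

lemma line_pos: "line Sec n T \<Longrightarrow> n > 0"
  by (auto simp: line_def)

lemma fibre_app: "line Sec n T \<Longrightarrow> v \<in> D \<Longrightarrow> fibre n (app T v) (idx v)"
  using idxD[of v] unfolding fibre_def app_def line_def
  by (auto simp: D_def Sec_def split: option.splits)

lemma app_edge:
  assumes "line Sec n T" "m < n" "u \<in> D" "v \<in> D" "idx u \<noteq> idx v" "E u s v"
  shows "E (app T u ! m) s (app T v ! m) \<and> T ! m = None \<or> E (app T u ! m) (lab (idx u) (idx v)) (app T v ! m)"
proof (cases "T ! m")
  case None
  then show ?thesis using assms unfolding app_def line_def by simp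
next
  case (Some \<alpha>)
  then have "\<alpha> \<in> Sec" using assms unfolding line_def by (metis (no_types, lifting) imageE insertE nth_mem option.distinct(1) option.inject subsetD)
  then have "E (\<alpha> (idx u)) (lab (idx u) (idx v)) (\<alpha> (idx v))" using assms idxD unfolding Sec_def by blast
  then show ?thesis using Some assms unfolding app_def line_def by simp
qed

lemma lift_V': "line Sec n T \<Longrightarrow> v \<in> V \<Longrightarrow> lift T v \<in> V' n"
  unfolding lift_def V'_def using fibre_app by auto

lemma fibre_hd: "0 < n \<Longrightarrow> fibre n g i \<Longrightarrow> \<pi> (hd g) = f i"
  unfolding fibre_def by (cases g) auto

lemma \<pi>'_lift: "line Sec n T \<Longrightarrow> v \<in> V \<Longrightarrow> \<pi>' (lift T v) = \<pi> v"
  using fibre_hd[OF line_pos fibre_app] idxD unfolding lift_def by auto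

lemma finite_V': "finite (V' n)"
proof -
  have fV: "finite V" using P by (auto simp: graph_def)
  have "{In g | g i. fibre n g i} \<subseteq> In ` {g. set g \<subseteq> V \<and> length g = n}" unfolding fibre_def by auto
  moreover have "{Out T v | T v. line Sec n T \<and> v \<in> V - D} \<subseteq>
      (\<lambda>(T, v). Out T v) ` ({T. set T \<subseteq> insert None (Some ` Sec) \<and> length T = n} \<times> V)"
    unfolding line_def by auto
  ultimately show ?thesis unfolding V'_def
    using finite_lists_length_eq[OF fV, of n] finite_lists_length_eq[of "insert None (Some ` Sec)" n] finite_Sec fV
    by (metis (no_types, lifting) finite_SigmaI finite_Un finite_imageI finite_insert finite_subset)
qed

lemma graph': "graph L (V' n) (E' n)"
  unfolding graph_def
proof (intro conjI allI impI finite_V')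
  fix u s v
  assume "E' n u s v"
  then consider "power_edge n u s v" | "lift_edge n u s v" unfolding E'_def by blast
  note * = this
  have sym: "E x s y \<Longrightarrow> E y s x" "E x s y \<Longrightarrow> x \<in> V \<and> y \<in> V \<and> s \<in> L" for x s y using P(1) unfolding graph_def by blast+
  have "u \<in> V' n \<and> v \<in> V' n"
    using *
  proof cases
    case 1
    then show ?thesis unfolding power_edge_def V'_def by blast
  next
    case 2
    then show ?thesis unfolding lift_edge_def using lift_V' sym(2) by blast
  qed
  then show "u \<in> V' n" "v \<in> V' n" by blast+
  show "s \<in> L"
    using * A by cases (auto simp: power_edge_def lift_edge_def pattern_def fibre_def dest: sym)
  show "E' n v s u"
    using *
  proof cases
    case 1
    then obtain g h i j where "u = In g" "v = In h" "fibre n g i" "fibre n h j" "i \<noteq> j" "s = lab i j" "\<forall>m<n. E (g ! m) s (h ! m)"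
      unfolding power_edge_def by blast
    moreover from this have "s = lab j i" using A unfolding pattern_def fibre_def by auto
    ultimately have "power_edge n v s u" unfolding power_edge_def using sym by metis
    then show ?thesis unfolding E'_def by blast
  next
    case 2
    then show ?thesis using sym unfolding lift_edge_def E'_def by blast
  qed
qed

lemma proj':
  assumes "0 < n"
  shows "v \<in> V' n \<Longrightarrow> \<pi>' v \<in> VQ" "E' n u s v \<Longrightarrow> EQ (\<pi>' u) s (\<pi>' v)"
proof -
  have "f i \<in> VQ" if "i < a" for i using f that unfolding copies_def by auto
  moreover have "\<pi> (hd g) = f i \<and> i < a" if "fibre n g i" for g i
    using fibre_hd[OF assms that] that by (simp add: fibre_def)
  ultimately show "v \<in> V' n \<Longrightarrow> \<pi>' v \<in> VQ"
    unfolding V'_def using proj by auto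
  assume "E' n u s v"
  then consider "power_edge n u s v" | "lift_edge n u s v" unfolding E'_def by blast
  then show "EQ (\<pi>' u) s (\<pi>' v)"
  proof cases
    case 1
    then obtain g h i j where *: "u = In g" "v = In h" "fibre n g i" "fibre n h j" "i \<noteq> j" "s = lab i j"
      unfolding power_edge_def by blast
    then have "i < a" "j < a" by (auto simp: fibre_def)
    then show ?thesis using * fibre_hd[OF assms *(3)] fibre_hd[OF assms *(4)] f_edge by simp
  next
    case 2
    then show ?thesis unfolding lift_edge_def using \<pi>'_lift proj P(1) by (metis graph_def)
  qed
qed

lemma power_edge_nth:
  "power_edge n (In g) s (In h) \<Longrightarrow> m < n \<Longrightarrow> E (g ! m) s (h ! m)"
  unfolding power_edge_def by auto

lemma lift_In: "lift T u = In g \<Longrightarrow> u \<in> D \<and> g = app T u"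
  unfolding lift_def by (auto split: if_splits)

lemma E_V: "E u s v \<Longrightarrow> u \<in> V \<and> v \<in> V \<and> s \<in> L \<and> E v s u"
  using P(1) unfolding graph_def by blast

lemma idx_neq:
  assumes "u \<in> D" "v \<in> D" "E u s v"
  shows "idx u \<noteq> idx v"
proof
  assume "idx u = idx v"
  then have "\<pi> u = \<pi> v" using idxD assms by metis
  then show False using good_loop[OF Q(2,3,1)] proj(2)[OF assms(3)] by metis
qed

lemma In_edge_nth:
  assumes "E' n (In g) s (In h)" "0 < n"
  shows "\<exists>i j. fibre n g i \<and> fibre n h j \<and> i \<noteq> j \<and> (\<forall>m<n. E (g ! m) s (h ! m) \<or> E (g ! m) (lab i j) (h ! m)) \<and>
    (\<exists>m<n. E (g ! m) s (h ! m))"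
proof -
  from assms consider "power_edge n (In g) s (In h)" | "lift_edge n (In g) s (In h)" unfolding E'_def by blast
  then show ?thesis
  proof cases
    case 1
    then show ?thesis using assms(2) unfolding power_edge_def by blast
  next
    case 2
    then obtain T u v where T: "line Sec n T" "E u s v" "In g = lift T u" "In h = lift T v"
      unfolding lift_edge_def by blast
    then have D: "u \<in> D" "v \<in> D" "g = app T u" "h = app T v" using lift_In by metis+
    have ne: "idx u \<noteq> idx v" using idx_neq D T by blast
    obtain m where m: "m < n" "T ! m = None" using T(1) unfolding line_def by (metis in_set_conv_nth)
    then have "E (g ! m) s (h ! m)" using D T(1,2) by (simp add: app_def line_def)
    moreover have "\<forall>m<n. E (g ! m) s (h ! m) \<or> E (g ! m) (lab (idx u) (idx v)) (h ! m)"
      using D app_edge[OF T(1) _ D(1,2) ne T(2)] by blast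
    ultimately show ?thesis using fibre_app[OF T(1)] D ne m(1) by blast
  qed
qed

lemma fibre_unique:
  assumes "0 < n" "fibre n g i" "fibre n g j"
  shows "i = j"
proof -
  have "f i = f j" using fibre_hd[OF assms(1,2)] fibre_hd[OF assms(1,3)] by simp
  then show ?thesis using assms f_inj unfolding fibre_def by blast
qed

text \<open>The picture has unique labels since \<open>Suc l \<ge> 2\<close>. In the power some
  coordinate shows \<open>s\<close>, where \<open>t\<close> or the pattern label occurs too, and
  likewise for \<open>t\<close>; so \<open>s\<close> and \<open>t\<close> agree, directly or through
  the pattern label.\<close>

lemma label_unique:
  assumes "E' n x s y" "E' n x t y" "0 < n"
  shows "s = t"
proof -
  have uE: "E u p v \<Longrightarrow> E u q v \<Longrightarrow> p = q" for u p q v using good_label[OF P(2) _ P(1)] Q(3) by simp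
  show ?thesis
  proof (cases "\<exists>g h. x = In g \<and> y = In h")
    case True
    then obtain g h where xy: "x = In g" "y = In h" by blast
    obtain i j where 1: "fibre n g i" "fibre n h j" "\<forall>m<n. E (g ! m) s (h ! m) \<or> E (g ! m) (lab i j) (h ! m)"
      "\<exists>m<n. E (g ! m) s (h ! m)" using In_edge_nth[OF assms(1)[unfolded xy] assms(3)] by blast
    obtain i' j' where 2: "fibre n g i'" "fibre n h j'" "\<forall>m<n. E (g ! m) t (h ! m) \<or> E (g ! m) (lab i' j') (h ! m)"
      "\<exists>m<n. E (g ! m) t (h ! m)" using In_edge_nth[OF assms(2)[unfolded xy] assms(3)] by blast
    have "i = i'" "j = j'" using fibre_unique[OF assms(3)] 1(1,2) 2(1,2) by blast+
    then show ?thesis using 1(3,4) 2(3,4) uE by metis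
  next
    case False
    then have "\<not> power_edge n x s y" "\<not> power_edge n x t y" unfolding power_edge_def by blast+
    then obtain T u v T' u' v' where T: "line Sec n T" "E u s v" "x = lift T u" "y = lift T v"
      and T': "line Sec n T'" "E u' t v'" "x = lift T' u'" "y = lift T' v'"
      using assms unfolding E'_def lift_edge_def by metis
    obtain m where m: "m < n" "T ! m = None" using T(1) unfolding line_def by (metis in_set_conv_nth)
    have eqs: "T = T'" using False T(3,4) T'(3,4) unfolding lift_def by (auto split: if_splits)
    have inj: "p = q" if "lift T p = lift T q" for p q
    proof (cases "p \<in> D")
      case True
      then have "q \<in> D" "app T p = app T q" using that unfolding lift_def by (auto split: if_splits)
      then have "app T p ! m = app T q ! m" by simp
      then show ?thesis using m T(1) by (simp add: app_def line_def)
    next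
      case False
      then show ?thesis using that unfolding lift_def by (auto split: if_splits)
    qed
    show ?thesis using inj T T' eqs uE by metis
  qed
qed

text \<open>For \<open>l \<ge> 2\<close> labels in the target are unique, so an edge lifted into the
  power carries the pattern label at all coordinates.\<close>

lemma In_edge_power:
  assumes "E' n (In g) s (In h)" "2 \<le> l"
  shows "power_edge n (In g) s (In h)"
proof (rule ccontr)
  assume no: "\<not> ?thesis"
  then obtain T u v where T: "line Sec n T" "E u s v" "In g = lift T u" "In h = lift T v"
    using assms unfolding E'_def lift_edge_def by blast
  then have D: "u \<in> D" "v \<in> D" "g = app T u" "h = app T v" using lift_In by metis+
  have ne: "idx u \<noteq> idx v" using idx_neq D T by blast
  have "EQ (\<pi> u) s (\<pi> v)" using proj T by blast
  moreover have "EQ (\<pi> u) (lab (idx u) (idx v)) (\<pi> v)" using f_edge[OF _ _ ne] idxD D by metis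
  ultimately have "s = lab (idx u) (idx v)" using good_label[OF Q(2) assms(2) Q(1)] by blast
  then have "power_edge n (In g) s (In h)"
    unfolding power_edge_def using D fibre_app[OF T(1)] ne app_edge[OF T(1) _ D(1,2) ne T(2)] by blast
  then show False using no by blast
qed

section \<open>Closed walks of the new picture\<close>

fun coord :: "nat \<Rightarrow> vertex \<Rightarrow> vertex" where
  "coord m (In g) = g ! m"
| "coord m (Out T v) = v"
| "coord m v = v"

definition near :: "(nat \<Rightarrow> vertex) option list \<Rightarrow> vertex set" where
  "near T = range In \<union> range (Out T)"

text \<open>A coordinate where \<open>T\<close> moves undoes \<open>lift T\<close>, and an edge of
  the power has its label at every coordinate; so this coordinate maps the power and the copy of
  \<open>T\<close> to the picture.\<close>

lemma coord_edge:
  assumes "E' n x s y" "2 \<le> l" "line Sec n T" "m < n" "T ! m = None" "x \<in> near T" "y \<in> near T"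
  shows "E (coord m x) s (coord m y)"
proof (cases "power_edge n x s y")
  case True
  then obtain g h where "x = In g" "y = In h" unfolding power_edge_def by blast
  then show ?thesis using power_edge_nth[of n g s h m] assms(4) True by simp
next
  case False
  then have no: "\<not> (\<exists>g h. x = In g \<and> y = In h)" using In_edge_power assms by blast
  obtain T' u v where T': "line Sec n T'" "E u s v" "x = lift T' u" "y = lift T' v"
    using assms(1) False unfolding E'_def lift_edge_def by blast
  have "u \<notin> D \<or> v \<notin> D" using no T'(3,4) unfolding lift_def by auto
  then have "T' = T" using T'(3,4) assms(6,7) unfolding lift_def near_def by auto
  moreover have "coord m (lift T w) = w" for w
    using assms(3-5) unfolding lift_def app_def line_def by auto
  ultimately show ?thesis using T' by simp
qed

text \<open>Vertices outside the power with different tags are never adjacent, so the walk must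
  enter the power.\<close>

lemma cross:
  assumes "walk (E' n) p w q" "p \<in> range (Out T)" "q \<notin> near T" "q \<notin> range In"
  obtains w1 w2 g where "w = w1 @ w2" "w1 \<noteq> []" "w2 \<noteq> []" "walk (E' n) p w1 (In g)" "walk (E' n) (In g) w2 q"
  using assms
proof (induction "E' n" p w q arbitrary: thesis rule: walk.induct)
  case (1 u v)
  then show ?case by (auto simp: near_def)
next
  case (2 u s x w v)
  have e: "E' n u s x" and w: "walk (E' n) x w v" using 2(3) by auto
  show ?case
  proof (cases "x \<in> range In")
    case True
    then obtain g where g: "x = In g" by blast
    then have "w \<noteq> []" using w 2 by auto
    then show ?thesis using 2(2)[of "[(s,x)]" w g] e w g by auto
  next
    case False
    have "\<not> power_edge n u s x" using 2(4) unfolding power_edge_def by auto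
    then obtain T' p q where "E p s q" "u = lift T' p" "x = lift T' q"
      using e unfolding E'_def lift_edge_def by blast
    then have "x \<in> range (Out T)" using 2(4) False unfolding lift_def by (auto split: if_splits)
    then obtain w1 w2 g where "w = w1 @ w2" "w2 \<noteq> []" "walk (E' n) x w1 (In g)" "walk (E' n) (In g) w2 v"
      using 2(1)[OF _ w] 2(5,6) by metis
    then show ?thesis using 2(2)[of "(s, x) # w1" w2 g] e by auto
  qed
qed

lemma length_two_good:
  assumes "walk (E' n) x w x" "length w = 2" "0 < n"
  shows "map fst w \<in> G"
proof -
  obtain s y t z where w: "w = [(s, y), (t, z)]" using assms(2) by (cases w; cases "tl w") (auto simp: length_Suc_conv numeral_2_eq_2)
  then have e: "E' n x s y" "E' n y t x" using assms(1) by auto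
  then have "E' n x t y" using graph'[of n] unfolding graph_def by blast
  then have "s = t" using label_unique e assms(3) by blast
  moreover have "s \<in> L" using e graph'[of n] unfolding graph_def by blast
  ultimately show ?thesis using double w by simp
qed

lemma In_proj:
  assumes "In g \<in> V' n" "0 < n"
  obtains i where "i < a" "\<pi>' (In g) = f i"
proof -
  obtain i where "fibre n g i" using assms(1) unfolding V'_def by auto
  then show ?thesis using that fibre_hd[OF assms(2)] by (auto simp: fibre_def)
qed

text \<open>Both cut vertices project into the copy \<open>f\<close>, so their images coincide or
  are joined by a chord. As the other piece has length at least 2, each piece has length at most
  \<open>l - 1\<close>, which leaves room for the chord.\<close>

lemma cut_good:
  assumes w: "walk (E' n) (In g) v (In h)" "walk (E' n) (In h) w (In g)" "2 \<le> length v" "2 \<le> length w" "length v + length w \<le> Suc l" "0 < n"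
    and V': "In g \<in> V' n" "In h \<in> V' n"
  shows "map fst v @ map fst w \<in> G"
proof -
  obtain i where i: "i < a" "\<pi>' (In g) = f i" using In_proj V' assms by metis
  obtain j where j: "j < a" "\<pi>' (In h) = f j" using In_proj V' assms by metis
  let ?p = "map (apsnd \<pi>')"
  have p: "walk EQ (f i) (?p v) (f j)" "walk EQ (f j) (?p w) (f i)"
    using walk_map[OF w(1), of EQ \<pi>'] walk_map[OF w(2), of EQ \<pi>'] proj'(2)[OF w(6)] i j by metis+
  have gd: "map fst x \<in> G" if "walk EQ u x u" "length x \<le> l" for u x
    using Q(2) that unfolding walks_good_def by blast
  show ?thesis
  proof (cases "i = j")
    case True
    have "map fst (?p v) \<in> G" "map fst (?p w) \<in> G" using p True w(3-5) by (intro gd; simp)+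
    then show ?thesis using glue by simp
  next
    case False
    have e: "EQ (f j) (lab i j) (f i)" "EQ (f i) (lab i j) (f j)" using f_edge i j False Q(1) unfolding graph_def by blast+
    have "walk EQ (f i) (?p v @ [(lab i j, f i)]) (f i)" "walk EQ (f j) (?p w @ [(lab i j, f j)]) (f j)"
      using p e by (auto simp: walk_append)
    then have "map fst (?p v @ [(lab i j, f i)]) \<in> G" "map fst (?p w @ [(lab i j, f j)]) \<in> G"
      using w(3-5) by (intro gd; simp)+
    moreover have "lab i j \<in> L" using A i j False unfolding pattern_def by blast
    ultimately show ?thesis using glue_edge[of "lab i j" "map fst v" "map fst w"] by simp
  qed
qed

lemma walk_verts:
  assumes "walk (E' n) u w v" "x \<in> snd ` set w"
  shows "x \<in> V' n"
  using assms graph'[of n] unfolding graph_def by (induction "E' n" u w v rule: walk.induct) auto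

lemma vertex_cases:
  assumes "x \<in> V' n"
  obtains "x \<in> range In" | T where "line Sec n T" "x \<in> range (Out T)"
  using assms unfolding V'_def by blast

text \<open>A closed walk that leaves the fibre power into at most one copy of the picture projects to a moving
  coordinate of the line of this copy.  Any other is cut at two vertices of the fibre power.\<close>

lemma walks_good':
  assumes T0: "line Sec n T0"
  shows "walks_good (Suc l) (E' n)"
  unfolding walks_good_def
proof (intro allI impI)
  fix u w
  assume w: "walk (E' n) u w u" and le: "length w \<le> Suc l"
  have n: "0 < n" using line_pos T0 by blast
  show "map fst w \<in> G"
  proof (cases "length w \<le> l")
    case True
    have "walk EQ (\<pi>' u) (map (apsnd \<pi>') w) (\<pi>' u)" using walk_map[OF w, of EQ \<pi>'] proj'(2)[OF n] by blast
    then have "map fst (map (apsnd \<pi>') w) \<in> G" using Q(2) True unfolding walks_good_def by (metis length_map)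
    then show ?thesis by simp
  next
    case False
    then have len: "length w = Suc l" using le by simp
    \<comment> \<open>For \<open>l = 1\<close> a lifted edge need not be an edge of the power, so
      coordinates do not help; closed walks of length 2 are settled by uniqueness of labels.\<close>
    show ?thesis
    proof (cases "l = 1")
      case True
      then show ?thesis using length_two_good[OF w _ n] len by simp
    next
      case False
      then have l2: "2 \<le> l" using Q(3) by simp
      have u: "u \<in> snd ` set w" using walk_end[OF w] len by (cases w) simp_all
      show ?thesis
      proof (cases "\<exists>T. line Sec n T \<and> snd ` set w \<subseteq> near T")
        case True
        then obtain T where T: "line Sec n T" "snd ` set w \<subseteq> near T" by blast
        obtain m where m: "m < n" "T ! m = None" using T(1) unfolding line_def by (metis in_set_conv_nth)
        have "walk E (coord m u) (map (apsnd (coord m)) w) (coord m u)"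
          using walk_map[OF w, of E "coord m"] coord_edge[OF _ l2 T(1) m] T(2) u by blast
        then have "map fst (map (apsnd (coord m)) w) \<in> G" using P(2) le unfolding walks_good_def by (metis length_map)
        then show ?thesis by simp
      next
        case False
        then obtain p where p: "p \<in> snd ` set w" "p \<notin> near T0" using T0 by blast
        then obtain T where T: "line Sec n T" "p \<in> range (Out T)"
          using vertex_cases walk_verts[OF w p(1)] unfolding near_def by blast
        obtain q where q: "q \<in> snd ` set w" "q \<notin> near T" using False T by blast
        then obtain T' where T': "line Sec n T'" "q \<in> range (Out T')"
          using vertex_cases walk_verts[OF w q(1)] unfolding near_def by blast
        have ne: "q \<notin> range In" "p \<notin> near T'" "p \<notin> range In"
          using q T T' unfolding near_def by auto
        obtain w1 w2 where w12: "w = w1 @ w2" "walk (E' n) u w1 p" "walk (E' n) p w2 u"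
          using walk_split[OF w p(1)] by metis
        have w21: "walk (E' n) p (w2 @ w1) p" using w12 walk_append by metis
        have "q \<in> snd ` set (w2 @ w1)" using q(1) w12(1) by auto
        from walk_split[OF w21 this] obtain w3 w4 where w34: "w2 @ w1 = w3 @ w4" "walk (E' n) p w3 q" "walk (E' n) q w4 p"
          by metis
        obtain a1 a2 g where a: "w3 = a1 @ a2" "a1 \<noteq> []" "a2 \<noteq> []" "walk (E' n) p a1 (In g)" "walk (E' n) (In g) a2 q"
          using cross[OF w34(2) T(2) q(2) ne(1)] by metis
        obtain a3 a4 h where b: "w4 = a3 @ a4" "a3 \<noteq> []" "a4 \<noteq> []" "walk (E' n) q a3 (In h)" "walk (E' n) (In h) a4 p"
          using cross[OF w34(3) T'(2) ne(2,3)] by metis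
        have V': "In h \<in> V' n" "In g \<in> V' n"
          using walk_verts[OF b(4) walk_end[OF b(4,2)]] walk_verts[OF a(4) walk_end[OF a(4,2)]] by blast+
        \<comment> \<open>One piece runs from \<open>In h\<close> through \<open>p\<close> to
          \<open>In g\<close>, the other from there through \<open>q\<close> back. All four parts
          are nonempty, so both pieces have length at least 2.\<close>
        have "map fst (a4 @ a1) @ map fst (a2 @ a3) \<in> G"
        proof (rule cut_good)
          show "walk (E' n) (In h) (a4 @ a1) (In g)" "walk (E' n) (In g) (a2 @ a3) (In h)"
            using a b by (auto simp: walk_append)
          have "length (w2 @ w1) = length (w3 @ w4)" using w34(1) by simp
          then show "length (a4 @ a1) + length (a2 @ a3) \<le> Suc l" using len w12(1) a(1) b(1) by simp
          show "2 \<le> length (a4 @ a1)" "2 \<le> length (a2 @ a3)"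
            using a(2,3) b(2,3) by (cases a1; cases a2; cases a3; cases a4; simp)+
        qed (use V' n in auto)
        then have "(map fst a4) @ (map fst a1 @ map fst a2 @ map fst a3) \<in> G" by simp
        from rotate[OF this] have "map fst (w3 @ w4) \<in> G" using a(1) b(1) by simp
        then have "map fst w2 @ map fst w1 \<in> G" using w34(1) by (metis map_append)
        from rotate[OF this] show ?thesis using w12(1) by simp
      qed
    qed
  qed
qed

lemma sections_Sec: "sections a lab V E \<pi> f = Sec"
proof -
  have "E (\<alpha> j) (lab j i) (\<alpha> i)" if "E (\<alpha> i) (lab i j) (\<alpha> j)" "i < a" "j < a" "i \<noteq> j" for \<alpha> i j
    using that A E_V unfolding pattern_def by metis
  then show ?thesis unfolding sections_def Sec_def by (smt (verit) linorder_neqE_nat mem_Collect_eq Collect_cong less_irrefl)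
qed

text \<open>The letters are sections: a word of \<open>n\<close> sections, read coordinatewise, is a
  section of the power, and the points of the line \<open>T\<close> are the images of the sections
  under \<open>lift T\<close>.\<close>

lemma partite_lemma:
  assumes "1 \<le> k"
  shows "\<exists>n>0. (\<exists>T. line Sec n T) \<and> (\<forall>c :: (nat \<Rightarrow> vertex) \<Rightarrow> nat. (\<forall>x. c x < k) \<longrightarrow> (\<exists>T. line Sec n T \<and>
     (\<forall>\<alpha>\<in>Sec. \<forall>\<beta>\<in>Sec. c (compose {..<a} (lift T) \<alpha>) = c (compose {..<a} (lift T) \<beta>))))"
proof -
  obtain n where n: "\<And>c :: (nat \<Rightarrow> vertex) list \<Rightarrow> nat. (\<forall>w\<in>words Sec n. c w < k) \<Longrightarrow> (\<exists>T. line Sec n T \<and> mono_line c Sec T)"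
    using hales_jewett[OF finite_Sec] by meson
  have ex: "\<exists>T. line Sec n T" using n[of "\<lambda>_. 0"] assms by auto
  have "\<exists>T. line Sec n T \<and> (\<forall>\<alpha>\<in>Sec. \<forall>\<beta>\<in>Sec. c (compose {..<a} (lift T) \<alpha>) = c (compose {..<a} (lift T) \<beta>))"
    if c: "\<forall>x. c x < k" for c :: "(nat \<Rightarrow> vertex) \<Rightarrow> nat"
  proof -
    define col where "col w = c (restrict (\<lambda>i. In (map (\<lambda>\<alpha>. \<alpha> i) w)) {..<a})" for w
    obtain T where T: "line Sec n T" "mono_line col Sec T" using n[of col] c unfolding col_def by blast
    have "compose {..<a} (lift T) \<alpha> = restrict (\<lambda>i. In (map (\<lambda>\<alpha>. \<alpha> i) (inst T \<alpha>))) {..<a}" if \<alpha>: "\<alpha> \<in> Sec" for \<alpha>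
    proof
      fix i
      have "lift T (\<alpha> i) = In (map (\<lambda>\<alpha>. \<alpha> i) (inst T \<alpha>))" if "i < a"
      proof -
        have "\<alpha> i \<in> D" "idx (\<alpha> i) = i" using \<alpha> that idx unfolding Sec_def D_def by auto
        then show ?thesis unfolding lift_def app_def inst_def by (auto split: option.splits)
      qed
      then show "compose {..<a} (lift T) \<alpha> i = restrict (\<lambda>i. In (map (\<lambda>\<alpha>. \<alpha> i) (inst T \<alpha>))) {..<a} i"
        by (simp add: compose_def)
    qed
    then have "c (compose {..<a} (lift T) \<alpha>) = col (inst T \<alpha>)" if "\<alpha> \<in> Sec" for \<alpha>
      using that unfolding col_def by simp
    then show ?thesis using T unfolding mono_line_def by metis
  qed
  then show ?thesis using ex line_pos by blast
qed

end

section \<open>The Ramsey property\<close>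

definition over :: "'v set \<Rightarrow> ('v \<Rightarrow> nat \<Rightarrow> 'v \<Rightarrow> bool) \<Rightarrow> ('v \<Rightarrow> 'q) \<Rightarrow> 'w set \<Rightarrow> ('w \<Rightarrow> nat \<Rightarrow> 'w \<Rightarrow> bool) \<Rightarrow> ('w \<Rightarrow> 'q) \<Rightarrow> ('v \<Rightarrow> 'w) \<Rightarrow> bool" where
  "over V E \<pi> V' E' \<pi>' \<iota> \<longleftrightarrow> (\<forall>v\<in>V. \<iota> v \<in> V' \<and> \<pi>' (\<iota> v) = \<pi> v) \<and> (\<forall>u s v. E u s v \<longrightarrow> E' (\<iota> u) s (\<iota> v))"

definition arrows :: "nat \<Rightarrow> nat \<Rightarrow> (nat \<Rightarrow> nat \<Rightarrow> nat) \<Rightarrow> nat \<Rightarrow> (nat \<Rightarrow> nat \<Rightarrow> nat) \<Rightarrow> 'v set \<Rightarrow> ('v \<Rightarrow> nat \<Rightarrow> 'v \<Rightarrow> bool) \<Rightarrow> ('v \<Rightarrow> nat) \<Rightarrow> bool" where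
  "arrows k a labA b labB V E r \<longleftrightarrow> (\<forall>c :: (nat \<Rightarrow> 'v) \<Rightarrow> nat. (\<forall>x. c x < k) \<longrightarrow>
     (\<exists>\<beta>\<in>copies b labB V E r. \<forall>e\<in>maps a labA b labB. \<forall>e'\<in>maps a labA b labB.
        c (compose {..<a} \<beta> e) = c (compose {..<a} \<beta> e')))"

lemma compose_compose: "compose A \<iota> (compose A \<kappa> \<alpha>) = compose A (\<iota> \<circ> \<kappa>) \<alpha>"
  by (auto simp: compose_def fun_eq_iff)

lemma over_sections: "over V E \<pi> V' E' \<pi>' \<iota> \<Longrightarrow> \<alpha> \<in> sections a lab V E \<pi> f \<Longrightarrow> compose {..<a} \<iota> \<alpha> \<in> sections a lab V' E' \<pi>' f"
  unfolding over_def sections_def by (auto simp: compose_def Pi_iff PiE_iff extensional_def)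

lemma over_comp: "over V E \<pi> V' E' \<pi>' \<iota> \<Longrightarrow> over V' E' \<pi>' V'' E'' \<pi>'' \<kappa> \<Longrightarrow> over V E \<pi> V'' E'' \<pi>'' (\<kappa> \<circ> \<iota>)"
  unfolding over_def by auto

context gluing begin

definition system :: "nat \<Rightarrow> vertex set \<Rightarrow> (vertex \<Rightarrow> nat \<Rightarrow> vertex \<Rightarrow> bool) \<Rightarrow> vertex set \<Rightarrow> (vertex \<Rightarrow> nat \<Rightarrow> vertex \<Rightarrow> bool) \<Rightarrow> (vertex \<Rightarrow> vertex) \<Rightarrow> bool" where
  "system l VQ EQ V E \<pi> \<longleftrightarrow> graph L V E \<and> walks_good (Suc l) E \<and> (\<forall>v\<in>V. \<pi> v \<in> VQ) \<and> (\<forall>u s v. E u s v \<longrightarrow> EQ (\<pi> u) s (\<pi> v))"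

lemma partite_step:
  assumes A: "pattern L a lab" and Q: "graph L VQ EQ" "walks_good l EQ" "1 \<le> l"
    and P: "system l VQ EQ V E \<pi>" and f: "f \<in> copies a lab VQ EQ rQ" and k: "1 \<le> k"
  shows "\<exists>V' E' \<pi>'. system l VQ EQ V' E' \<pi>' \<and> (\<forall>c :: (nat \<Rightarrow> vertex) \<Rightarrow> nat. (\<forall>x. c x < k) \<longrightarrow> (\<exists>\<iota>. over V E \<pi> V' E' \<pi>' \<iota> \<and>
     (\<forall>\<alpha>\<in>sections a lab V E \<pi> f. \<forall>\<beta>\<in>sections a lab V E \<pi> f. c (compose {..<a} \<iota> \<alpha>) = c (compose {..<a} \<iota> \<beta>))))"
proof -
  interpret partite L G a lab VQ EQ rQ V E \<pi> l f
    using assms unfolding system_def by unfold_locales auto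
  obtain n where n: "n > 0" "\<exists>T. line Sec n T" "\<And>c :: (nat \<Rightarrow> vertex) \<Rightarrow> nat. (\<forall>x. c x < k) \<Longrightarrow> (\<exists>T. line Sec n T \<and>
     (\<forall>\<alpha>\<in>Sec. \<forall>\<beta>\<in>Sec. c (compose {..<a} (lift T) \<alpha>) = c (compose {..<a} (lift T) \<beta>)))"
    using partite_lemma[OF k] by blast
  have "system l VQ EQ (V' n) (E' n) \<pi>'"
    unfolding system_def using graph' walks_good' proj'[OF n(1)] n(2) by blast
  moreover have "over V E \<pi> (V' n) (E' n) \<pi>' (lift T)" if "line Sec n T" for T
    unfolding over_def using lift_V'[OF that] \<pi>'_lift[OF that] that unfolding E'_def lift_edge_def by blast
  ultimately show ?thesis unfolding sections_Sec using n(3) by meson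
qed

text \<open>The copies in \<open>F\<close> are treated in succession. Given a colouring, the
  embedding into the last picture is chosen first, and the colouring pulled back along it is handed
  to the earlier picture.\<close>

lemma partite_iterate:
  assumes A: "pattern L a lab" and Q: "graph L VQ EQ" "walks_good l EQ" "1 \<le> l"
    and P: "system l VQ EQ V E \<pi>" and k: "1 \<le> k"
    and F: "finite F" "F \<subseteq> copies a lab VQ EQ rQ"
  shows "\<exists>V' E' \<pi>'. system l VQ EQ V' E' \<pi>' \<and> (\<forall>c :: (nat \<Rightarrow> vertex) \<Rightarrow> nat. (\<forall>x. c x < k) \<longrightarrow> (\<exists>\<iota>. over V E \<pi> V' E' \<pi>' \<iota> \<and>
     (\<forall>f\<in>F. \<forall>\<alpha>\<in>sections a lab V E \<pi> f. \<forall>\<beta>\<in>sections a lab V E \<pi> f. c (compose {..<a} \<iota> \<alpha>) = c (compose {..<a} \<iota> \<beta>))))"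
  using F
proof (induction F rule: finite_induct)
  case empty
  have "over V E \<pi> V E \<pi> id" unfolding over_def by simp
  then show ?case using P by blast
next
  case (insert f F)
  then obtain V1 E1 \<pi>1 where 1: "system l VQ EQ V1 E1 \<pi>1" "\<And>c :: (nat \<Rightarrow> vertex) \<Rightarrow> nat. (\<forall>x. c x < k) \<Longrightarrow> (\<exists>\<iota>. over V E \<pi> V1 E1 \<pi>1 \<iota> \<and>
     (\<forall>f\<in>F. \<forall>\<alpha>\<in>sections a lab V E \<pi> f. \<forall>\<beta>\<in>sections a lab V E \<pi> f. c (compose {..<a} \<iota> \<alpha>) = c (compose {..<a} \<iota> \<beta>)))"
    by blast
  obtain V2 E2 \<pi>2 where 2: "system l VQ EQ V2 E2 \<pi>2" "\<And>c :: (nat \<Rightarrow> vertex) \<Rightarrow> nat. (\<forall>x. c x < k) \<Longrightarrow> (\<exists>\<iota>. over V1 E1 \<pi>1 V2 E2 \<pi>2 \<iota> \<and>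
     (\<forall>\<alpha>\<in>sections a lab V1 E1 \<pi>1 f. \<forall>\<beta>\<in>sections a lab V1 E1 \<pi>1 f. c (compose {..<a} \<iota> \<alpha>) = c (compose {..<a} \<iota> \<beta>)))"
    using partite_step[OF A Q 1(1) _ k, of f rQ] insert(4) by blast
  have "\<exists>\<iota>. over V E \<pi> V2 E2 \<pi>2 \<iota> \<and> (\<forall>f\<in>insert f F. \<forall>\<alpha>\<in>sections a lab V E \<pi> f. \<forall>\<beta>\<in>sections a lab V E \<pi> f.
       c (compose {..<a} \<iota> \<alpha>) = c (compose {..<a} \<iota> \<beta>))" if c: "\<forall>x. c x < k" for c :: "(nat \<Rightarrow> vertex) \<Rightarrow> nat"
  proof -
    obtain \<kappa> where \<kappa>: "over V1 E1 \<pi>1 V2 E2 \<pi>2 \<kappa>"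
     "\<And>\<alpha> \<beta>. \<alpha>\<in>sections a lab V1 E1 \<pi>1 f \<Longrightarrow> \<beta>\<in>sections a lab V1 E1 \<pi>1 f \<Longrightarrow> c (compose {..<a} \<kappa> \<alpha>) = c (compose {..<a} \<kappa> \<beta>)"
      using 2(2)[OF c] by blast
    obtain \<iota> where \<iota>: "over V E \<pi> V1 E1 \<pi>1 \<iota>"
     "\<And>f \<alpha> \<beta>. f \<in> F \<Longrightarrow> \<alpha>\<in>sections a lab V E \<pi> f \<Longrightarrow> \<beta>\<in>sections a lab V E \<pi> f \<Longrightarrow>
        c (compose {..<a} \<kappa> (compose {..<a} \<iota> \<alpha>)) = c (compose {..<a} \<kappa> (compose {..<a} \<iota> \<beta>))"
      using 1(2)[of "\<lambda>\<alpha>. c (compose {..<a} \<kappa> \<alpha>)"] c by blast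
    have "over V E \<pi> V2 E2 \<pi>2 (\<kappa> \<circ> \<iota>)" using over_comp \<iota>(1) \<kappa>(1) by blast
    moreover have "\<forall>f\<in>insert f F. \<forall>\<alpha>\<in>sections a lab V E \<pi> f. \<forall>\<beta>\<in>sections a lab V E \<pi> f.
       c (compose {..<a} (\<kappa> \<circ> \<iota>) \<alpha>) = c (compose {..<a} (\<kappa> \<circ> \<iota>) \<beta>)"
      using \<iota>(2) \<kappa>(2)[OF over_sections[OF \<iota>(1)] over_sections[OF \<iota>(1)]]
      unfolding compose_compose[symmetric] by blast
    ultimately show ?thesis by blast
  qed
  then show ?case using 2(1) by blast
qed

lemma finite_copies: "finite V \<Longrightarrow> finite (copies a lab V E r)"
  unfolding copies_def by (rule finite_subset[of _ "{..<a} \<rightarrow>\<^sub>E V"]) (auto intro: finite_PiE)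

section \<open>Induction on the length of good walks\<close>

fun under :: "vertex \<Rightarrow> vertex" where
  "under (Copy \<beta> i) = \<beta> i"
| "under v = v"

fun copy_index :: "vertex \<Rightarrow> nat" where
  "copy_index (Copy \<beta> i) = i"
| "copy_index v = 0"

text \<open>The initial picture has a separate copy of the larger pattern over each of its copies in
  the target. Forgetting which copy it is sends closed walks to closed walks of the pattern
  itself.\<close>

lemma disjoint_copies:
  fixes rQ :: "vertex \<Rightarrow> nat"
  assumes B: "pattern L b labB" "walks_good (Suc l) (pattern_edge b labB)" and Q: "graph L VQ EQ"
  defines "X \<equiv> copies b labB VQ EQ rQ"
  defines "V \<equiv> (\<lambda>(\<beta>, i). Copy \<beta> i) ` (X \<times> {..<b})"
  defines "E \<equiv> (\<lambda>u s v. \<exists>\<beta>\<in>X. \<exists>i j. u = Copy \<beta> i \<and> v = Copy \<beta> j \<and> pattern_edge b labB i s j)"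
  shows "system l VQ EQ V E under"
  unfolding system_def
proof (intro conjI ballI allI impI)
  have "finite X" unfolding X_def using Q finite_copies unfolding graph_def by blast
  then show "graph L V E"
    using B(1) unfolding graph_def V_def E_def pattern_edge_def pattern_def by auto
  show "walks_good (Suc l) E"
    unfolding walks_good_def
  proof (intro allI impI)
    fix u w assume "walk E u w u" "length w \<le> Suc l"
    moreover have "walk (pattern_edge b labB) (copy_index u) (map (apsnd copy_index) w) (copy_index u)"
      by (rule walk_map[OF \<open>walk E u w u\<close>]) (auto simp: E_def)
    ultimately have "map fst (map (apsnd copy_index) w) \<in> G" using B(2) unfolding walks_good_def by (metis length_map)
    then show "map fst w \<in> G" by simp
  qed
  show "under v \<in> VQ" if "v \<in> V" for v
    using that unfolding V_def X_def copies_def by auto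
  show "EQ (under u) s (under v)" if e: "E u s v" for u s v
  proof -
    obtain \<beta> i j where *: "\<beta> \<in> X" "u = Copy \<beta> i" "v = Copy \<beta> j" "i < b" "j < b" "i \<noteq> j" "s = labB i j"
      using e unfolding E_def pattern_edge_def by blast
    have "EQ (\<beta> i) (labB i j) (\<beta> j)"
      using * B(1) Q unfolding X_def copies_def pattern_def graph_def
      by (cases i j rule: linorder_cases) auto
    then show ?thesis using * by simp
  qed
qed

text \<open>Once all copies in the target are treated, the colour of a section depends only on its
  projection and so induces a colouring of the target. A copy that is monochromatic for it has its
  own disjoint copy in the initial picture, whose image is the desired one.\<close>

lemma arrows_Suc:
  fixes VQ :: "vertex set"
  assumes A: "pattern L a labA" and B: "pattern L b labB" "walks_good (Suc l) (pattern_edge b labB)"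
    and Q: "graph L VQ EQ" "walks_good l EQ" "1 \<le> l" "arrows k a labA b labB VQ EQ rQ" and k: "1 \<le> k"
  shows "\<exists>(V :: vertex set) E r. graph L V E \<and> walks_good (Suc l) E \<and> arrows k a labA b labB V E r"
proof -
  define X where "X = copies b labB VQ EQ rQ"
  define V where "V = (\<lambda>(\<beta>, i). Copy \<beta> i) ` (X \<times> {..<b})"
  define E where "E = (\<lambda>u s v. \<exists>\<beta>\<in>X. \<exists>i j. u = Copy \<beta> i \<and> v = Copy \<beta> j \<and> pattern_edge b labB i s j)"
  have P: "system l VQ EQ V E under"
    unfolding V_def E_def X_def by (rule disjoint_copies[OF B Q(1)])
  have "finite (copies a labA VQ EQ rQ)" using Q finite_copies unfolding graph_def by blast
  from partite_iterate[OF A Q(1-3) P k this order_refl] obtain V' E' \<pi>' where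
    1: "system l VQ EQ V' E' \<pi>'" and 2: "\<And>c :: (nat \<Rightarrow> vertex) \<Rightarrow> nat. (\<forall>x. c x < k) \<Longrightarrow> (\<exists>\<iota>. over V E under V' E' \<pi>' \<iota> \<and>
     (\<forall>f\<in>copies a labA VQ EQ rQ. \<forall>\<alpha>\<in>sections a labA V E under f. \<forall>\<beta>\<in>sections a labA V E under f.
       c (compose {..<a} \<iota> \<alpha>) = c (compose {..<a} \<iota> \<beta>)))"
    by blast
  let ?e = "maps a labA b labB"
  have "\<exists>\<beta>\<in>copies b labB V' E' (rQ \<circ> \<pi>'). \<forall>e\<in>?e. \<forall>e'\<in>?e. c (compose {..<a} \<beta> e) = c (compose {..<a} \<beta> e')"
    if c: "\<forall>x. c x < k" for c :: "(nat \<Rightarrow> vertex) \<Rightarrow> nat"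
  proof -
    obtain \<iota> where \<iota>: "over V E under V' E' \<pi>' \<iota>" and mono:
     "\<And>f \<alpha> \<beta>. f\<in>copies a labA VQ EQ rQ \<Longrightarrow> \<alpha>\<in>sections a labA V E under f \<Longrightarrow> \<beta>\<in>sections a labA V E under f \<Longrightarrow>
       c (compose {..<a} \<iota> \<alpha>) = c (compose {..<a} \<iota> \<beta>)"
      using 2[OF c] by blast
    \<comment> \<open>Copies without sections get an arbitrary colour; those inside \<beta> have the
      section \<alpha> given below.\<close>
    define c' where "c' f = c (compose {..<a} \<iota> (SOME \<alpha>. \<alpha> \<in> sections a labA V E under f))" for f
    obtain \<beta> where \<beta>: "\<beta> \<in> X" "\<And>e e'. e \<in> ?e \<Longrightarrow> e' \<in> ?e \<Longrightarrow> c' (compose {..<a} \<beta> e) = c' (compose {..<a} \<beta> e')"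
      using Q(4) c unfolding arrows_def c'_def X_def by meson
    define \<gamma> where "\<gamma> = restrict (\<lambda>i. \<iota> (Copy \<beta> i)) {..<b}"
    have V: "Copy \<beta> i \<in> V" if "i < b" for i using that \<beta>(1) unfolding V_def by auto
    have "\<gamma> \<in> copies b labB V' E' (rQ \<circ> \<pi>')"
      unfolding copies_def
    proof (intro CollectI conjI allI impI)
      show "\<gamma> \<in> {..<b} \<rightarrow>\<^sub>E V'" using \<iota> V unfolding \<gamma>_def over_def by auto
      fix i j assume ij: "i < b" "j < b" "i < j"
      have "rQ (\<beta> i) < rQ (\<beta> j)" using \<beta>(1) ij unfolding X_def copies_def by blast
      then show "(rQ \<circ> \<pi>') (\<gamma> i) < (rQ \<circ> \<pi>') (\<gamma> j)"
        using \<iota> V ij unfolding \<gamma>_def over_def by simp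
      have "E (Copy \<beta> i) (labB i j) (Copy \<beta> j)" using \<beta>(1) ij unfolding E_def pattern_edge_def by auto
      then show "E' (\<gamma> i) (labB i j) (\<gamma> j)" using \<iota> ij unfolding \<gamma>_def over_def by simp
    qed
    moreover have "c (compose {..<a} \<gamma> e) = c' (compose {..<a} \<beta> e)" if e: "e \<in> ?e" for e
    proof -
      have eb: "e i < b" if "i < a" for i using e that unfolding copies_def by auto
      define \<alpha> where "\<alpha> = restrict (\<lambda>i. Copy \<beta> (e i)) {..<a}"
      have f: "compose {..<a} \<beta> e \<in> copies a labA VQ EQ rQ"
        unfolding copies_def
      proof (intro CollectI conjI allI impI)
        show "compose {..<a} \<beta> e \<in> {..<a} \<rightarrow>\<^sub>E VQ" using eb \<beta>(1) unfolding X_def copies_def by (auto simp: compose_def)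
        fix i j assume ij: "i < a" "j < a" "i < j"
        then have "e i < e j" "labA i j = labB (e i) (e j)" using e unfolding copies_def pattern_edge_def by auto
        then show "rQ (compose {..<a} \<beta> e i) < rQ (compose {..<a} \<beta> e j)"
          "EQ (compose {..<a} \<beta> e i) (labA i j) (compose {..<a} \<beta> e j)"
          using \<beta>(1) eb ij unfolding X_def copies_def by (auto simp: compose_def)
      qed
      have s: "\<alpha> \<in> sections a labA V E under (compose {..<a} \<beta> e)"
        unfolding sections_def
      proof (intro CollectI conjI allI impI)
        show "\<alpha> \<in> {..<a} \<rightarrow>\<^sub>E V" using eb V unfolding \<alpha>_def by auto
        show "under (\<alpha> i) = compose {..<a} \<beta> e i" if "i < a" for i using that unfolding \<alpha>_def by (simp add: compose_def)
        show "E (\<alpha> i) (labA i j) (\<alpha> j)" if "i < a" "j < a" "i < j" for i j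
        proof -
          have "pattern_edge b labB (e i) (labA i j) (e j)" using e that unfolding copies_def by auto
          then show ?thesis using that \<beta>(1) unfolding E_def \<alpha>_def by auto
        qed
      qed
      have "compose {..<a} \<gamma> e = compose {..<a} \<iota> \<alpha>"
        using eb by (auto simp: compose_def \<gamma>_def \<alpha>_def fun_eq_iff)
      then show ?thesis unfolding c'_def using mono[OF f s someI[of "\<lambda>\<alpha>. \<alpha> \<in> _", OF s]] by simp
    qed
    ultimately show ?thesis using \<beta>(2) by metis
  qed
  then have "arrows k a labA b labB V' E' (rQ \<circ> \<pi>')" unfolding arrows_def by blast
  then show ?thesis using 1 unfolding system_def by blast
qed

text \<open>Each pair of distinct points carries all labels, so every increasing tuple is a copy of
  the pattern, and Ramsey's theorem for \<open>a\<close>-element sets applies. Goodness up to length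
  1 amounts to having no loops.\<close>

lemma arrows_base:
  assumes a: "pattern L a labA" and B: "pattern L b labB" and L: "0 \<notin> L"
  shows "\<exists>(V :: vertex set) E r. graph L V E \<and> walks_good 1 E \<and> arrows k a labA b labB V E r"
proof -
  obtain n :: nat where n: "partn_lst {..<n} (replicate k b) a" using ramsey_full by blast
  define V where "V = Base ` {..<n}"
  define E where "E = (\<lambda>u s v. s \<in> L \<and> (\<exists>i<n. \<exists>j<n. i \<noteq> j \<and> u = Base i \<and> v = Base j))"
  define r where "r v = (case v of Base i \<Rightarrow> i | _ \<Rightarrow> 0)" for v
  have g: "graph L V E" unfolding graph_def V_def E_def by auto
  have w: "walks_good 1 E"
    unfolding walks_good_def
  proof (intro allI impI)
    fix u w assume w: "walk E u w u" "length w \<le> 1"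
    have "w = []"
    proof (rule ccontr)
      assume "w \<noteq> []"
      then obtain s x where "w = [(s, x)]" using w(2) by (cases w) auto
      then have "E u s u" using w(1) by auto
      then show False unfolding E_def by auto
    qed
    then show "map fst w \<in> G" using nil by simp
  qed
  let ?e = "maps a labA b labB"
  have "\<exists>\<beta>\<in>copies b labB V E r. \<forall>e\<in>?e. \<forall>e'\<in>?e. c (compose {..<a} \<beta> e) = c (compose {..<a} \<beta> e')"
    if c: "\<forall>x. c x < k" for c :: "(nat \<Rightarrow> vertex) \<Rightarrow> nat"
  proof -
    define en where "en S = restrict (\<lambda>i. Base (sorted_list_of_set S ! i)) {..<a}" for S :: "nat set"
    have "(\<lambda>S. c (en S)) \<in> nsets {..<n} a \<rightarrow> {..<length (replicate k b)}" using c by auto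
    with n obtain i H where H: "i < k" "H \<in> nsets {..<n} b" "(\<lambda>S. c (en S)) ` nsets H a \<subseteq> {i}"
      unfolding partn_lst_def monochromatic_def by fastforce
    define h where "h i = sorted_list_of_set H ! i" for i
    have Hf: "finite H" "card H = b" "H \<subseteq> {..<n}" using H(2) unfolding nsets_def by auto
    have hH: "h i \<in> H" if "i < b" for i
      using that Hf unfolding h_def by (metis nth_mem set_sorted_list_of_set sorted_list_of_set.length_sorted_key_list_of_set)
    have hm: "h i < h j" if "i < j" "j < b" for i j
      using that Hf unfolding h_def
      by (metis sorted_wrt_nth_less strict_sorted_list_of_set sorted_list_of_set.length_sorted_key_list_of_set)
    define \<beta> where "\<beta> = restrict (\<lambda>i. Base (h i)) {..<b}"
    have "\<beta> \<in> copies b labB V E r"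
      unfolding copies_def
    proof (intro CollectI conjI allI impI)
      show "\<beta> \<in> {..<b} \<rightarrow>\<^sub>E V" using hH Hf unfolding \<beta>_def V_def by auto
      fix i j assume ij: "i < b" "j < b" "i < j"
      then show "r (\<beta> i) < r (\<beta> j)" using hm unfolding \<beta>_def r_def by simp
      have "labB i j \<in> L" using B ij unfolding pattern_def by auto
      moreover have "h i < n" "h j < n" using hH[OF ij(1)] hH[OF ij(2)] Hf(3) by auto
      ultimately show "E (\<beta> i) (labB i j) (\<beta> j)" using ij hm[of i j] unfolding \<beta>_def E_def by auto
    qed
    moreover have "c (compose {..<a} \<beta> e) = i" if e: "e \<in> ?e" for e
    proof -
      have eb: "e i < b" if "i < a" for i using e that unfolding copies_def by auto
      have em: "e i < e j" if "i < j" "j < a" for i j using e that unfolding copies_def by auto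
      define S where "S = (\<lambda>i. h (e i)) ` {..<a}"
      define xs where "xs = map (\<lambda>i. h (e i)) [0..<a]"
      have "sorted_wrt (<) xs" unfolding xs_def using hm em eb by (auto simp: sorted_wrt_iff_nth_less)
      moreover have "set xs = S" unfolding xs_def S_def by (auto simp: atLeast0LessThan)
      ultimately have xs: "sorted_list_of_set S = xs" "distinct xs"
        using sorted_list_of_set.idem_if_sorted_distinct strict_sorted_iff by (metis, metis)
      have "card S = a" using \<open>set xs = S\<close> xs(2) distinct_card[of xs] unfolding xs_def by simp
      then have "S \<in> nsets H a" unfolding nsets_def S_def using hH eb by auto
      moreover have "compose {..<a} \<beta> e = en S"
        using eb unfolding en_def xs(1) by (auto simp: compose_def \<beta>_def xs_def fun_eq_iff)
      ultimately show ?thesis using H(3) by auto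
    qed
    ultimately show ?thesis by metis
  qed
  then have "arrows k a labA b labB V E r" unfolding arrows_def by blast
  then show ?thesis using g w by blast
qed

theorem good_arrows:
  assumes "pattern L a labA" "pattern L b labB" "0 \<notin> L" "1 \<le> k"
    and B: "\<And>l. walks_good l (pattern_edge b labB)"
  shows "\<exists>(V :: vertex set) E r. graph L V E \<and> walks_good (Suc l) E \<and> arrows k a labA b labB V E r"
proof (induction l)
  case 0
  then show ?case using arrows_base assms by simp
next
  case (Suc l)
  then show ?case using arrows_Suc[OF assms(1,2) B _ _ _ _ assms(4)] by (metis le_add1 plus_1_eq_Suc)
qed

end

lemma finite_linear_order_enum:
  assumes "finite V" "linear_order_on V r"
  obtains e where "bij_betw e {..<card V} V" "\<And>i j. i < card V \<Longrightarrow> j < card V \<Longrightarrow> (e i, e j) \<in> r \<longleftrightarrow> i \<le> j"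
proof -
  define pos where "pos x = card {y \<in> V. (y, x) \<in> r \<and> y \<noteq> x}" for x
  have r: "refl_on V r" "trans r" "antisym r" "total_on V r"
    using assms(2) unfolding linear_order_on_def partial_order_on_def preorder_on_def by auto
  have less: "pos x < pos y" if "x \<in> V" "y \<in> V" "(x, y) \<in> r" "x \<noteq> y" for x y
  proof -
    have "{z \<in> V. (z, x) \<in> r \<and> z \<noteq> x} \<subseteq> {z \<in> V. (z, y) \<in> r \<and> z \<noteq> y}"
      using r that by (auto dest: transD antisymD)
    moreover have "x \<in> {z \<in> V. (z, y) \<in> r \<and> z \<noteq> y}" "x \<notin> {z \<in> V. (z, x) \<in> r \<and> z \<noteq> x}" using that by auto
    ultimately show ?thesis unfolding pos_def using assms(1) by (intro psubset_card_mono) auto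
  qed
  have iff: "(x, y) \<in> r \<longleftrightarrow> pos x \<le> pos y" if "x \<in> V" "y \<in> V" for x y
  proof (cases "x = y")
    case True
    then show ?thesis using r(1) that by (auto simp: refl_on_def)
  next
    case False
    then show ?thesis using less[OF that] less[OF that(2,1)] r(4) that unfolding total_on_def
      by (metis less_imp_le_nat not_le)
  qed
  have inj: "inj_on pos V"
    using iff r(3) by (intro inj_onI antisymD[OF r(3)]) auto
  have "pos ` V \<subseteq> {..<card V}"
  proof
    fix i assume "i \<in> pos ` V"
    then obtain x where x: "x \<in> V" "i = pos x" by blast
    then have "{y \<in> V. (y, x) \<in> r \<and> y \<noteq> x} \<subset> V" by auto
    then show "i \<in> {..<card V}" using x assms(1) unfolding pos_def by (auto intro: psubset_card_mono)
  qed
  then have "bij_betw pos V {..<card V}"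
    using inj by (metis bij_betw_def card_image card_lessThan card_subset_eq finite_lessThan)
  then have b: "bij_betw (inv_into V pos) {..<card V} V" and p: "\<And>i. i < card V \<Longrightarrow> pos (inv_into V pos i) = i"
    by (auto intro: bij_betw_inv_into simp: bij_betw_inv_into_right)
  show ?thesis
    using that[OF b] iff p bij_betwE[OF b] by auto
qed

section \<open>Enumerated spaces and their good walks\<close>

context magic begin

abbreviation "words_ok \<equiv> {w. 0 \<in> span w}"

text \<open>By \<open>span_append_0\<close> words close up exactly when their spans meet, and the
  span of one letter is that letter.\<close>

sublocale gluing "{1..\<delta>}" words_ok
proof
  show "[] \<in> words_ok" by simp
  show "w @ v \<in> words_ok" if "v @ w \<in> words_ok" for v w
    using that by (auto simp: span_append_0)
  show "v @ w \<in> words_ok" if "v \<in> words_ok" "w \<in> words_ok" for v w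
    using that unfolding mem_Collect_eq span_append_0 by blast
  have single: "x = t" if "x \<in> span [t]" for x t using span_single_D[OF that] by simp
  show "v @ w \<in> words_ok" if "v @ [t] \<in> words_ok" "w @ [t] \<in> words_ok" for t v w
    using that single unfolding mem_Collect_eq span_append_0 by blast
  show "[s] \<notin> words_ok" if "s \<in> {1..\<delta>}" for s
    using single[of 0 s] that by auto
  show "[s, t] \<in> words_ok \<longleftrightarrow> s = t" if "s \<in> {1..\<delta>}" "t \<in> {1..\<delta>}" for s t
  proof -
    have "span [s] = {s}" "span [t] = {t}" using span_single that by auto
    then have "0 \<in> span ([s] @ [t]) \<longleftrightarrow> s = t" unfolding span_append_0 by auto
    then show ?thesis by (simp del: span.simps)
  qed
qed

text \<open>An ordered space given by its distance matrix along the increasing enumeration.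
  Degenerate triangles are included, since walks may revisit vertices.\<close>

definition space :: "nat \<Rightarrow> (nat \<Rightarrow> nat \<Rightarrow> nat) \<Rightarrow> bool" where
  "space n D \<longleftrightarrow> (\<forall>i<n. D i i = 0) \<and> (\<forall>i<n. \<forall>j<n. D i j = D j i \<and> D i j \<le> \<delta> \<and> (i \<noteq> j \<longrightarrow> 1 \<le> D i j)) \<and>
    (\<forall>i<n. \<forall>j<n. \<forall>k<n. tri (D i j) (D j k) (D i k))"

lemma spaceI:
  assumes "\<And>i. i < n \<Longrightarrow> D i i = 0" "\<And>i j. i < n \<Longrightarrow> j < n \<Longrightarrow> D i j = D j i" "\<And>i j. i < n \<Longrightarrow> j < n \<Longrightarrow> i \<noteq> j \<Longrightarrow> 1 \<le> D i j \<and> D i j \<le> \<delta>"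
    "\<And>i j k. i < n \<Longrightarrow> j < n \<Longrightarrow> k < n \<Longrightarrow> i \<noteq> j \<Longrightarrow> j \<noteq> k \<Longrightarrow> i \<noteq> k \<Longrightarrow> tri (D i j) (D j k) (D i k)"
  shows "space n D"
proof -
  have le: "D i j \<le> \<delta>" if "i < n" "j < n" for i j using assms(1,3) that by (cases "i = j") auto
  have "tri (D i j) (D j k) (D i k)" if "i < n" "j < n" "k < n" for i j k
  proof -
    consider "i = j" | "j = k" | "i = k" | "i \<noteq> j" "j \<noteq> k" "i \<noteq> k" by blast
    then show ?thesis
      using assms(1,2,4) that le[OF that(1,2)] le[OF that(2,3)] allowed_zero allowed_0_0 by cases auto
  qed
  then show ?thesis unfolding space_def using assms(1-3) le by (intro conjI allI impI) auto
qed

lemma space_pattern: "space n D \<Longrightarrow> pattern {1..\<delta>} n D"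
  unfolding space_def pattern_def by auto

lemma space_walk:
  assumes "space n D" "walk (pattern_edge n D) i w j" "i < n" "j < n"
  shows "D i j \<in> span (map fst w)"
  using assms(2-)
proof (induction w arbitrary: i)
  case Nil
  then show ?case using assms(1) unfolding space_def by simp
next
  case (Cons p w)
  obtain s x where p: "p = (s, x)" by (cases p)
  then have "pattern_edge n D i s x" "walk (pattern_edge n D) x w j" using Cons(2) by simp_all
  then have x: "x < n" "s = D i x" "walk (pattern_edge n D) x w j" unfolding pattern_edge_def by auto
  then have "D x j \<in> span (map fst w)" using Cons by blast
  moreover have "tri (D i x) (D x j) (D i j)" "D i j \<le> \<delta>" "D i x \<le> \<delta>"
    using assms(1) x(1) Cons(3,4) unfolding space_def by blast+
  ultimately show ?case using p x by auto
qed

lemma space_good: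
  assumes "space n D"
  shows "walks_good l (pattern_edge n D)"
  unfolding walks_good_def
proof (intro allI impI)
  fix i w assume w: "walk (pattern_edge n D) i w i"
  show "map fst w \<in> words_ok"
  proof (cases "w = []")
    case False
    then have "i < n" using w by (cases w) (auto simp: pattern_edge_def)
    then show ?thesis using space_walk[OF assms w] assms unfolding space_def by simp
  qed simp
qed

text \<open>Completion keeps the labels of edges, so copies in the graph remain copies in the space.
  Sorting breaks ties of rank arbitrarily, which is harmless as copies increase strictly in
  rank.\<close>

theorem space_arrows:
  assumes A: "space a DA" and B: "space b DB" and k: "1 \<le> k"
  shows "\<exists>m D. space m D \<and> arrows k a DA b DB {..<m} (pattern_edge m D) id"
proof -
  have zero: "0 \<notin> {1..\<delta>}" by simp
  obtain V :: "vertex set" and E r where g: "graph {1..\<delta>} V E" "walks_good (Suc (3 * 2 ^ (2 * \<delta>))) E" "arrows k a DA b DB V E r"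
    using good_arrows[OF space_pattern[OF A] space_pattern[OF B] zero k space_good[OF B]] by blast
  interpret good_graph \<delta> K1 K2 C0 C1 M C IIB E
  proof unfold_locales
    show "E v s u" if "E u s v" for u s v using g(1) that unfolding graph_def by blast
    show "1 \<le> s \<and> s \<le> \<delta>" if "E u s v" for u s v using g(1) that unfolding graph_def by fastforce
    show "0 \<in> span (map fst w)" if "walk E u w u" "length w \<le> 3 * 2 ^ (2 * \<delta>)" for u w
    proof -
      have "map fst w \<in> words_ok" using g(2)[unfolded walks_good_def, rule_format, OF that(1) le_SucI[OF that(2)]] .
      then show ?thesis by simp
    qed
  qed
  have "finite V" using g(1) unfolding graph_def by blast
  then obtain xs where xs: "set xs = V" "distinct xs" using finite_distinct_list by blast
  define ys where "ys = sort_key r xs"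
  have ys: "set ys = V" "distinct ys" "sorted (map r ys)" unfolding ys_def using xs by auto
  define m where "m = length ys"
  define D where "D i j = (if i = j then 0 else dst (ys ! i) (ys ! j))" for i j
  define \<omega> where "\<omega> v = (THE i. i < m \<and> ys ! i = v)" for v
  have \<omega>: "\<omega> v < m \<and> ys ! (\<omega> v) = v" if v: "v \<in> V" for v
  proof -
    have "v \<in> set ys" using v ys(1) by simp
    then obtain i where "i < m" "ys ! i = v" unfolding m_def in_set_conv_nth by blast
    have "\<omega> v = i"
      unfolding \<omega>_def
    proof (rule the_equality)
      show "i < m \<and> ys ! i = v" using \<open>i < m\<close> \<open>ys ! i = v\<close> by blast
      show "j = i" if "j < m \<and> ys ! j = v" for j
        using nth_eq_iff_index_eq[OF ys(2), of j i] that \<open>i < m\<close> \<open>ys ! i = v\<close> by (simp add: m_def)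
    qed
    then show ?thesis using \<open>i < m\<close> \<open>ys ! i = v\<close> by simp
  qed
  have mono: "\<omega> u < \<omega> v" if "u \<in> V" "v \<in> V" "r u < r v" for u v
  proof (rule ccontr)
    assume "\<not> \<omega> u < \<omega> v"
    then have "r (ys ! \<omega> v) \<le> r (ys ! \<omega> u)" using ys(3) \<omega> that unfolding m_def
      by (metis leI length_map nth_map sorted_nth_mono)
    then show False using \<omega> that by auto
  qed
  have D: "space m D"
    by (rule spaceI) (use dst_sym dst_bounds dst_allowed in \<open>auto simp: D_def\<close>)
  have c: "compose {..<n} \<omega> \<alpha> \<in> maps n lab m D" if \<alpha>: "\<alpha> \<in> copies n lab V E r" for n lab \<alpha>
    unfolding copies_def
  proof (intro CollectI conjI allI impI)
    have V: "\<alpha> i \<in> V" if "i < n" for i using \<alpha> that unfolding copies_def by auto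
    show "compose {..<n} \<omega> \<alpha> \<in> {..<n} \<rightarrow>\<^sub>E {..<m}" using V \<omega> by (auto simp: compose_def)
    fix i j assume ij: "i < n" "j < n" "i < j"
    have *: "r (\<alpha> i) < r (\<alpha> j)" "E (\<alpha> i) (lab i j) (\<alpha> j)" using \<alpha> ij unfolding copies_def by auto
    then have "\<omega> (\<alpha> i) < \<omega> (\<alpha> j)" using mono V ij by blast
    moreover have "D (\<omega> (\<alpha> i)) (\<omega> (\<alpha> j)) = lab i j" using dst_edge[OF *(2)] \<omega> V ij calculation by (simp add: D_def)
    ultimately show "id (compose {..<n} \<omega> \<alpha> i) < id (compose {..<n} \<omega> \<alpha> j)"
      "pattern_edge m D (compose {..<n} \<omega> \<alpha> i) (lab i j) (compose {..<n} \<omega> \<alpha> j)"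
      using ij \<omega> V by (auto simp: compose_def pattern_edge_def)
  qed
  have "\<exists>\<beta>\<in>maps b DB m D. \<forall>e\<in>maps a DA b DB. \<forall>e'\<in>maps a DA b DB.
        col (compose {..<a} \<beta> e) = col (compose {..<a} \<beta> e')" if col: "\<forall>x. col x < k" for col :: "(nat \<Rightarrow> nat) \<Rightarrow> nat"
  proof -
    obtain \<beta> where \<beta>: "\<beta> \<in> copies b DB V E r" "\<And>e e'. e\<in>maps a DA b DB \<Longrightarrow> e'\<in>maps a DA b DB \<Longrightarrow>
        col (compose {..<a} \<omega> (compose {..<a} \<beta> e)) = col (compose {..<a} \<omega> (compose {..<a} \<beta> e'))"
      using g(3)[unfolded arrows_def, rule_format, of "\<lambda>\<alpha>. col (compose {..<a} \<omega> \<alpha>)"] col by blast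
    have "compose {..<a} (compose {..<b} \<omega> \<beta>) e = compose {..<a} \<omega> (compose {..<a} \<beta> e)"
      if "e\<in>maps a DA b DB" for e
      using that unfolding copies_def by (auto simp: compose_def fun_eq_iff PiE_iff)
    then show ?thesis using c[OF \<beta>(1)] \<beta>(2) by metis
  qed
  then show ?thesis using D unfolding arrows_def by blast
qed

section \<open>Ordered structures as enumerated spaces\<close>

definition ospace :: "(nat with_order, 'a) struct \<Rightarrow> nat \<Rightarrow> (nat \<Rightarrow> nat \<Rightarrow> nat) \<Rightarrow> (nat \<Rightarrow> 'a) \<Rightarrow> bool" where
  "ospace S n D e \<longleftrightarrow> space n D \<and> inj_on e {..<n} \<and> verts S = e ` {..<n} \<and>
     (\<forall>i<n. \<forall>j<n. ((e i, e j) \<in> rels S Leq \<longleftrightarrow> i \<le> j) \<and> (\<forall>s. (e i, e j) \<in> rels S (Sym s) \<longleftrightarrow> s \<in> {1..\<delta>} \<and> D i j = s))"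

lemma metric_class_space:
  assumes "finite V" "valued_metric \<delta> V d"
    "\<forall>u\<in>V. \<forall>v\<in>V. \<forall>w\<in>V. u \<noteq> v \<and> v \<noteq> w \<and> u \<noteq> w \<longrightarrow> allowed_triangle K1 K2 C0 C1 (d u v) (d v w) (d u w)"
    and e: "inj_on e {..<n}" "e ` {..<n} \<subseteq> V"
  shows "space n (\<lambda>i j. d (e i) (e j))"
proof -
  interpret Metric_space V "\<lambda>x y. real (d x y)" using assms(2) unfolding valued_metric_def by blast
  have V: "e i \<in> V" if "i < n" for i using that e(2) by auto
  have ne: "e i \<noteq> e j" if "i < n" "j < n" "i \<noteq> j" for i j using that e(1) by (auto simp: inj_on_def)
  have com: "d x y = d y x" for x y using commute[of x y] by simp
  have tri: "d x z \<le> d x y + d y z" if "x \<in> V" "y \<in> V" "z \<in> V" for x y z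
    using triangle[OF that] by linarith
  show ?thesis
  proof (rule spaceI)
    show "d (e i) (e i) = 0" if "i < n" for i using zero[OF V[OF that] V[OF that]] by simp
    show "d (e i) (e j) = d (e j) (e i)" for i j by (rule com)
    show "1 \<le> d (e i) (e j) \<and> d (e i) (e j) \<le> \<delta>" if "i < n" "j < n" "i \<noteq> j" for i j
      using assms(2) V[OF that(1)] V[OF that(2)] ne[OF that] zero[of "e i" "e j"] unfolding valued_metric_def by auto
    fix i j k assume *: "i < n" "j < n" "k < n" "i \<noteq> j" "j \<noteq> k" "i \<noteq> k"
    then have "allowed_triangle K1 K2 C0 C1 (d (e i) (e j)) (d (e j) (e k)) (d (e i) (e k))"
      using assms(3) V ne by meson
    then show "tri (d (e i) (e j)) (d (e j) (e k)) (d (e i) (e k))"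
      unfolding allowed_iff using tri[of "e i" "e k" "e j"] tri[of "e i" "e j" "e k"] tri[of "e j" "e i" "e k"] V * com by auto
  qed
qed

lemma space_metric_class:
  assumes D: "space n D" and e: "inj_on e {..<n}"
  defines "ix \<equiv> inv_into {..<n} e"
  shows "metric_struct \<delta> (e ` {..<n}) (\<lambda>x y. D (ix x) (ix y)) \<in> metric_class \<delta> K1 K2 C0 C1"
proof -
  have ix: "ix x < n \<and> e (ix x) = x" if "x \<in> e ` {..<n}" for x
    using that inv_into_into[OF that] f_inv_into_f[OF that] unfolding ix_def by simp
  \<comment> \<open>\<open>inv_into\<close> is arbitrary outside the vertices, where
    \<open>Metric_space\<close> still asks for symmetry; hence the value 0 there.\<close>
  define d where "d x y = (if x \<in> e ` {..<n} \<and> y \<in> e ` {..<n} then D (ix x) (ix y) else 0)" for x y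
  have allowed: "tri (D i j) (D j k) (D i k)" if "i < n" "j < n" "k < n" for i j k
    using D that unfolding space_def by blast
  have D0: "D i j = 0 \<longleftrightarrow> i = j" if "i < n" "j < n" for i j
  proof (cases "i = j")
    case False
    then have "1 \<le> D i j" using D that unfolding space_def by blast
    then show ?thesis using False by simp
  qed (use D that in \<open>simp add: space_def\<close>)
  have Ds: "D i j = D j i" "D i j \<le> \<delta>" if "i < n" "j < n" for i j
    using D that unfolding space_def by blast+
  have "Metric_space (e ` {..<n}) (\<lambda>x y. real (d x y))"
  proof
    show "0 \<le> real (d x y)" for x y by simp
    show "real (d x y) = real (d y x)" for x y
      using Ds(1)[of "ix x" "ix y"] ix[of x] ix[of y] unfolding d_def by simp
    show "real (d x y) = 0 \<longleftrightarrow> x = y" if "x \<in> e ` {..<n}" "y \<in> e ` {..<n}" for x y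
    proof -
      have "x = y \<longleftrightarrow> ix x = ix y" using ix[OF that(1)] ix[OF that(2)] by metis
      then show ?thesis using D0[of "ix x" "ix y"] ix[OF that(1)] ix[OF that(2)] that by (simp add: d_def)
    qed
    show "real (d x z) \<le> real (d x y) + real (d y z)" if "x \<in> e ` {..<n}" "y \<in> e ` {..<n}" "z \<in> e ` {..<n}" for x y z
      using allowed_metric[OF allowed[of "ix x" "ix y" "ix z"]] ix[OF that(1)] ix[OF that(2)] ix[OF that(3)] that by (simp add: d_def)
  qed
  moreover have "\<forall>x\<in>e ` {..<n}. \<forall>y\<in>e ` {..<n}. d x y \<le> \<delta>"
  proof (intro ballI)
    fix x y assume "x \<in> e ` {..<n}" "y \<in> e ` {..<n}"
    then show "d x y \<le> \<delta>" using Ds(2)[of "ix x" "ix y"] ix[of x] ix[of y] by (simp add: d_def)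
  qed
  ultimately have "valued_metric \<delta> (e ` {..<n}) d" unfolding valued_metric_def by blast
  moreover have "allowed_triangle K1 K2 C0 C1 (d u v) (d v w) (d u w)" if "u \<in> e ` {..<n}" "v \<in> e ` {..<n}" "w \<in> e ` {..<n}" for u v w
    using allowed[of "ix u" "ix v" "ix w"] ix[OF that(1)] ix[OF that(2)] ix[OF that(3)] that
    unfolding allowed_iff by (simp only: d_def if_True simp_thms)
  moreover have "metric_struct \<delta> (e ` {..<n}) (\<lambda>x y. D (ix x) (ix y)) = metric_struct \<delta> (e ` {..<n}) d"
  proof -
    have eq: "{(x, y). x \<in> e ` {..<n} \<and> y \<in> e ` {..<n} \<and> D (ix x) (ix y) = s} = {(x, y). x \<in> e ` {..<n} \<and> y \<in> e ` {..<n} \<and> d x y = s}" for s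
      unfolding d_def by (rule Collect_cong) (simp split: prod.split cong: conj_cong)
    show ?thesis unfolding metric_struct_def eq ..
  qed
  ultimately show ?thesis unfolding metric_class_def by blast
qed

lemma ospace_ex:
  assumes "S \<in> ordered_metric_class \<delta> K1 K2 C0 C1"
  shows "\<exists>n D e. ospace S n D e"
proof -
  have S: "reduct S \<in> metric_class \<delta> K1 K2 C0 C1" "linear_order_on (verts S) (rels S Leq)"
    using assms unfolding ordered_metric_class_def order_expansions_def by auto
  from S(1) obtain V d where V: "reduct S = metric_struct \<delta> V d" "finite V" "valued_metric \<delta> V d"
    "\<forall>u\<in>V. \<forall>v\<in>V. \<forall>w\<in>V. u \<noteq> v \<and> v \<noteq> w \<and> u \<noteq> w \<longrightarrow> allowed_triangle K1 K2 C0 C1 (d u v) (d v w) (d u w)"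
    unfolding metric_class_def mem_Collect_eq by (elim exE conjE)
  have r: "verts S = V" "\<And>s. rels S (Sym s) = (if s \<in> {1..\<delta>} then {(x, y). x \<in> V \<and> y \<in> V \<and> d x y = s} else {})"
    using V(1) unfolding reduct_def metric_struct_def by (auto simp: fun_eq_iff)
  obtain e where e: "bij_betw e {..<card V} V" "\<And>i j. i < card V \<Longrightarrow> j < card V \<Longrightarrow> (e i, e j) \<in> rels S Leq \<longleftrightarrow> i \<le> j"
    using finite_linear_order_enum[OF V(2)] S(2) r(1) by metis
  have "space (card V) (\<lambda>i j. d (e i) (e j))"
    using metric_class_space[OF V(2-4)] e(1) unfolding bij_betw_def by blast
  then have "ospace S (card V) (\<lambda>i j. d (e i) (e j)) e"
    unfolding ospace_def
  proof (intro conjI allI impI)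
    show "inj_on e {..<card V}" "verts S = e ` {..<card V}" using e(1) r(1) unfolding bij_betw_def by auto
    fix i j s assume ij: "i < card V" "j < card V"
    show "(e i, e j) \<in> rels S Leq \<longleftrightarrow> i \<le> j" by (rule e(2)[OF ij])
    have "e i \<in> V" "e j \<in> V" using bij_betwE[OF e(1)] ij by auto
    then show "(e i, e j) \<in> rels S (Sym s) \<longleftrightarrow> s \<in> {1..\<delta>} \<and> d (e i) (e j) = s" unfolding r(2) by (cases "s \<in> {1..\<delta>}") auto
  qed
  then show ?thesis by blast
qed

lemma ospace_class:
  assumes D: "space n D" and e: "inj_on e {..<n}"
  shows "\<exists>S\<in>ordered_metric_class \<delta> K1 K2 C0 C1. ospace S n D e"
proof -
  let ?X = "metric_struct \<delta> (e ` {..<n}) (\<lambda>x y. D (inv_into {..<n} e x) (inv_into {..<n} e y))"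
  define S where "S = \<lparr>verts = e ` {..<n}, rels = (\<lambda>s. case s of Leq \<Rightarrow> {(e i, e j) | i j. i \<le> j \<and> j < n} | Sym t \<Rightarrow> rels ?X t)\<rparr>"
  have "reduct S = ?X" unfolding S_def reduct_def by (simp add: metric_struct_def)
  then have "reduct S \<in> metric_class \<delta> K1 K2 C0 C1" using space_metric_class[OF D e] by simp
  moreover have ei: "e i = e j \<longleftrightarrow> i = j" if "i < n" "j < n" for i j using that e by (auto simp: inj_on_def)
  have leq: "(e i, e j) \<in> rels S Leq \<longleftrightarrow> i \<le> j" if "i < n" "j < n" for i j
  proof
    assume "(e i, e j) \<in> rels S Leq"
    then obtain i' j' where "e i = e i'" "e j = e j'" "i' \<le> j'" "j' < n" unfolding S_def by auto
    then show "i \<le> j" using that ei by (metis le_less_trans)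
  qed (use that in \<open>auto simp: S_def\<close>)
  have R: "rels S Leq \<subseteq> verts S \<times> verts S" unfolding S_def by auto
  have "linear_order_on (verts S) (rels S Leq)"
    unfolding linear_order_on_def partial_order_on_def preorder_on_def
  proof (intro conjI R)
    show "refl_on (verts S) (rels S Leq)" unfolding refl_on_def using R leq by (auto simp: S_def)
    show "trans (rels S Leq)"
    proof (rule transI)
      fix x y z assume "(x, y) \<in> rels S Leq" "(y, z) \<in> rels S Leq"
      moreover from this obtain i j k where "x = e i" "y = e j" "z = e k" "i < n" "j < n" "k < n" using R unfolding S_def by auto
      ultimately show "(x, z) \<in> rels S Leq" using leq by simp
    qed
    show "antisym (rels S Leq)"
    proof (rule antisymI)
      fix x y assume "(x, y) \<in> rels S Leq" "(y, x) \<in> rels S Leq"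
      moreover from this obtain i j where "x = e i" "y = e j" "i < n" "j < n" using R unfolding S_def by auto
      ultimately show "x = y" using leq by simp
    qed
    show "total_on (verts S) (rels S Leq)"
      unfolding total_on_def
    proof (intro ballI impI)
      fix x y assume "x \<in> verts S" "y \<in> verts S"
      then obtain i j where "x = e i" "y = e j" "i < n" "j < n" unfolding S_def by auto
      then show "(x, y) \<in> rels S Leq \<or> (y, x) \<in> rels S Leq" using leq by (cases "i \<le> j") auto
    qed
  qed
  ultimately have "S \<in> ordered_metric_class \<delta> K1 K2 C0 C1" unfolding ordered_metric_class_def order_expansions_def by blast
  moreover have "ospace S n D e"
    unfolding ospace_def using D e leq by (auto simp: S_def metric_struct_def)
  ultimately show ?thesis by blast
qed

text \<open>Transports a map of positions to the vertices; all embeddings of ordered spaces arise in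
  this way from \<open>maps\<close>.\<close>

definition hat :: "nat \<Rightarrow> (nat \<Rightarrow> 'a) \<Rightarrow> (nat \<Rightarrow> 'b) \<Rightarrow> (nat \<Rightarrow> nat) \<Rightarrow> 'a \<Rightarrow> 'b" where
  "hat a eA e g = restrict (\<lambda>x. e (g (inv_into {..<a} eA x))) (eA ` {..<a})"

lemma hat_apply: "inj_on eA {..<a} \<Longrightarrow> i < a \<Longrightarrow> hat a eA e g (eA i) = e (g i)"
  unfolding hat_def by (simp add: inv_into_f_f)

lemma copies_index:
  assumes "space a DA" "space m D" "g \<in> maps a DA m D" "i < a" "j < a"
  shows "g i < m" "g i \<le> g j \<longleftrightarrow> i \<le> j" "D (g i) (g j) = DA i j"
proof -
  have g: "g i < m" "i < j \<Longrightarrow> g i < g j \<and> D (g i) (g j) = DA i j" if "i < a" "j < a" for i j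
    using assms(3) that unfolding copies_def pattern_edge_def by auto
  show "g i < m" using g assms by blast
  show "g i \<le> g j \<longleftrightarrow> i \<le> j" using g(2)[OF assms(4,5)] g(2)[OF assms(5,4)] by (cases i j rule: linorder_cases) auto
  have "D u v = D v u \<and> D u u = 0" if "u < m" "v < m" for u v using assms(2) that unfolding space_def by blast
  moreover have "DA i j = DA j i \<and> DA i i = 0" using assms(1,4,5) unfolding space_def by blast
  ultimately show "D (g i) (g j) = DA i j"
    using g[OF assms(4,5)] g[OF assms(5,4)] by (cases i j rule: linorder_cases) auto
qed

lemma hat_embedding:
  assumes A: "ospace A a DA eA" and C: "ospace C' m D e" and g: "g \<in> maps a DA m D"
  shows "hat a eA e g \<in> embeddings A C'"
proof -
  have A': "space a DA" "inj_on eA {..<a}" "verts A = eA ` {..<a}" and C'': "space m D" "inj_on e {..<m}" "verts C' = e ` {..<m}"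
    using A C unfolding ospace_def by auto
  note gi = copies_index[OF A'(1) C''(1) g]
  note h = hat_apply[OF A'(2), of _ e g]
  show ?thesis
    unfolding embeddings_def
  proof (intro CollectI conjI allI ballI)
    show "hat a eA e g \<in> verts A \<rightarrow>\<^sub>E verts C'"
      unfolding A'(3) C''(3)
    proof (rule PiE_I)
      fix x assume "x \<in> eA ` {..<a}"
      then show "hat a eA e g x \<in> e ` {..<m}" using h gi(1) by auto
    next
      fix x assume "x \<notin> eA ` {..<a}"
      then show "hat a eA e g x = undefined" by (simp add: hat_def)
    qed
    show "inj_on (hat a eA e g) (verts A)"
      unfolding A'(3)
    proof (rule inj_onI)
      fix x y assume "x \<in> eA ` {..<a}" "y \<in> eA ` {..<a}" and eq: "hat a eA e g x = hat a eA e g y"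
      then obtain i j where ij: "x = eA i" "y = eA j" "i < a" "j < a" by auto
      then have "e (g i) = e (g j)" using eq h by simp
      then have "g i = g j" using C''(2) gi(1) ij by (auto simp: inj_on_def)
      then have "i = j" using gi(2)[OF ij(3,4)] gi(2)[OF ij(4,3)] by simp
      then show "x = y" using ij by simp
    qed
    fix s x y assume "x \<in> verts A" "y \<in> verts A"
    then obtain i j where ij: "x = eA i" "y = eA j" "i < a" "j < a" using A'(3) by auto
    then show "(x, y) \<in> rels A s \<longleftrightarrow> (hat a eA e g x, hat a eA e g y) \<in> rels C' s"
      using A C gi[OF ij(3,4)] gi(1)[OF ij(4,3)] h unfolding ospace_def by (cases s) simp_all
  qed
qed

lemma embedding_hat:
  assumes A: "ospace A a DA eA" and C: "ospace C' m D e" and \<phi>: "\<phi> \<in> embeddings A C'"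
  shows "\<exists>g\<in>maps a DA m D. \<phi> = hat a eA e g"
proof -
  have A': "space a DA" "inj_on eA {..<a}" "verts A = eA ` {..<a}" and C'': "space m D" "inj_on e {..<m}" "verts C' = e ` {..<m}"
    using A C unfolding ospace_def by auto
  have f: "\<phi> \<in> verts A \<rightarrow>\<^sub>E verts C'" "inj_on \<phi> (verts A)"
    "\<And>s i j. i < a \<Longrightarrow> j < a \<Longrightarrow> (eA i, eA j) \<in> rels A s \<longleftrightarrow> (\<phi> (eA i), \<phi> (eA j)) \<in> rels C' s"
    using \<phi> A'(3) unfolding embeddings_def by auto
  define g where "g = restrict (\<lambda>i. inv_into {..<m} e (\<phi> (eA i))) {..<a}"
  have g: "g i < m" "e (g i) = \<phi> (eA i)" if "i < a" for i
  proof -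
    have "\<phi> (eA i) \<in> e ` {..<m}" using f(1) that A'(3) C''(3) by auto
    then show "g i < m" "e (g i) = \<phi> (eA i)" using inv_into_into[of "\<phi> (eA i)" e "{..<m}"] f_inv_into_f[of "\<phi> (eA i)" e "{..<m}"] that
      unfolding g_def by auto
  qed
  have "g \<in> maps a DA m D"
    unfolding copies_def
  proof (intro CollectI conjI allI impI)
    show "g \<in> {..<a} \<rightarrow>\<^sub>E {..<m}" using g(1) unfolding g_def by auto
    fix i j assume ij: "i < a" "j < a" "i < j"
    have "eA i \<noteq> eA j" using inj_onD[OF A'(2), of i j] ij by auto
    then have "\<phi> (eA i) \<noteq> \<phi> (eA j)" using inj_onD[OF f(2), of "eA i" "eA j"] A'(3) ij by auto
    then have ne: "g i \<noteq> g j" using g ij by metis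
    have "(eA i, eA j) \<in> rels A Leq" using A ij unfolding ospace_def by simp
    then have "(e (g i), e (g j)) \<in> rels C' Leq" using f(3) g ij by simp
    then have "g i \<le> g j" using C g(1) ij unfolding ospace_def by blast
    then show "id (g i) < id (g j)" using ne by simp
    have "DA i j \<in> {1..\<delta>}" using A'(1) ij unfolding space_def by auto
    then have "(eA i, eA j) \<in> rels A (Sym (DA i j))" using A ij unfolding ospace_def by blast
    then have "(e (g i), e (g j)) \<in> rels C' (Sym (DA i j))" using f(3) g ij by simp
    then have "D (g i) (g j) = DA i j" using C g(1) ij unfolding ospace_def by blast
    then show "pattern_edge m D (g i) (DA i j) (g j)" using ne g(1) ij unfolding pattern_edge_def by simp
  qed
  moreover have "\<phi> = hat a eA e g"
  proof
    fix x
    show "\<phi> x = hat a eA e g x"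
    proof (cases "x \<in> eA ` {..<a}")
      case True
      then show ?thesis using hat_apply[OF A'(2), of _ e g] g(2) by auto
    next
      case False
      then show ?thesis using f(1) A'(3) by (auto simp: hat_def)
    qed
  qed
  ultimately show ?thesis by blast
qed

lemma copies_compose:
  assumes "\<beta> \<in> maps b DB m D" "g \<in> maps a DA b DB"
  shows "compose {..<a} \<beta> g \<in> maps a DA m D"
  unfolding copies_def
proof (intro CollectI conjI allI impI)
  have gb: "g i < b" if "i < a" for i using assms(2) that unfolding copies_def by auto
  have \<beta>: "\<beta> i < m" if "i < b" for i using assms(1) that unfolding copies_def by auto
  show "compose {..<a} \<beta> g \<in> {..<a} \<rightarrow>\<^sub>E {..<m}" using gb \<beta> by (auto simp: compose_def)
  fix i j assume ij: "i < a" "j < a" "i < j"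
  then have "g i < g j" "DA i j = DB (g i) (g j)" using assms(2) unfolding copies_def pattern_edge_def by auto
  then show "id (compose {..<a} \<beta> g i) < id (compose {..<a} \<beta> g j)"
    "pattern_edge m D (compose {..<a} \<beta> g i) (DA i j) (compose {..<a} \<beta> g j)"
    using assms(1) gb ij unfolding copies_def by (auto simp: compose_def)
qed

theorem ramsey:
  "ramsey_property (ordered_metric_class \<delta> K1 K2 C0 C1 :: (nat with_order, 'a::infinite) struct set)"
  unfolding ramsey_property_def
proof (intro ballI allI impI)
  fix A B :: "(nat with_order, 'a) struct" and k :: nat
  assume "A \<in> ordered_metric_class \<delta> K1 K2 C0 C1" "B \<in> ordered_metric_class \<delta> K1 K2 C0 C1" and k: "1 \<le> k"
  then obtain a DA eA b DB eB where A: "ospace A a DA eA" and B: "ospace B b DB eB"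
    using ospace_ex by metis
  obtain m D where D: "space m D" and ar: "arrows k a DA b DB {..<m} (pattern_edge m D) id"
    using space_arrows[OF _ _ k] A B unfolding ospace_def by metis
  \<comment> \<open>Infinity of \<open>'a\<close> leaves room to place the positions
    \<open>{..<m}\<close> inside the vertex type, whatever \<open>m\<close> is.\<close>
  obtain e :: "nat \<Rightarrow> 'a" where "inj e" using infinite_countable_subset[OF infinite_UNIV] by blast
  then obtain C' where C': "C' \<in> ordered_metric_class \<delta> K1 K2 C0 C1" "ospace C' m D e"
    using ospace_class[OF D, of e] inj_on_subset by blast
  have vA: "verts A = eA ` {..<a}" "inj_on eA {..<a}" "inj_on eB {..<b}" using A B unfolding ospace_def by auto
  have "\<forall>c\<in>embeddings A C' \<rightarrow> {..<k}. \<exists>\<beta>\<in>embeddings B C'.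
          \<forall>\<alpha>\<^sub>1\<in>embeddings A B. \<forall>\<alpha>\<^sub>2\<in>embeddings A B. c (compose (verts A) \<beta> \<alpha>\<^sub>1) = c (compose (verts A) \<beta> \<alpha>\<^sub>2)"
  proof
    fix c assume c: "c \<in> embeddings A C' \<rightarrow> {..<k}"
    \<comment> \<open>\<open>arrows\<close> colours all functions; the default 0 is a legal colour
      because \<open>k \<ge> 1\<close>.\<close>
    define c' where "c' g = (if g \<in> maps a DA m D then c (hat a eA e g) else 0)" for g
    have "\<forall>g. c' g < k" unfolding c'_def using c hat_embedding[OF A C'(2)] k by auto
    then obtain \<beta> where \<beta>: "\<beta> \<in> maps b DB m D"
      and mono: "\<And>g g'. g \<in> maps a DA b DB \<Longrightarrow> g' \<in> maps a DA b DB \<Longrightarrow>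
        c' (compose {..<a} \<beta> g) = c' (compose {..<a} \<beta> g')"
      using ar unfolding arrows_def by meson
    have comp: "compose (verts A) (hat b eB e \<beta>) (hat a eA eB g) = hat a eA e (compose {..<a} \<beta> g)"
      if g: "g \<in> maps a DA b DB" for g
    proof
      fix x
      show "compose (verts A) (hat b eB e \<beta>) (hat a eA eB g) x = hat a eA e (compose {..<a} \<beta> g) x"
      proof (cases "x \<in> verts A")
        case True
        then obtain i where i: "x = eA i" "i < a" using vA by auto
        have "g i < b" using g i unfolding copies_def by auto
        then show ?thesis
          using i True hat_apply[OF vA(2) i(2), of eB g] hat_apply[OF vA(2) i(2), of e "compose {..<a} \<beta> g"]
            hat_apply[OF vA(3), of "g i" e \<beta>] by (simp add: compose_def)
      next
        case False
        then show ?thesis using vA by (simp add: compose_def hat_def)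
      qed
    qed
    show "\<exists>\<beta>\<in>embeddings B C'. \<forall>\<alpha>\<^sub>1\<in>embeddings A B. \<forall>\<alpha>\<^sub>2\<in>embeddings A B. c (compose (verts A) \<beta> \<alpha>\<^sub>1) = c (compose (verts A) \<beta> \<alpha>\<^sub>2)"
    proof (rule bexI[OF _ hat_embedding[OF B C'(2) \<beta>]], intro ballI)
      fix \<alpha> \<alpha>' assume "\<alpha> \<in> embeddings A B" "\<alpha>' \<in> embeddings A B"
      then obtain g g' where g: "g \<in> maps a DA b DB" "g' \<in> maps a DA b DB"
        "\<alpha> = hat a eA eB g" "\<alpha>' = hat a eA eB g'" using embedding_hat[OF A B] by meson
      show "c (compose (verts A) (hat b eB e \<beta>) \<alpha>) = c (compose (verts A) (hat b eB e \<beta>) \<alpha>')"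
        using mono[OF g(1,2)] copies_compose[OF \<beta>] g comp unfolding c'_def by simp
    qed
  qed
  then show "\<exists>C\<in>(ordered_metric_class \<delta> K1 K2 C0 C1 :: (nat with_order, 'a) struct set). \<forall>c\<in>embeddings A C \<rightarrow> {..<k}. \<exists>\<beta>\<in>embeddings B C.
          \<forall>\<alpha>\<^sub>1\<in>embeddings A B. \<forall>\<alpha>\<^sub>2\<in>embeddings A B. c (compose (verts A) \<beta> \<alpha>\<^sub>1) = c (compose (verts A) \<beta> \<alpha>\<^sub>2)"
    using C'(1) by blast
qed

end

section \<open>The expansion property\<close>

lemma linear_order_embedding_iff:
  assumes "linear_order_on X r" "linear_order_on Y s" "inj_on f X"
    and le: "\<And>x y. x \<in> X \<Longrightarrow> y \<in> X \<Longrightarrow> (x, y) \<in> r \<Longrightarrow> (f x, f y) \<in> s"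
    and "x \<in> X" "y \<in> X"
  shows "(x, y) \<in> r \<longleftrightarrow> (f x, f y) \<in> s"
proof
  assume xy: "(f x, f y) \<in> s"
  show "(x, y) \<in> r"
  proof (rule ccontr)
    assume n: "(x, y) \<notin> r"
    have "refl_on X r" "total_on X r" "antisym s"
      using assms(1,2) unfolding linear_order_on_def partial_order_on_def preorder_on_def by auto
    moreover from this n have "x \<noteq> y" using assms(5) unfolding refl_on_def by auto
    ultimately have "(y, x) \<in> r" using n assms(5,6) unfolding total_on_def by blast
    then have "(f y, f x) \<in> s" using le assms by blast
    then have "f x = f y" using xy \<open>antisym s\<close> unfolding antisym_def by blast
    then show False using \<open>x \<noteq> y\<close> assms(3,5,6) unfolding inj_on_def by blast
  qed
qed (use assms in blast)

context magic begin

text \<open>A list of blocks, one for each enumeration in \<open>\<sigma>s\<close>: the even positions of a block form a copy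
  of the given space, and the odd positions are at distance \<open>M\<close> from everything.\<close>

definition blocks :: "nat \<Rightarrow> ('a \<Rightarrow> 'a \<Rightarrow> nat) \<Rightarrow> (nat \<Rightarrow> 'a) list \<Rightarrow> nat \<Rightarrow> nat \<Rightarrow> nat" where
  "blocks n d \<sigma>s p q = (if p = q then 0
     else if p div (2 * n) = q div (2 * n) \<and> even (p mod (2 * n)) \<and> even (q mod (2 * n))
     then d ((\<sigma>s ! (p div (2 * n))) (p mod (2 * n) div 2)) ((\<sigma>s ! (p div (2 * n))) (q mod (2 * n) div 2)) else M)"

lemma M_bounds: "1 \<le> M" "M \<le> \<delta>"
  using M acc by auto

text \<open>Either all three points lie in one copy of the given space, or at least two of the three
  sides are \<open>M\<close> and \<open>allowed_M_M\<close> applies.\<close>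

lemma space_blocks:
  assumes d: "\<And>\<sigma>. \<sigma> \<in> set \<sigma>s \<Longrightarrow> space n (\<lambda>i j. d (\<sigma> i) (\<sigma> j))" and "0 < n"
  shows "space (length \<sigma>s * (2 * n)) (blocks n d \<sigma>s)"
proof -
  define N where "N = length \<sigma>s * (2 * n)"
  define same where "same p q \<longleftrightarrow> p div (2 * n) = q div (2 * n) \<and> even (p mod (2 * n)) \<and> even (q mod (2 * n))" for p q
  define ix where "ix p = p mod (2 * n) div 2" for p
  define D where "D p i j = d ((\<sigma>s ! (p div (2 * n))) i) ((\<sigma>s ! (p div (2 * n))) j)" for p i j
  have b: "blocks n d \<sigma>s p q = (if p = q then 0 else if same p q then D p (ix p) (ix q) else M)" for p q
    unfolding blocks_def same_def ix_def D_def by simp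
  have ix: "ix p < n" for p
  proof -
    have "p mod (2 * n) < 2 * n" using assms(2) by simp
    then show ?thesis unfolding ix_def by linarith
  qed
  have D: "space n (D p)" if "p < N" for p
  proof -
    have "p div (2 * n) < length \<sigma>s" using that unfolding N_def by (simp add: less_mult_imp_div_less)
    then show ?thesis using d nth_mem unfolding D_def by blast
  qed
  have same_ix: "ix p \<noteq> ix q" if "same p q" "p \<noteq> q" for p q
  proof
    assume "ix p = ix q"
    then have "p mod (2 * n) = q mod (2 * n)" using that(1) unfolding ix_def same_def by (metis dvd_div_mult_self)
    then show False using that unfolding same_def by (metis div_mult_mod_eq)
  qed
  have sD: "D p = D q" if "same p q" for p q using that unfolding same_def D_def by auto
  have sym: "same p q \<Longrightarrow> same q p" and trans: "same p q \<Longrightarrow> same q r \<Longrightarrow> same p r" for p q r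
    unfolding same_def by auto
  have Ds: "D p i j = D p j i" "D p i j \<le> \<delta>" "i \<noteq> j \<Longrightarrow> 1 \<le> D p i j" if "p < N" "i < n" "j < n" for p i j
    using D[OF that(1)] that unfolding space_def by blast+
  show ?thesis
    unfolding N_def[symmetric]
  proof (rule spaceI)
    show "blocks n d \<sigma>s p p = 0" for p unfolding b by simp
    fix p q assume pq: "p < N" "q < N"
    show "blocks n d \<sigma>s p q = blocks n d \<sigma>s q p"
      unfolding b using sym[of p q] sym[of q p] sD[of p q] Ds(1)[OF pq(1) ix ix, of p q] by auto
    assume ne: "p \<noteq> q"
    show "1 \<le> blocks n d \<sigma>s p q \<and> blocks n d \<sigma>s p q \<le> \<delta>"
      unfolding b using ne same_ix[of p q] Ds(2,3)[OF pq(1) ix ix, of p q] M_bounds by auto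
    fix r assume r: "r < N" "q \<noteq> r" "p \<noteq> r"
    have a: "tri M M x" "tri M x M" "tri x M M" if "1 \<le> x" "x \<le> \<delta>" for x
      using allowed_M_M[OF that] by (simp_all add: allowed_sym)
    have bd: "1 \<le> D u (ix u) (ix v) \<and> D u (ix u) (ix v) \<le> \<delta>" if "same u v" "u \<noteq> v" "u < N" for u v
      using Ds(2,3)[OF that(3) ix ix] same_ix[OF that(1,2)] by blast
    consider "same p q" "same q r" "same p r" | "same p q" "\<not> same q r" "\<not> same p r" | "\<not> same p q" "same q r" "\<not> same p r"
      | "\<not> same p q" "\<not> same q r" "same p r" | "\<not> same p q" "\<not> same q r" "\<not> same p r"
      using sym trans by blast
    then show "tri (blocks n d \<sigma>s p q) (blocks n d \<sigma>s q r) (blocks n d \<sigma>s p r)"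
    proof cases
      case 1
      have "tri (D p (ix p) (ix q)) (D p (ix q) (ix r)) (D p (ix p) (ix r))"
        using D[OF pq(1)] ix unfolding space_def by blast
      then show ?thesis unfolding b using 1 ne r sD[OF 1(1)] by simp
    next
      case 2
      then show ?thesis unfolding b using a(3) bd[OF 2(1) ne pq(1)] ne r by simp
    next
      case 3
      then show ?thesis unfolding b using a(2) bd[OF 3(2) r(2) pq(2)] ne r by simp
    next
      case 4
      then show ?thesis unfolding b using a(1) bd[OF 4(3) r(3) pq(1)] ne r by simp
    next
      case 5
      then show ?thesis unfolding b using a(1) M_bounds ne r by simp
    qed
  qed
qed

text \<open>For \<open>i < j\<close> the odd position \<open>2 * i + 1\<close> is the separating
  point: it lies between \<open>2 * i\<close> and \<open>2 * j\<close>, at distance \<open>M\<close>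
  from both.\<close>

lemma block_embedding:
  assumes "t < length \<sigma>s" "i < n" "j < n" "i \<noteq> j"
  shows "blocks n d \<sigma>s (t * (2 * n) + 2 * i) (t * (2 * n) + 2 * j) = d ((\<sigma>s ! t) i) ((\<sigma>s ! t) j)"
    "blocks n d \<sigma>s (t * (2 * n) + 2 * i) (t * (2 * n) + (2 * i + 1)) = M"
    "blocks n d \<sigma>s (t * (2 * n) + (2 * i + 1)) (t * (2 * n) + 2 * j) = M"
proof -
  have dm: "(t * (2 * n) + x) div (2 * n) = t" "(t * (2 * n) + x) mod (2 * n) = x" if "x < 2 * n" for x
    using that assms by auto
  have lt: "2 * i < 2 * n" "2 * i + 1 < 2 * n" "2 * j < 2 * n" using assms by auto
  show "blocks n d \<sigma>s (t * (2 * n) + 2 * i) (t * (2 * n) + 2 * j) = d ((\<sigma>s ! t) i) ((\<sigma>s ! t) j)"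
    unfolding blocks_def dm[OF lt(1)] dm[OF lt(3)] using assms by simp
  show "blocks n d \<sigma>s (t * (2 * n) + 2 * i) (t * (2 * n) + (2 * i + 1)) = M"
    unfolding blocks_def dm[OF lt(1)] dm[OF lt(2)] by simp
  have "2 * i + 1 \<noteq> 2 * j" by presburger
  then show "blocks n d \<sigma>s (t * (2 * n) + (2 * i + 1)) (t * (2 * n) + 2 * j) = M"
    unfolding blocks_def dm[OF lt(2)] dm[OF lt(3)] by simp
qed

lemma metric_reduct:
  assumes "reduct S = metric_struct \<delta> V d"
  shows "verts S = V" "x \<in> V \<Longrightarrow> y \<in> V \<Longrightarrow> (x, y) \<in> rels S (Sym s) \<longleftrightarrow> s \<in> {1..\<delta>} \<and> d x y = s"
proof -
  show "verts S = V" using assms unfolding reduct_def metric_struct_def by simp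
  have "rels (reduct S) s = rels (metric_struct \<delta> V d) s" using assms by simp
  then have "rels S (Sym s) = (if s \<in> {1..\<delta>} then {(x, y). x \<in> V \<and> y \<in> V \<and> d x y = s} else {})"
    unfolding reduct_def metric_struct_def by simp
  then show "x \<in> V \<Longrightarrow> y \<in> V \<Longrightarrow> (x, y) \<in> rels S (Sym s) \<longleftrightarrow> s \<in> {1..\<delta>} \<and> d x y = s"
    by (cases "s \<in> {1..\<delta>}") auto
qed

lemma pair_copies:
  assumes "p < q" "q < N" "DB p q = M"
  shows "restrict (\<lambda>i. if i = 0 then p else q) {..<2} \<in> copies 2 (\<lambda>i j. if i = j then 0 else M) {..<N} (pattern_edge N DB) id"
  unfolding copies_def
proof (intro CollectI conjI allI impI)
  fix i j :: nat
  assume "i < 2" "j < 2" "i < j"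
  then have "i = 0" "j = 1" by auto
  then show "id (restrict (\<lambda>i. if i = 0 then p else q) {..<2} i) < id (restrict (\<lambda>i. if i = 0 then p else q) {..<2} j)"
    "pattern_edge N DB (restrict (\<lambda>i. if i = 0 then p else q) {..<2} i) (if i = j then 0 else M) (restrict (\<lambda>i. if i = 0 then p else q) {..<2} j)"
    using assms by (simp_all add: pattern_edge_def)
qed (use assms in auto)

theorem expansion:
  "expansion_property (ordered_metric_class \<delta> K1 K2 C0 C1 :: (nat with_order, 'a::infinite) struct set) (metric_class \<delta> K1 K2 C0 C1)"
  unfolding expansion_property_def
proof
  fix B :: "(nat, 'a) struct"
  assume B: "B \<in> metric_class \<delta> K1 K2 C0 C1"
  then obtain V d where V: "B = metric_struct \<delta> V d" "finite V" "valued_metric \<delta> V d"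
    "\<forall>u\<in>V. \<forall>v\<in>V. \<forall>w\<in>V. u \<noteq> v \<and> v \<noteq> w \<and> u \<noteq> w \<longrightarrow> allowed_triangle K1 K2 C0 C1 (d u v) (d v w) (d u w)"
    unfolding metric_class_def mem_Collect_eq by (elim exE conjE)
  define n where "n = card V"
  show "\<exists>C\<in>(metric_class \<delta> K1 K2 C0 C1 :: (nat, 'a) struct set). \<forall>B'\<in>ordered_metric_class \<delta> K1 K2 C0 C1. \<forall>C'\<in>ordered_metric_class \<delta> K1 K2 C0 C1.
      reduct B' = B \<longrightarrow> reduct C' = C \<longrightarrow> embeddings B' C' \<noteq> {}"
  proof (cases "n = 0")
    case True
    then have "V = {}" using V(2) by (simp add: n_def)
    have "embeddings B' C' \<noteq> {}" if "reduct B' = B" for B' C' :: "(nat with_order, 'a) struct"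
    proof -
      have "verts B' = {}" using metric_reduct(1)[of B' V d] that V(1) \<open>V = {}\<close> by simp
      then have "(\<lambda>_. undefined) \<in> embeddings B' C'" unfolding embeddings_def by simp
      then show ?thesis by blast
    qed
    then show ?thesis using B by blast
  next
    case False
    then have n: "0 < n" by simp
    \<comment> \<open>Every enumeration of \<open>V\<close> gets a block, so one is at hand for each
      order of the given space and for its reverse.\<close>
    have "finite {\<sigma> \<in> {..<n} \<rightarrow>\<^sub>E V. bij_betw \<sigma> {..<n} V}"
      by (rule finite_subset[of _ "{..<n} \<rightarrow>\<^sub>E V"]) (use V(2) in \<open>auto intro: finite_PiE\<close>)
    then obtain \<sigma>s where \<sigma>s: "set \<sigma>s = {\<sigma> \<in> {..<n} \<rightarrow>\<^sub>E V. bij_betw \<sigma> {..<n} V}" using finite_list by metis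
    define N where "N = length \<sigma>s * (2 * n)"
    define DB where "DB = blocks n d \<sigma>s"
    have "space n (\<lambda>i j. d (\<sigma> i) (\<sigma> j))" if "\<sigma> \<in> set \<sigma>s" for \<sigma>
      using metric_class_space[OF V(2-4), of \<sigma> n] that \<sigma>s unfolding bij_betw_def by simp
    then have DB: "space N DB" unfolding N_def DB_def using space_blocks n by blast
    let ?A = "\<lambda>i j :: nat. if i = j then 0 else M"
    have "space 2 ?A" by (rule spaceI) (use M_bounds in auto)
    then obtain m D where D: "space m D" and ar: "arrows 2 2 ?A N DB {..<m} (pattern_edge m D) id"
      using space_arrows[OF _ DB, of 2 ?A 2] by auto
    obtain e :: "nat \<Rightarrow> 'a" where e: "inj e" using infinite_countable_subset[OF infinite_UNIV] by blast
    then have ei: "inj_on e {..<m}" using inj_on_subset by blast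
    define ix where "ix = inv_into {..<m} e"
    have ix: "ix (e i) = i" if "i < m" for i using inv_into_f_f[OF ei] that unfolding ix_def by simp
    have Cm: "metric_struct \<delta> (e ` {..<m}) (\<lambda>x y. D (ix x) (ix y)) \<in> metric_class \<delta> K1 K2 C0 C1"
      unfolding ix_def by (rule space_metric_class[OF D ei])
    have "embeddings B' C' \<noteq> {}" if B'C': "B' \<in> ordered_metric_class \<delta> K1 K2 C0 C1" "C' \<in> ordered_metric_class \<delta> K1 K2 C0 C1"
      and rB: "reduct B' = B" and rC: "reduct C' = metric_struct \<delta> (e ` {..<m}) (\<lambda>x y. D (ix x) (ix y))" for B' C' :: "(nat with_order, 'a) struct"
    proof -
      note rB = metric_reduct[OF rB[unfolded V(1)]] and rC = metric_reduct[OF rC]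
      have lin: "linear_order_on V (rels B' Leq)" "linear_order_on (e ` {..<m}) (rels C' Leq)"
        using B'C' rB(1) rC(1) unfolding ordered_metric_class_def order_expansions_def by auto
      then have C: "refl_on (e ` {..<m}) (rels C' Leq)" "trans (rels C' Leq)" "total_on (e ` {..<m}) (rels C' Leq)"
        unfolding linear_order_on_def partial_order_on_def preorder_on_def by auto
      \<comment> \<open>records whether the order of \<open>C'\<close> agrees with that of the indices\<close>
      define col :: "(nat \<Rightarrow> nat) \<Rightarrow> nat" where "col g = (if (e (g 0), e (g 1)) \<in> rels C' Leq then 0 else 1)" for g
      have "\<forall>g. col g < 2" unfolding col_def by simp
      then obtain \<beta> where \<beta>: "\<beta> \<in> maps N DB m D" and mono:
        "\<And>g g'. g \<in> maps 2 ?A N DB \<Longrightarrow> g' \<in> maps 2 ?A N DB \<Longrightarrow>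
           col (compose {..<2} \<beta> g) = col (compose {..<2} \<beta> g')"
        using ar unfolding arrows_def by meson
      have \<beta>m: "\<beta> p < m" if "p < N" for p using \<beta> that unfolding copies_def by auto
      have eq: "(e (\<beta> p), e (\<beta> q)) \<in> rels C' Leq \<longleftrightarrow> (e (\<beta> p'), e (\<beta> q')) \<in> rels C' Leq"
        if "p < q" "q < N" "DB p q = M" "p' < q'" "q' < N" "DB p' q' = M" for p q p' q'
        using mono[OF pair_copies[where DB = DB, OF that(1-3)] pair_copies[where DB = DB, OF that(4-6)]]
        unfolding col_def by (simp add: compose_def split: if_splits)
      define up where "up \<longleftrightarrow> (\<exists>p q. p < q \<and> q < N \<and> DB p q = M \<and> (e (\<beta> p), e (\<beta> q)) \<in> rels C' Leq)"
      have step: "if up then (e (\<beta> p), e (\<beta> q)) \<in> rels C' Leq else (e (\<beta> q), e (\<beta> p)) \<in> rels C' Leq"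
        if pq: "p < q" "q < N" "DB p q = M" for p q
      proof (cases up)
        case True
        then show ?thesis using eq[OF _ _ _ pq] unfolding up_def by auto
      next
        case False
        then have no: "(e (\<beta> p), e (\<beta> q)) \<notin> rels C' Leq" using pq unfolding up_def by blast
        have "e (\<beta> p) \<in> e ` {..<m}" "e (\<beta> q) \<in> e ` {..<m}" using \<beta>m pq by auto
        then have "(e (\<beta> q), e (\<beta> p)) \<in> rels C' Leq"
          using no C(1,3) unfolding total_on_def refl_on_def by metis
        then show ?thesis using False by simp
      qed
      obtain \<sigma> where \<sigma>: "bij_betw \<sigma> {..<n} V" "\<And>i j. i < n \<Longrightarrow> j < n \<Longrightarrow> (\<sigma> i, \<sigma> j) \<in> rels B' Leq \<longleftrightarrow> i \<le> j"
        using finite_linear_order_enum[OF V(2) lin(1)] unfolding n_def by blast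
      \<comment> \<open>If the order of \<open>C'\<close> reverses the positions, the block of the
        reversed enumeration is taken, so that the two reversals cancel.\<close>
      define \<tau> where "\<tau> = restrict (if up then \<sigma> else (\<lambda>i. \<sigma> (n - 1 - i))) {..<n}"
      have rev: "bij_betw (\<lambda>i. n - 1 - i) {..<n} {..<n}"
        by (rule bij_betw_byWitness[where f' = "\<lambda>i. n - 1 - i"]) auto
      have \<tau>b: "bij_betw \<tau> {..<n} V"
      proof (cases up)
        case True
        then have "bij_betw \<tau> {..<n} V \<longleftrightarrow> bij_betw \<sigma> {..<n} V" by (intro bij_betw_cong) (simp add: \<tau>_def)
        then show ?thesis using \<sigma>(1) by blast
      next
        case False
        then have "bij_betw \<tau> {..<n} V \<longleftrightarrow> bij_betw (\<sigma> \<circ> (\<lambda>i. n - 1 - i)) {..<n} V" by (intro bij_betw_cong) (simp add: \<tau>_def)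
        then show ?thesis using bij_betw_trans[OF rev \<sigma>(1)] by blast
      qed
      have "\<tau> \<in> {..<n} \<rightarrow>\<^sub>E V" using bij_betwE[OF \<tau>b] by (intro PiE_I) (auto simp: \<tau>_def)
      then have "\<tau> \<in> set \<sigma>s" unfolding \<sigma>s using \<tau>b by blast
      then obtain t where t: "t < length \<sigma>s" "\<sigma>s ! t = \<tau>" by (metis in_set_conv_nth)
      have \<tau>o: "(\<tau> i, \<tau> j) \<in> rels B' Leq \<longleftrightarrow> (if up then i \<le> j else j \<le> i)" if "i < n" "j < n" for i j
        using that \<sigma>(2)[of i j] \<sigma>(2)[of "n - 1 - i" "n - 1 - j"] unfolding \<tau>_def by auto
      define pos where "pos i = t * (2 * n) + 2 * i" for i
      have pN: "pos i + 1 < N" if "i < n" for i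
      proof -
        have "pos i + 1 < (t + 1) * (2 * n)" using that unfolding pos_def by simp
        also have "\<dots> \<le> N" unfolding N_def using t(1) by (intro mult_le_mono1) simp
        finally show ?thesis .
      qed
      have DBM: "DB (pos i) (pos i + 1) = M" "DB (pos i + 1) (pos j) = M" "DB (pos i) (pos j) = d (\<tau> i) (\<tau> j)"
        if "i < n" "j < n" "i \<noteq> j" for i j
        using block_embedding[OF t(1) that, where d = d] t(2) unfolding pos_def DB_def by (simp_all add: add.assoc)
      define h where "h i = e (\<beta> (pos i))" for i
      \<comment> \<open>Two comparisons at distance \<open>M\<close>, meeting in the position
        \<open>pos i + 1\<close>, combine by transitivity although \<open>pos i\<close> and
        \<open>pos j\<close> may have any distance.\<close>
      have chain: "if up then (h i, h j) \<in> rels C' Leq else (h j, h i) \<in> rels C' Leq" if ij: "i < j" "j < n" for i j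
      proof -
        have "pos i + 1 < pos j" "i < n" "i \<noteq> j" using ij unfolding pos_def by auto
        then show ?thesis
          using step[of "pos i" "pos i + 1"] step[of "pos i + 1" "pos j"] DBM[of i j] pN[of i] pN[of j] ij C(2)
          unfolding h_def by (auto split: if_splits dest: transD)
      qed
      have hm: "h i \<in> e ` {..<m}" if "i < n" for i using \<beta>m pN[OF that] unfolding h_def by auto
      have hle: "(h i, h j) \<in> rels C' Leq" if "i < n" "j < n" "if up then i \<le> j else j \<le> i" for i j
      proof (cases "i = j")
        case True
        then show ?thesis using C(1) hm[OF that(1)] unfolding refl_on_def by blast
      next
        case False
        then show ?thesis using chain[of i j] chain[of j i] that by (cases up) auto
      qed
      have hD: "D (ix (h i)) (ix (h j)) = d (\<tau> i) (\<tau> j)" if "i < n" "j < n" for i j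
      proof -
        have "D (ix (h i)) (ix (h j)) = DB (pos i) (pos j)"
          using copies_index(3)[OF DB D \<beta>, of "pos i" "pos j"] ix \<beta>m pN[OF that(1)] pN[OF that(2)] unfolding h_def by simp
        also have "\<dots> = d (\<tau> i) (\<tau> j)"
        proof (cases "i = j")
          case True
          have "\<tau> j \<in> V" using bij_betwE[OF \<tau>b] that by auto
          then have "real (d (\<tau> j) (\<tau> j)) = 0" using V(3) Metric_space.zero[of V "\<lambda>x y. real (d x y)"] unfolding valued_metric_def by metis
          then show ?thesis using True unfolding DB_def blocks_def by simp
        qed (use DBM that in blast)
        finally show ?thesis .
      qed
      have hinj: "i = j" if "i < n" "j < n" "h i = h j" for i j
      proof (rule ccontr)
        assume ne: "i \<noteq> j"
        have "\<beta> (pos i) = \<beta> (pos j)" using that(3) e unfolding h_def inj_def by blast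
        moreover have "pos i < pos j \<or> pos j < pos i" using ne unfolding pos_def by auto
        moreover have "\<beta> p < \<beta> q" if "p < q" "p < N" "q < N" for p q using \<beta> that unfolding copies_def by simp
        moreover have "pos i < N" "pos j < N" using pN[OF that(1)] pN[OF that(2)] by linarith+
        ultimately show False by (metis less_irrefl)
      qed
      define \<phi> where "\<phi> = restrict (\<lambda>x. h (inv_into {..<n} \<tau> x)) V"
      have \<phi>: "\<phi> (\<tau> i) = h i" if "i < n" for i
        using that \<tau>b bij_betwE[OF \<tau>b] inv_into_f_f[of \<tau> "{..<n}" i] unfolding \<phi>_def bij_betw_def by simp
      have ex: "\<exists>i<n. x = \<tau> i" if "x \<in> V" for x using \<tau>b that unfolding bij_betw_def by auto
      have inj: "inj_on \<phi> V"
      proof (rule inj_onI)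
        fix x y assume "x \<in> V" "y \<in> V" "\<phi> x = \<phi> y"
        then show "x = y" using ex \<phi> hinj by metis
      qed
      have "\<phi> \<in> embeddings B' C'"
        unfolding embeddings_def rB(1) rC(1)
      proof (intro CollectI conjI allI ballI inj)
        show "\<phi> \<in> V \<rightarrow>\<^sub>E e ` {..<m}"
        proof (rule PiE_I)
          fix x assume "x \<in> V"
          then show "\<phi> x \<in> e ` {..<m}" using ex \<phi> hm by metis
        qed (simp add: \<phi>_def)
        fix s x y assume xy: "x \<in> V" "y \<in> V"
        then obtain i j where ij: "i < n" "j < n" "x = \<tau> i" "y = \<tau> j" using ex by meson
        show "(x, y) \<in> rels B' s \<longleftrightarrow> (\<phi> x, \<phi> y) \<in> rels C' s"
        proof (cases s)
          case Leq
          have "(\<phi> u, \<phi> v) \<in> rels C' Leq" if "u \<in> V" "v \<in> V" "(u, v) \<in> rels B' Leq" for u v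
            using ex[OF that(1)] ex[OF that(2)] \<phi> \<tau>o hle that(3) by metis
          then show ?thesis using linear_order_embedding_iff[OF lin inj _ xy] Leq by blast
        next
          case (Sym u)
          have "(x, y) \<in> rels B' (Sym u) \<longleftrightarrow> u \<in> {1..\<delta>} \<and> d x y = u" by (rule rB(2)[OF xy])
          moreover have "(h i, h j) \<in> rels C' (Sym u) \<longleftrightarrow> u \<in> {1..\<delta>} \<and> D (ix (h i)) (ix (h j)) = u"
            by (rule rC(2)[OF hm[OF ij(1)] hm[OF ij(2)]])
          ultimately show ?thesis using Sym hD[OF ij(1,2)] \<phi>[OF ij(1)] \<phi>[OF ij(2)] ij(3,4) by simp
        qed
      qed
      then show ?thesis by blast
    qed
    then show ?thesis using Cm by blast
  qed
qed

end

theorem theorem6p1: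
  fixes \<delta> K1 K2 C0 C1 :: nat
  assumes "admissible \<delta> K1 K2 C0 C1"
  shows "ramsey_property
           (ordered_metric_class \<delta> K1 K2 C0 C1 :: (nat with_order, 'a::infinite) struct set) \<and>
         expansion_property
           (ordered_metric_class \<delta> K1 K2 C0 C1 :: (nat with_order, 'a) struct set)
           (metric_class \<delta> K1 K2 C0 C1)"
proof -
  obtain M C IIB where "magic \<delta> K1 K2 C0 C1 M C IIB" using admissible_magic[OF assms] .
  then interpret magic \<delta> K1 K2 C0 C1 M C IIB .
  show ?thesis using ramsey expansion by blast
qed

end
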